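(* Let $(S^2,g)$ be the closed two-sphere of constant sectional curvature $3$ and let $(S^4,h)$ be the closed four-sphere of constant sectional curvature $1$. Then $$\mathcal{L}_1(S^2\times S^4,g+ch)=128\pi^3c^{-1}(3c+1)^2(c-1)$$ for all $c>0$. In particular, the Einstein manifold $(S^2\times S^4,g+h)$ is not a critical point of the functional $\mathcal{L}_1$ in the space of Riemannian metrics on $S^2\times S^4$.
   Context: Abstract index notation is used; indices are raised and lowered with the metric, and norms are full contractions (e.g. $\lvert W\rvert^2=W_{ijkl}W^{ijkl}$). $R_{ijkl}$ is the Riemann curvature tensor, with sign such that constant sectional curvature $\mu$ means $R_{ijkl}=\mu(g_{ik}g_{jl}-g_{il}g_{jk})$, and $R_{ij}=R_{isj}{}^s$ is the Ricci tensor. In dimension $n\ge3$: the Schouten tensor is $P_{ij}:=\frac{1}{n-2}(R_{ij}-Jg_{ij})$ with $J:=P_s{}^s$ (equivalently $J=\frac{R}{2(n-1)}$, $R$ the scalar curvature); the Weyl tensor is $W_{ijkl}:=R_{ijkl}-P_{ik}g_{jl}-P_{jl}g_{ik}+P_{il}g_{jk}+P_{jk}g_{il}$; the Cotton tensor is $C_{ijk}:=\nabla_iP_{jk}-\nabla_jP_{ik}$. On a closed six-manifold $\mathcal{L}_1(M,g):=\int_M L_1^g\,\mathrm{dvol}_g$, where, with $\Delta=\nabla^s\nabla_s$, $$L_1:=2\Delta\lvert W\rvert^2-48\nabla^l(W_{ijkl}C^{ijk})+\lvert\nabla W\rvert^2+48P_t{}^sW_{sijk}W^{tijk}-8J\lvert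 W\rvert^2-64\lvert C\rvert^2.$$ A metric is Einstein if $\mathrm{Ric}=\lambda g$ for some constant $\lambda\in\mathbb{R}$. *)

theory Defs
  imports "HOL-Analysis.Analysis"
begin

section \<open>Smooth maps and embedded submanifolds\<close>

primrec higher_differentiable_on ::
    "'a::real_normed_vector set \<Rightarrow> ('a \<Rightarrow> 'b::real_normed_vector) \<Rightarrow> nat \<Rightarrow> bool" where
  "higher_differentiable_on S f 0 \<longleftrightarrow> continuous_on S f"
| "higher_differentiable_on S f (Suc n) \<longleftrightarrow>
     (\<forall>x\<in>S. f differentiable (at x)) \<and>
     (\<forall>v. higher_differentiable_on S (\<lambda>x. frechet_derivative f (at x) v) n)"

text \<open>Only used for open \<open>S\<close>, where it says that \<open>f\<close> is of class \<open>C\<^sup>\<infinity>\<close> on \<open>S\<close>.\<close>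

definition smooth_on :: "'a::real_normed_vector set \<Rightarrow> ('a \<Rightarrow> 'b::real_normed_vector) \<Rightarrow> bool" where
  "smooth_on S f \<longleftrightarrow> (\<forall>n. higher_differentiable_on S f n)"

text \<open>
  Manifolds are embedded submanifolds \<open>M\<close> of a Euclidean space \<open>'a\<close>. The dimension is carried by the
  index type \<open>'n\<close> of the coordinate space \<open>real^'n\<close>. A local parametrization \<open>\<psi>\<close> is the inverse of
  a chart; all smooth local parametrizations are admitted, so they form the maximal atlas.
\<close>

definition local_param ::
    "'a::euclidean_space set \<Rightarrow> (real^'n) set \<Rightarrow> (real^'n \<Rightarrow> 'a) \<Rightarrow> bool" where
  "local_param M U \<psi> \<longleftrightarrow>
     open U \<and> smooth_on U \<psi> \<and> (\<forall>x\<in>U. inj (frechet_derivative \<psi> (at x))) \<and>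
     openin (top_of_set M) (\<psi> ` U) \<and> (\<exists>\<phi>. homeomorphism U (\<psi> ` U) \<psi> \<phi>)"

definition closed_submanifold :: "'n::finite itself \<Rightarrow> 'a::euclidean_space set \<Rightarrow> bool" where
  "closed_submanifold (_ :: 'n itself) M \<longleftrightarrow>
     compact M \<and> (\<forall>p\<in>M. \<exists>U (\<psi> :: real^'n \<Rightarrow> 'a). local_param M U \<psi> \<and> p \<in> \<psi> ` U)"

section \<open>Symmetric two-tensor fields and Riemannian metrics\<close>

text \<open>
  The tangent space of \<open>M\<close> at \<open>p = \<psi> x\<close> is the range of the derivative of \<open>\<psi>\<close> at \<open>x\<close>, a subspace of
  \<open>'a\<close>. A field \<open>g\<close> assigns to a point \<open>p\<close> and vectors \<open>u\<close>, \<open>v\<close> the number \<open>g p u v\<close>; only its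
  values at points of \<open>M\<close> and at tangent vectors are ever used.
\<close>

type_synonym 'a two_tensor = "'a \<Rightarrow> 'a \<Rightarrow> 'a \<Rightarrow> real"

definition pullback :: "(real^'n \<Rightarrow> 'a::euclidean_space) \<Rightarrow> 'a two_tensor \<Rightarrow> (real^'n) two_tensor" where
  "pullback \<psi> g x u v = g (\<psi> x) (frechet_derivative \<psi> (at x) u) (frechet_derivative \<psi> (at x) v)"

definition components ::
    "(real^'n \<Rightarrow> 'a::euclidean_space) \<Rightarrow> 'a two_tensor \<Rightarrow> real^'n \<Rightarrow> real^'n^'n" where
  "components \<psi> g x = (\<chi> i j. pullback \<psi> g x (axis i 1) (axis j 1))"

definition smooth_symmetric_tensor ::
    "'n::finite itself \<Rightarrow> 'a::euclidean_space set \<Rightarrow> 'a two_tensor \<Rightarrow> bool" where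
  "smooth_symmetric_tensor (_ :: 'n itself) M g \<longleftrightarrow>
     (\<forall>U (\<psi> :: real^'n \<Rightarrow> 'a). local_param M U \<psi> \<longrightarrow>
        smooth_on U (components \<psi> g) \<and>
        (\<forall>x\<in>U. bilinear (pullback \<psi> g x) \<and> (\<forall>u v. pullback \<psi> g x u v = pullback \<psi> g x v u)))"

definition riemannian_metric ::
    "'n::finite itself \<Rightarrow> 'a::euclidean_space set \<Rightarrow> 'a two_tensor \<Rightarrow> bool" where
  "riemannian_metric (N :: 'n itself) M g \<longleftrightarrow>
     closed_submanifold N M \<and> smooth_symmetric_tensor N M g \<and>
     (\<forall>U (\<psi> :: real^'n \<Rightarrow> 'a). local_param M U \<psi> \<longrightarrow>
        (\<forall>x\<in>U. \<forall>u. u \<noteq> 0 \<longrightarrow> pullback \<psi> g x u u > 0))"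

section \<open>Local Riemannian geometry in coordinates\<close>

text \<open>
  Below \<open>G :: real^'n \<Rightarrow> real^'n^'n\<close> is the matrix of a metric in a coordinate system. Tensor fields
  with lower indices are functions of the coordinates and the indices.
\<close>

definition partial :: "'n::finite \<Rightarrow> (real^'n \<Rightarrow> real) \<Rightarrow> real^'n \<Rightarrow> real" where
  "partial i f x = frechet_derivative f (at x) (axis i 1)"

definition ginv :: "(real^'n \<Rightarrow> real^'n^'n) \<Rightarrow> real^'n \<Rightarrow> 'n \<Rightarrow> 'n \<Rightarrow> real" where
  "ginv G x i j = matrix_inv (G x) $ i $ j"

text \<open>\<open>christoffel G x m i j\<close> is \<open>\<Gamma>\<^sup>m\<^sub>i\<^sub>j\<close>.\<close>

definition christoffel :: "(real^'n \<Rightarrow> real^'n^'n) \<Rightarrow> real^'n \<Rightarrow> 'n \<Rightarrow> 'n \<Rightarrow> 'n \<Rightarrow> real" where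
  "christoffel G x m i j =
     (\<Sum>l\<in>UNIV. ginv G x m l *
        (partial i (\<lambda>y. G y $ j $ l) x + partial j (\<lambda>y. G y $ i $ l) x
           - partial l (\<lambda>y. G y $ i $ j) x)) / 2"

text \<open>
  The covariant derivatives of one-, two- and four-tensors; the first index \<open>m\<close> is the direction of
  differentiation, e.g. \<open>nabla2 G T x m i j\<close> is \<open>\<nabla>\<^sub>m T\<^sub>i\<^sub>j\<close>.
\<close>

definition nabla1 ::
    "(real^'n \<Rightarrow> real^'n^'n) \<Rightarrow> (real^'n \<Rightarrow> 'n \<Rightarrow> real) \<Rightarrow> real^'n \<Rightarrow> 'n \<Rightarrow> 'n \<Rightarrow> real" where
  "nabla1 G T x m i = partial m (\<lambda>y. T y i) x - (\<Sum>p\<in>UNIV. christoffel G x p m i * T x p)"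

definition nabla2 ::
    "(real^'n \<Rightarrow> real^'n^'n) \<Rightarrow> (real^'n \<Rightarrow> 'n \<Rightarrow> 'n \<Rightarrow> real) \<Rightarrow>
     real^'n \<Rightarrow> 'n \<Rightarrow> 'n \<Rightarrow> 'n \<Rightarrow> real" where
  "nabla2 G T x m i j = partial m (\<lambda>y. T y i j) x
     - (\<Sum>p\<in>UNIV. christoffel G x p m i * T x p j + christoffel G x p m j * T x i p)"

definition nabla4 ::
    "(real^'n \<Rightarrow> real^'n^'n) \<Rightarrow> (real^'n \<Rightarrow> 'n \<Rightarrow> 'n \<Rightarrow> 'n \<Rightarrow> 'n \<Rightarrow> real) \<Rightarrow>
     real^'n \<Rightarrow> 'n \<Rightarrow> 'n \<Rightarrow> 'n \<Rightarrow> 'n \<Rightarrow> 'n \<Rightarrow> real" where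
  "nabla4 G T x m i j k l = partial m (\<lambda>y. T y i j k l) x
     - (\<Sum>p\<in>UNIV. christoffel G x p m i * T x p j k l + christoffel G x p m j * T x i p k l
                 + christoffel G x p m k * T x i j p l + christoffel G x p m l * T x i j k p)"

text \<open>
  The sign is fixed by \<open>R\<^sub>i\<^sub>j\<^sub>k\<^sub>l = g (R(\<partial>\<^sub>i, \<partial>\<^sub>j) \<partial>\<^sub>l, \<partial>\<^sub>k)\<close> with
  \<open>R(X, Y) Z = \<nabla>\<^sub>X \<nabla>\<^sub>Y Z - \<nabla>\<^sub>Y \<nabla>\<^sub>X Z - \<nabla>\<^bsub>[X, Y]\<^esub> Z\<close>, so that constant sectional curvature \<open>\<mu>\<close> means
  \<open>R\<^sub>i\<^sub>j\<^sub>k\<^sub>l = \<mu> (g\<^sub>i\<^sub>k g\<^sub>j\<^sub>l - g\<^sub>i\<^sub>l g\<^sub>j\<^sub>k)\<close>.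
\<close>

definition riemann ::
    "(real^'n \<Rightarrow> real^'n^'n) \<Rightarrow> real^'n \<Rightarrow> 'n \<Rightarrow> 'n \<Rightarrow> 'n \<Rightarrow> 'n \<Rightarrow> real" where
  "riemann G x i j k l =
     (\<Sum>m\<in>UNIV. G x $ k $ m *
        (partial i (\<lambda>y. christoffel G y m j l) x - partial j (\<lambda>y. christoffel G y m i l) x
         + (\<Sum>p\<in>UNIV. christoffel G x m i p * christoffel G x p j l
                     - christoffel G x m j p * christoffel G x p i l)))"

definition ricci :: "(real^'n \<Rightarrow> real^'n^'n) \<Rightarrow> real^'n \<Rightarrow> 'n \<Rightarrow> 'n \<Rightarrow> real" where
  "ricci G x i j = (\<Sum>s\<in>UNIV. \<Sum>t\<in>UNIV. ginv G x s t * riemann G x i s j t)"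

definition scalar_curv :: "(real^'n \<Rightarrow> real^'n^'n) \<Rightarrow> real^'n \<Rightarrow> real" where
  "scalar_curv G x = (\<Sum>i\<in>UNIV. \<Sum>j\<in>UNIV. ginv G x i j * ricci G x i j)"

text \<open>\<open>schouten_trace\<close> is \<open>J\<close>, the trace of the Schouten tensor.\<close>

definition schouten_trace :: "(real^'n \<Rightarrow> real^'n^'n) \<Rightarrow> real^'n \<Rightarrow> real" where
  "schouten_trace G x = scalar_curv G x / (2 * (real CARD('n) - 1))"

definition schouten :: "(real^'n \<Rightarrow> real^'n^'n) \<Rightarrow> real^'n \<Rightarrow> 'n \<Rightarrow> 'n \<Rightarrow> real" where
  "schouten G x i j =
     (ricci G x i j - schouten_trace G x * G x $ i $ j) / (real CARD('n) - 2)"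

definition weyl ::
    "(real^'n \<Rightarrow> real^'n^'n) \<Rightarrow> real^'n \<Rightarrow> 'n \<Rightarrow> 'n \<Rightarrow> 'n \<Rightarrow> 'n \<Rightarrow> real" where
  "weyl G x i j k l = riemann G x i j k l
     - schouten G x i k * G x $ j $ l - schouten G x j l * G x $ i $ k
     + schouten G x i l * G x $ j $ k + schouten G x j k * G x $ i $ l"

definition cotton :: "(real^'n \<Rightarrow> real^'n^'n) \<Rightarrow> real^'n \<Rightarrow> 'n \<Rightarrow> 'n \<Rightarrow> 'n \<Rightarrow> real" where
  "cotton G x i j k = nabla2 G (schouten G) x i j k - nabla2 G (schouten G) x j i k"

text \<open>Raising all indices, at a fixed point, with the inverse metric \<open>H\<close>.\<close>

definition raise3 ::
    "('n \<Rightarrow> 'n \<Rightarrow> real) \<Rightarrow> ('n::finite \<Rightarrow> 'n \<Rightarrow> 'n \<Rightarrow> real) \<Rightarrow> 'n \<Rightarrow> 'n \<Rightarrow> 'n \<Rightarrow> real" where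
  "raise3 H T i j k = (\<Sum>a\<in>UNIV. \<Sum>b\<in>UNIV. \<Sum>c\<in>UNIV. H i a * H j b * H k c * T a b c)"

definition raise4 ::
    "('n \<Rightarrow> 'n \<Rightarrow> real) \<Rightarrow> ('n::finite \<Rightarrow> 'n \<Rightarrow> 'n \<Rightarrow> 'n \<Rightarrow> real) \<Rightarrow>
     'n \<Rightarrow> 'n \<Rightarrow> 'n \<Rightarrow> 'n \<Rightarrow> real" where
  "raise4 H T i j k l =
     (\<Sum>a\<in>UNIV. \<Sum>b\<in>UNIV. \<Sum>c\<in>UNIV. \<Sum>d\<in>UNIV. H i a * H j b * H k c * H l d * T a b c d)"

definition norm_sq3 :: "('n \<Rightarrow> 'n \<Rightarrow> real) \<Rightarrow> ('n::finite \<Rightarrow> 'n \<Rightarrow> 'n \<Rightarrow> real) \<Rightarrow> real" where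
  "norm_sq3 H T = (\<Sum>i\<in>UNIV. \<Sum>j\<in>UNIV. \<Sum>k\<in>UNIV. T i j k * raise3 H T i j k)"

definition norm_sq4 :: "('n \<Rightarrow> 'n \<Rightarrow> real) \<Rightarrow> ('n::finite \<Rightarrow> 'n \<Rightarrow> 'n \<Rightarrow> 'n \<Rightarrow> real) \<Rightarrow> real" where
  "norm_sq4 H T =
     (\<Sum>i\<in>UNIV. \<Sum>j\<in>UNIV. \<Sum>k\<in>UNIV. \<Sum>l\<in>UNIV. T i j k l * raise4 H T i j k l)"

definition norm_sq5 ::
    "('n \<Rightarrow> 'n \<Rightarrow> real) \<Rightarrow> ('n::finite \<Rightarrow> 'n \<Rightarrow> 'n \<Rightarrow> 'n \<Rightarrow> 'n \<Rightarrow> real) \<Rightarrow> real" where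
  "norm_sq5 H T =
     (\<Sum>m\<in>UNIV. \<Sum>n\<in>UNIV. \<Sum>i\<in>UNIV. \<Sum>j\<in>UNIV. \<Sum>k\<in>UNIV. \<Sum>l\<in>UNIV.
        H m n * T m i j k l * raise4 H (T n) i j k l)"

definition divergence :: "(real^'n \<Rightarrow> real^'n^'n) \<Rightarrow> (real^'n \<Rightarrow> 'n \<Rightarrow> real) \<Rightarrow> real^'n \<Rightarrow> real" where
  "divergence G w x = (\<Sum>l\<in>UNIV. \<Sum>m\<in>UNIV. ginv G x l m * nabla1 G w x m l)"

definition laplacian :: "(real^'n \<Rightarrow> real^'n^'n) \<Rightarrow> (real^'n \<Rightarrow> real) \<Rightarrow> real^'n \<Rightarrow> real" where
  "laplacian G f = divergence G (\<lambda>y i. partial i f y)"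

definition L1_local :: "(real^'n \<Rightarrow> real^'n^'n) \<Rightarrow> real^'n \<Rightarrow> real" where
  "L1_local G x =
     2 * laplacian G (\<lambda>y. norm_sq4 (ginv G y) (weyl G y)) x
     - 48 * divergence G (\<lambda>y l. \<Sum>i\<in>UNIV. \<Sum>j\<in>UNIV. \<Sum>k\<in>UNIV.
                weyl G y i j k l * raise3 (ginv G y) (cotton G y) i j k) x
     + norm_sq5 (ginv G x) (nabla4 G (weyl G) x)
     + 48 * (\<Sum>s\<in>UNIV. \<Sum>t\<in>UNIV. \<Sum>i\<in>UNIV. \<Sum>j\<in>UNIV. \<Sum>k\<in>UNIV.
                (\<Sum>a\<in>UNIV. ginv G x s a * schouten G x t a)
                  * weyl G x s i j k * raise4 (ginv G x) (weyl G x) t i j k)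
     - 8 * schouten_trace G x * norm_sq4 (ginv G x) (weyl G x)
     - 64 * norm_sq3 (ginv G x) (cotton G x)"

section \<open>Global notions\<close>

definition constant_sectional_curvature ::
    "'n::finite itself \<Rightarrow> 'a::euclidean_space set \<Rightarrow> 'a two_tensor \<Rightarrow> real \<Rightarrow> bool" where
  "constant_sectional_curvature (N :: 'n itself) M g \<mu> \<longleftrightarrow>
     riemannian_metric N M g \<and>
     (\<forall>U (\<psi> :: real^'n \<Rightarrow> 'a). local_param M U \<psi> \<longrightarrow>
        (let G = components \<psi> g in
          \<forall>x\<in>U. \<forall>i j k l. riemann G x i j k l
             = \<mu> * (G x $ i $ k * G x $ j $ l - G x $ i $ l * G x $ j $ k)))"

definition einstein_metric ::
    "'n::finite itself \<Rightarrow> 'a::euclidean_space set \<Rightarrow> 'a two_tensor \<Rightarrow> bool" where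
  "einstein_metric (N :: 'n itself) M g \<longleftrightarrow>
     riemannian_metric N M g \<and>
     (\<exists>r::real. \<forall>U (\<psi> :: real^'n \<Rightarrow> 'a). local_param M U \<psi> \<longrightarrow>
        (let G = components \<psi> g in \<forall>x\<in>U. \<forall>i j. ricci G x i j = r * G x $ i $ j))"

text \<open>
  The Riemannian measure is the unique Borel measure on \<open>M\<close> that in every coordinate system has
  density \<open>sqrt (det (g\<^sub>i\<^sub>j))\<close> with respect to Lebesgue measure.
\<close>

definition riemannian_measure ::
    "'n::finite itself \<Rightarrow> 'a::euclidean_space set \<Rightarrow> 'a two_tensor \<Rightarrow> 'a measure" where
  "riemannian_measure (_ :: 'n itself) M g =
     (THE \<mu>. sets \<mu> = sets (restrict_space borel M) \<and>
        (\<forall>U (\<psi> :: real^'n \<Rightarrow> 'a). local_param M U \<psi> \<longrightarrow>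
           (\<forall>A\<in>sets borel. A \<subseteq> \<psi> ` U \<longrightarrow>
              emeasure \<mu> A =
                (\<integral>\<^sup>+x\<in>{x\<in>U. \<psi> x \<in> A}. ennreal (sqrt (det (components \<psi> g x))) \<partial>lborel))))"

text \<open>
  \<open>L1_local\<close> is a scalar invariant, so its value at a point does not depend on the coordinates in
  which it is computed.
\<close>

definition L1_density :: "'a::euclidean_space set \<Rightarrow> 'a two_tensor \<Rightarrow> 'a \<Rightarrow> real" where
  "L1_density M g p =
     (SOME y. \<exists>U (\<psi> :: real^6 \<Rightarrow> 'a). \<exists>x\<in>U.
        local_param M U \<psi> \<and> \<psi> x = p \<and> y = L1_local (components \<psi> g) x)"

definition L1_functional :: "'a::euclidean_space set \<Rightarrow> 'a two_tensor \<Rightarrow> real" where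
  "L1_functional M g = (\<integral>p. L1_density M g p \<partial>(riemannian_measure TYPE(6) M g))"

text \<open>
  Critical points in the space of all Riemannian metrics: the first variation vanishes in the
  direction of every smooth symmetric two-tensor field. As \<open>M\<close> is compact, \<open>g + t v\<close> is a metric
  for all small \<open>t\<close>.
\<close>

definition critical_metric ::
    "'n::finite itself \<Rightarrow> 'a::euclidean_space set \<Rightarrow> ('a two_tensor \<Rightarrow> real) \<Rightarrow> 'a two_tensor \<Rightarrow> bool" where
  "critical_metric N M F g \<longleftrightarrow>
     riemannian_metric N M g \<and>
     (\<forall>v. smooth_symmetric_tensor N M v \<longrightarrow>
        ((\<lambda>t. F (\<lambda>p u w. g p u w + t * v p u w)) has_real_derivative 0) (at 0))"

section \<open>Round spheres and products\<close>

text \<open>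
  On the unit sphere, the metric induced from the ambient Euclidean space divided by \<open>\<kappa>\<close>; this is
  the sphere of radius \<open>1 / sqrt \<kappa>\<close>, i.e. the sphere of constant sectional curvature \<open>\<kappa>\<close>.
\<close>

definition round_metric :: "real \<Rightarrow> 'a::euclidean_space two_tensor" where
  "round_metric \<kappa> = (\<lambda>p u v. (u \<bullet> v) / \<kappa>)"

definition scale_metric :: "real \<Rightarrow> 'a two_tensor \<Rightarrow> 'a two_tensor" where
  "scale_metric c h = (\<lambda>p u v. c * h p u v)"

definition product_metric :: "'a two_tensor \<Rightarrow> 'b two_tensor \<Rightarrow> ('a \<times> 'b) two_tensor" where
  "product_metric g h =
     (\<lambda>p u v. g (fst p) (fst u) (fst v) + h (snd p) (snd u) (snd v))"

end

theory Submission
  imports Defs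
begin

text \<open>
  The sphere factors give two symmetric tensors \<open>S True\<close> and \<open>S False\<close> on the product, whose sum is
  the metric. Both are parallel, and the curvature is a polynomial in them with constant
  coefficients; so are the Ricci, Schouten and Weyl tensors. Every term of \<open>L\<^sub>1\<close> that contains a
  derivative therefore vanishes, including the Cotton tensor, and
  \<open>L\<^sub>1 = 48 P\<^sub>t\<^sup>s W\<^sub>s\<^sub>i\<^sub>j\<^sub>k W\<^sup>t\<^sup>i\<^sup>j\<^sup>k - 8 J |W|\<^sup>2\<close> is a constant: for factors of curvature \<open>3\<close> and
  \<open>k = 1/c\<close> it is \<open>36 (3 + k)\<^sup>2 (1 - k)\<close>. Multiplication by the volume
  \<open>(4 \<pi> / 3) (8 \<pi>\<^sup>2 c\<^sup>2 / 3)\<close> gives the formula. It has a simple zero at \<open>c = 1\<close>, so the derivative in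
  the direction of the metric of the second factor does not vanish there.

  The density and the volume measure are described through arbitrary local parametrizations, so
  nothing may depend on a convenient choice of coordinates. In an arbitrary parametrization the
  geometry is read off from the embedding: the tangent vectors together with the unit normals of the
  factors span the ambient space (\<open>completeness\<close>), which yields the Gauss formula
  (\<open>gauss_formula\<close>), hence that the factor metrics are parallel (\<open>partial_S\<close>) and the Gauss
  equation (\<open>riemann_eq\<close>). The same identity turns the contractions with the inverse metric into
  the algebra of orthogonal projections (\<open>splitting\<close>), and \<open>L1_local_eq\<close> follows. This part treats
  a product of any number of spheres, so that a single sphere is covered too. Stereographic
  projection in all factors at once provides the parametrizations (\<open>stereographic_chart\<close>).

  The volume measure is exhibited as a multiple of the measure that assigns to \<open>A\<close> the Lebesgue
  measure of the cone \<open>{(s y, t z) | (y, z) \<in> A, 0 < s \<le> 1, 0 < t \<le> 1}\<close>. In every parametrization,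
  polar coordinates show that it has the right density (\<open>emeasure_cone\<close>); the Jacobian is compared
  with \<open>sqrt (det g)\<close> through Gram determinants. Its total mass is the same multiple of a product of two ball volumes.
\<close>

section \<open>Calculus of smooth maps\<close>

lemma higher_differentiable_on_continuous_on:
  "higher_differentiable_on S f n \<Longrightarrow> continuous_on S f"
  by (cases n) (auto intro!: continuous_at_imp_continuous_on differentiable_imp_continuous_within)

lemma higher_differentiable_on_Suc_imp:
  "higher_differentiable_on S f (Suc n) \<Longrightarrow> higher_differentiable_on S f n"
proof (induction n arbitrary: f)
  case 0
  then show ?case
    using higher_differentiable_on_continuous_on[OF 0] by simp
next
  case (Suc n)
  have "higher_differentiable_on S (\<lambda>x. frechet_derivative f (at x) v) n" for v
    by (rule Suc.IH) (use Suc.prems in simp)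
  with Suc.prems show ?case
    by simp
qed

text \<open>
  As \<open>S\<close> is open, derivatives at its points only see the values on \<open>S\<close>.
\<close>

lemma higher_differentiable_on_cong:
  assumes "open S" "\<And>x. x \<in> S \<Longrightarrow> f x = g x" "higher_differentiable_on S g n"
  shows "higher_differentiable_on S f n"
  using assms(2,3)
proof (induction n arbitrary: f g)
  case 0
  then show ?case
    by (auto cong: continuous_on_cong)
next
  case (Suc n)
  have g: "g differentiable (at x)" if "x \<in> S" for x
    using Suc.prems that by auto
  have deriv: "(f has_derivative frechet_derivative g (at x)) (at x)" if "x \<in> S" for x
    using g[OF that] unfolding frechet_derivative_works
    by (rule has_derivative_transform_within_open[OF _ \<open>open S\<close> that]) (simp add: Suc.prems(1))
  have "frechet_derivative f (at x) v = frechet_derivative g (at x) v" if "x \<in> S" for x v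
    using frechet_derivative_at[OF deriv[OF that]] by simp
  then have "higher_differentiable_on S (\<lambda>x. frechet_derivative f (at x) v) n" for v
    using Suc.prems(2) by (rule_tac Suc.IH[of _ "\<lambda>x. frechet_derivative g (at x) v"]) auto
  with deriv show ?case
    by (auto simp: differentiable_def)
qed

text \<open>
  The recursion step for a derivative that is known by an explicit formula.
\<close>

lemma higher_differentiable_on_SucI:
  assumes "open S" and "\<And>x. x \<in> S \<Longrightarrow> (f has_derivative f' x) (at x)"
    and "\<And>v. higher_differentiable_on S (\<lambda>x. f' x v) n"
  shows "higher_differentiable_on S f (Suc n)"
proof -
  have "frechet_derivative f (at x) = f' x" if "x \<in> S" for x
    using frechet_derivative_at[OF assms(2)[OF that]] by simp
  then have "higher_differentiable_on S (\<lambda>x. frechet_derivative f (at x) v) n" for v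
    by (rule_tac higher_differentiable_on_cong[OF assms(1) _ assms(3)]) simp
  with assms(2) show ?thesis
    by (auto simp: differentiable_def)
qed

lemma higher_differentiable_on_const: "higher_differentiable_on S (\<lambda>x. c) n"
  by (induction n arbitrary: c) auto

lemma higher_differentiable_on_linear:
  assumes "open S" "bounded_linear h" "higher_differentiable_on S f n"
  shows "higher_differentiable_on S (\<lambda>x. h (f x)) n"
  using assms(3)
proof (induction n arbitrary: f)
  case 0
  then show ?case
    by (auto intro: bounded_linear.continuous_on[OF assms(2)])
next
  case (Suc n)
  then have "(f has_derivative frechet_derivative f (at x)) (at x)" if "x \<in> S" for x
    using that by (simp add: frechet_derivative_works)
  then show ?case
    using Suc by (intro higher_differentiable_on_SucI[OF assms(1)
      bounded_linear.has_derivative[OF assms(2)]]) auto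
qed

lemma higher_differentiable_on_add:
  assumes "open S" "higher_differentiable_on S f n" "higher_differentiable_on S g n"
  shows "higher_differentiable_on S (\<lambda>x. f x + g x) n"
  using assms(2,3)
proof (induction n arbitrary: f g)
  case 0
  then show ?case
    by (auto intro: continuous_intros)
next
  case (Suc n)
  have "((\<lambda>x. f x + g x) has_derivative
      (\<lambda>v. frechet_derivative f (at x) v + frechet_derivative g (at x) v)) (at x)" if "x \<in> S" for x
    using Suc.prems that by (intro has_derivative_add) (auto simp: frechet_derivative_works[symmetric])
  then show ?case
    by (rule higher_differentiable_on_SucI[OF assms(1)]) (use Suc in auto)
qed

text \<open>
  By the product rule the directional derivatives are sums of two expressions of the same kind, so the
  induction has to run over all \<open>f\<close> and \<open>g\<close>.
\<close>

lemma higher_differentiable_on_bilinear: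
  assumes "open S" "bounded_bilinear B"
    and "higher_differentiable_on S f n" "higher_differentiable_on S g n"
  shows "higher_differentiable_on S (\<lambda>x. B (f x) (g x)) n"
  using assms(3,4)
proof (induction n arbitrary: f g)
  case 0
  then show ?case
    by (auto intro: bounded_bilinear.continuous_on[OF assms(2)])
next
  case (Suc n)
  have "(f has_derivative frechet_derivative f (at x)) (at x)"
    "(g has_derivative frechet_derivative g (at x)) (at x)" if "x \<in> S" for x
    using that Suc.prems by (simp_all add: frechet_derivative_works)
  note der = bounded_bilinear.FDERIV[OF assms(2) this]
  have "higher_differentiable_on S f n" "higher_differentiable_on S g n"
    using Suc.prems by (auto intro: higher_differentiable_on_Suc_imp simp del: higher_differentiable_on.simps)
  with Suc.prems show ?case
    by (intro higher_differentiable_on_SucI[OF assms(1) der] higher_differentiable_on_add assms(1) Suc.IH) auto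
qed

lemma smooth_on_continuous_on: "smooth_on S f \<Longrightarrow> continuous_on S f"
  unfolding smooth_on_def using higher_differentiable_on_continuous_on by blast

lemma smooth_on_has_derivative:
  assumes "smooth_on S f" "x \<in> S"
  shows "(f has_derivative frechet_derivative f (at x)) (at x)"
proof -
  have "higher_differentiable_on S f (Suc 0)"
    using assms(1) unfolding smooth_on_def by blast
  with assms(2) show ?thesis
    by (simp add: frechet_derivative_works)
qed

lemma smooth_on_frechet_derivative:
  assumes "smooth_on S f"
  shows "smooth_on S (\<lambda>x. frechet_derivative f (at x) v)"
proof -
  have "higher_differentiable_on S f (Suc n)" for n
    using assms unfolding smooth_on_def by blast
  then show ?thesis
    by (simp add: smooth_on_def)
qed

lemma smooth_on_const: "smooth_on S (\<lambda>x. c)"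
  by (simp add: smooth_on_def higher_differentiable_on_const)

lemma smooth_on_linear:
  "open S \<Longrightarrow> bounded_linear h \<Longrightarrow> smooth_on S f \<Longrightarrow> smooth_on S (\<lambda>x. h (f x))"
  by (simp add: smooth_on_def higher_differentiable_on_linear)

lemma smooth_on_ident:
  assumes "open S"
  shows "smooth_on S (\<lambda>x. x)"
proof -
  have "higher_differentiable_on S (\<lambda>x. x) n" for n
    by (cases n) (auto intro: higher_differentiable_on_const)
  then show ?thesis
    by (simp add: smooth_on_def)
qed

lemma smooth_on_bilinear:
  "open S \<Longrightarrow> bounded_bilinear B \<Longrightarrow> smooth_on S f \<Longrightarrow> smooth_on S g \<Longrightarrow> smooth_on S (\<lambda>x. B (f x) (g x))"
  by (simp add: smooth_on_def higher_differentiable_on_bilinear)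

lemmas smooth_on_inner = smooth_on_bilinear[OF _ bounded_bilinear_inner]
lemmas smooth_on_scaleR = smooth_on_bilinear[OF _ bounded_bilinear_scaleR]

lemma smooth_on_add:
  assumes "open S" "smooth_on S f" "smooth_on S g"
  shows "smooth_on S (\<lambda>x. f x + g x)"
  using assms by (simp add: smooth_on_def higher_differentiable_on_add)

lemma smooth_on_sum:
  assumes "open S" "\<And>i. i \<in> I \<Longrightarrow> smooth_on S (f i)"
  shows "smooth_on S (\<lambda>x. \<Sum>i\<in>I. f i x)"
  using assms(2)
  by (induction I rule: infinite_finite_induct)
    (simp_all add: smooth_on_const smooth_on_add[OF assms(1)])

text \<open>
  The derivative of \<open>1 / f\<close> is \<open>- f' / f\<^sup>2\<close>, in which \<open>1 / f\<close> is needed to one order less.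
\<close>

lemma smooth_on_inverse:
  fixes f :: "'a::real_normed_vector \<Rightarrow> real"
  assumes "open S" "smooth_on S f" "\<And>x. x \<in> S \<Longrightarrow> f x \<noteq> 0"
  shows "smooth_on S (\<lambda>x. inverse (f x))"
proof -
  have "higher_differentiable_on S (\<lambda>x. inverse (f x)) n" for n
  proof (induction n)
    case 0
    then show ?case
      using assms smooth_on_continuous_on by (auto intro: continuous_intros)
  next
    case (Suc n)
    have f: "higher_differentiable_on S (\<lambda>x. frechet_derivative f (at x) v) n" for v
      using smooth_on_frechet_derivative[OF assms(2)] by (simp add: smooth_on_def)
    note mult = higher_differentiable_on_bilinear[OF assms(1) bounded_bilinear_mult]
    show ?case
      by (rule higher_differentiable_on_SucI[OF assms(1)
          Deriv.has_derivative_inverse[OF assms(3) smooth_on_has_derivative[OF assms(2)]]])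
        (auto intro!: mult Suc f higher_differentiable_on_linear[OF assms(1) bounded_linear_minus[OF bounded_linear_ident]])
  qed
  then show ?thesis
    by (simp add: smooth_on_def)
qed

text \<open>
  Schwarz's theorem. The second difference of \<open>f\<close> over the parallelogram with sides \<open>t v\<close> and \<open>t w\<close>
  equals \<open>t\<^sup>2\<close> times the mixed derivative at some point near \<open>x\<close>, by two applications of the mean value
  theorem. It is symmetric in \<open>v\<close> and \<open>w\<close>, so the mixed derivatives in the two orders agree at two
  points near \<open>x\<close>; by continuity they cannot differ at \<open>x\<close>.
\<close>

lemma second_derivative_symmetric_real:
  fixes f :: "'a::real_normed_vector \<Rightarrow> real"
  assumes "open S" "x \<in> S" "smooth_on S f"
  shows "frechet_derivative (\<lambda>y. frechet_derivative f (at y) v) (at x) w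
       = frechet_derivative (\<lambda>y. frechet_derivative f (at y) w) (at x) v"
proof (rule ccontr)
  define D where "D v w y = frechet_derivative (\<lambda>y. frechet_derivative f (at y) v) (at y) w" for v w y
  assume "\<not> ?thesis"
  then have "D v w x \<noteq> D w v x" by (simp add: D_def)
  define e where "e = \<bar>D v w x - D w v x\<bar>"
  have "e > 0" using \<open>D v w x \<noteq> D w v x\<close> by (simp add: e_def)
  have der: "(f has_derivative frechet_derivative f (at y)) (at y)"
    "((\<lambda>y. frechet_derivative f (at y) u) has_derivative (\<lambda>z. D u z y)) (at y)" if "y \<in> S" for y u
    unfolding D_def using that assms(3)
    by (auto intro: smooth_on_has_derivative smooth_on_frechet_derivative)
  have cont: "continuous_on S (D v w)" for v w
    unfolding D_def by (intro smooth_on_continuous_on smooth_on_frechet_derivative assms(3))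
  have "\<exists>d>0. \<forall>y. dist y x < d \<longrightarrow> y \<in> S \<and> dist (D v w y) (D v w x) < e/2" for v w
  proof -
    obtain d1 where "d1 > 0" "ball x d1 \<subseteq> S"
      using assms openE by blast
    moreover obtain d2 where "d2 > 0" "\<And>y. y \<in> S \<Longrightarrow> dist y x < d2 \<Longrightarrow> dist (D v w y) (D v w x) < e/2"
      using cont[of v w] \<open>e > 0\<close> assms(2) unfolding continuous_on_iff by (metis half_gt_zero)
    ultimately show ?thesis
      by (intro exI[of _ "min d1 d2"]) (auto simp: subset_iff dist_commute)
  qed
  then obtain d1 d2 where d: "d1 > 0" "d2 > 0"
    "\<And>y. dist y x < d1 \<Longrightarrow> y \<in> S \<and> dist (D v w y) (D v w x) < e/2"
    "\<And>y. dist y x < d2 \<Longrightarrow> y \<in> S \<and> dist (D w v y) (D w v x) < e/2"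
    by metis
  (* The parallelogram with sides t v and t w stays within distance min d1 d2 of x;
     the summand 1 keeps the denominator positive. *)
  define t where "t = min d1 d2 / (2 * (norm v + norm w + 1))"
  have "t > 0" using d by (simp add: t_def add_nonneg_pos)
  have small: "dist (x + a *\<^sub>R v + b *\<^sub>R w) x < min d1 d2" if "0 \<le> a" "a \<le> t" "0 \<le> b" "b \<le> t" for a b
  proof -
    have "dist (x + a *\<^sub>R v + b *\<^sub>R w) x = norm (a *\<^sub>R v + b *\<^sub>R w)"
      by (simp add: dist_norm)
    also have "\<dots> \<le> a * norm v + b * norm w"
      using that by (metis abs_of_nonneg norm_scaleR norm_triangle_ineq)
    also have "\<dots> \<le> t * norm v + t * norm w"
      using that by (intro add_mono mult_right_mono) auto
    also have "\<dots> < t * (2 * (norm v + norm w + 1))"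
      using \<open>t > 0\<close> by (simp add: algebra_simps add_strict_increasing)
    also have "\<dots> = min d1 d2"
    proof -
      have "norm v + norm w + 1 > 0"
        by (simp add: add_nonneg_pos)
      then show ?thesis
        by (simp add: t_def)
    qed
    finally show ?thesis .
  qed
  (* The second difference quotient of f in the directions v, w is a value of D v w near x. *)
  have quotient: "\<exists>y. dist y x < min d1 d2 \<and>
      f (x + t *\<^sub>R v + t *\<^sub>R w) - f (x + t *\<^sub>R v) - f (x + t *\<^sub>R w) + f x = t * t * D v w y"
    if small: "\<And>a b. 0 \<le> a \<Longrightarrow> a \<le> t \<Longrightarrow> 0 \<le> b \<Longrightarrow> b \<le> t \<Longrightarrow> dist (x + a *\<^sub>R v + b *\<^sub>R w) x < min d1 d2"
    for v w
  proof -
    have S: "x + a *\<^sub>R v + b *\<^sub>R w \<in> S" if "0 \<le> a" "a \<le> t" "0 \<le> b" "b \<le> t" for a b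
      using small[OF that] d(3) by simp
    have S0: "x + a *\<^sub>R v \<in> S" if "0 \<le> a" "a \<le> t" for a
      using S[OF that, of 0] \<open>t > 0\<close> by simp
    define \<phi> where "\<phi> a = f (x + a *\<^sub>R v + t *\<^sub>R w) - f (x + a *\<^sub>R v)" for a
    have "\<exists>a\<in>{0<..<t}. \<phi> t - \<phi> 0 = (\<lambda>h. frechet_derivative f (at (x + a *\<^sub>R v + t *\<^sub>R w)) (h *\<^sub>R v)
        - frechet_derivative f (at (x + a *\<^sub>R v)) (h *\<^sub>R v)) (t - 0)"
    proof (rule mvt_simple[OF \<open>t > 0\<close>])
      fix a assume a: "0 \<le> a" "a \<le> t"
      show "(\<phi> has_derivative (\<lambda>h. frechet_derivative f (at (x + a *\<^sub>R v + t *\<^sub>R w)) (h *\<^sub>R v)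
        - frechet_derivative f (at (x + a *\<^sub>R v)) (h *\<^sub>R v))) (at a within {0..t})"
        unfolding \<phi>_def using a \<open>t > 0\<close> S[OF a, of t] S0[OF a]
        by (auto intro!: derivative_eq_intros has_derivative_compose[OF _ der(1)])
    qed
    then obtain a where a: "0 < a" "a < t" and \<phi>: "\<phi> t - \<phi> 0 =
        frechet_derivative f (at (x + a *\<^sub>R v + t *\<^sub>R w)) (t *\<^sub>R v) - frechet_derivative f (at (x + a *\<^sub>R v)) (t *\<^sub>R v)"
      by auto
    have lin: "linear (frechet_derivative f (at y))" if "y \<in> S" for y
      using der(1)[OF that] by (rule has_derivative_linear)
    have "\<exists>b\<in>{0<..<t}. frechet_derivative f (at (x + a *\<^sub>R v + t *\<^sub>R w)) v
        - frechet_derivative f (at (x + a *\<^sub>R v + 0 *\<^sub>R w)) v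
        = (\<lambda>h. D v (h *\<^sub>R w) (x + a *\<^sub>R v + b *\<^sub>R w)) (t - 0)"
    proof (rule mvt_simple[OF \<open>t > 0\<close>])
      fix b assume "0 \<le> b" "b \<le> t"
      then have "x + a *\<^sub>R v + b *\<^sub>R w \<in> S" using a S by simp
      then show "((\<lambda>b. frechet_derivative f (at (x + a *\<^sub>R v + b *\<^sub>R w)) v) has_derivative
          (\<lambda>h. D v (h *\<^sub>R w) (x + a *\<^sub>R v + b *\<^sub>R w))) (at b within {0..t})"
        by (auto intro!: derivative_eq_intros has_derivative_compose[OF _ der(2)])
    qed
    then obtain b where b: "0 < b" "b < t" and eq: "frechet_derivative f (at (x + a *\<^sub>R v + t *\<^sub>R w)) v
        - frechet_derivative f (at (x + a *\<^sub>R v)) v = D v (t *\<^sub>R w) (x + a *\<^sub>R v + b *\<^sub>R w)"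
      by auto
    have Sab: "x + a *\<^sub>R v + b *\<^sub>R w \<in> S" using a b by (intro S) auto
    have "linear (\<lambda>z. D v z (x + a *\<^sub>R v + b *\<^sub>R w))"
      using der(2)[OF Sab] by (rule has_derivative_linear)
    from linear_cmul[OF this, of t w]
    have "D v (t *\<^sub>R w) (x + a *\<^sub>R v + b *\<^sub>R w) = t * D v w (x + a *\<^sub>R v + b *\<^sub>R w)"
      by simp
    then have "\<phi> t - \<phi> 0 = t * t * D v w (x + a *\<^sub>R v + b *\<^sub>R w)"
      using \<phi> eq a S[of a t] S0[of a] \<open>t > 0\<close>
      by (simp add: linear_cmul[OF lin] right_diff_distrib[symmetric])
    moreover have "dist (x + a *\<^sub>R v + b *\<^sub>R w) x < min d1 d2"
      using a b by (intro small) auto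
    ultimately show ?thesis
      unfolding \<phi>_def by (intro exI[of _ "x + a *\<^sub>R v + b *\<^sub>R w"]) (auto simp: algebra_simps)
  qed
  obtain y where y: "dist y x < min d1 d2"
    "f (x + t *\<^sub>R v + t *\<^sub>R w) - f (x + t *\<^sub>R v) - f (x + t *\<^sub>R w) + f x = t * t * D v w y"
    using quotient[OF small] by blast
  obtain z where z: "dist z x < min d1 d2"
    "f (x + t *\<^sub>R w + t *\<^sub>R v) - f (x + t *\<^sub>R w) - f (x + t *\<^sub>R v) + f x = t * t * D w v z"
  proof -
    have "dist (x + a *\<^sub>R w + b *\<^sub>R v) x < min d1 d2" if "0 \<le> a" "a \<le> t" "0 \<le> b" "b \<le> t" for a b
      using small[OF that(3,4,1,2)] by (simp only: add.assoc add.commute[of "a *\<^sub>R w"])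
    from quotient[OF this] show ?thesis
      using that by blast
  qed
  have "t * t * D v w y = t * t * D w v z"
    using y(2) z(2) by (simp add: algebra_simps)
  then have "D v w y = D w v z" using \<open>t > 0\<close> by simp
  moreover have "\<bar>D v w y - D v w x\<bar> < e/2" "\<bar>D w v z - D w v x\<bar> < e/2"
    using d(3)[of y] d(4)[of z] y(1) z(1) by (auto simp: dist_real_def)
  ultimately show False
    unfolding e_def by (smt (verit) field_sum_of_halves)
qed

text \<open>
  For vector-valued maps the real case is applied to the component along each fixed vector \<open>c\<close>.
\<close>

lemma second_derivative_symmetric:
  fixes f :: "'a::real_normed_vector \<Rightarrow> 'b::real_inner"
  assumes "open S" "x \<in> S" "smooth_on S f"
  shows "frechet_derivative (\<lambda>y. frechet_derivative f (at y) v) (at x) w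
       = frechet_derivative (\<lambda>y. frechet_derivative f (at y) w) (at x) v"
proof -
  have inner: "frechet_derivative (\<lambda>y. g y \<bullet> c) (at y) u = frechet_derivative g (at y) u \<bullet> c"
    if "smooth_on S g" "y \<in> S" for g :: "'a \<Rightarrow> 'b" and y u c
    using fun_cong[OF frechet_derivative_at[OF has_derivative_inner_left[OF smooth_on_has_derivative[OF that]]]]
    by (rule sym)
  have second: "frechet_derivative (\<lambda>y. frechet_derivative f (at y) v) (at x) w \<bullet> c
      = frechet_derivative (\<lambda>y. frechet_derivative (\<lambda>y. f y \<bullet> c) (at y) v) (at x) w" for v w c
  proof -
    have "frechet_derivative (\<lambda>y. frechet_derivative (\<lambda>y. f y \<bullet> c) (at y) v) (at x)
        = frechet_derivative (\<lambda>y. frechet_derivative f (at y) v \<bullet> c) (at x)"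
      using smooth_on_has_derivative[OF smooth_on_inner[OF assms(1)
          smooth_on_frechet_derivative[OF assms(3)] smooth_on_const] assms(2)]
      by (intro frechet_derivative_at[symmetric])
        (rule has_derivative_transform_within_open[OF _ assms(1,2)], auto simp: inner[OF assms(3)])
    then show ?thesis
      by (simp add: inner[OF smooth_on_frechet_derivative[OF assms(3)] assms(2)])
  qed
  have "frechet_derivative (\<lambda>y. frechet_derivative f (at y) v) (at x) w \<bullet> c
      = frechet_derivative (\<lambda>y. frechet_derivative f (at y) w) (at x) v \<bullet> c" for c
    unfolding second
    by (rule second_derivative_symmetric_real[OF assms(1,2)])
      (intro smooth_on_inner smooth_on_const assms)
  then show ?thesis
    by (metis vector_eq_rdot)
qed

section \<open>Curvature algebra of an orthogonal splitting\<close>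

text \<open>
  If the forms \<open>S u\<close> are the metrics of mutually orthogonal factors and \<open>K\<close> is symmetric, this is the
  curvature tensor with sectional curvature \<open>K u v\<close> on the planes spanned by a vector of factor \<open>u\<close> and
  a vector of factor \<open>v\<close>.
\<close>

definition split_curvature ::
    "('u::finite \<Rightarrow> 'n \<Rightarrow> 'n \<Rightarrow> real) \<Rightarrow> ('u \<Rightarrow> 'u \<Rightarrow> real) \<Rightarrow> 'n \<Rightarrow> 'n \<Rightarrow> 'n \<Rightarrow> 'n \<Rightarrow> real" where
  "split_curvature S K i j k l = (\<Sum>u\<in>UNIV. \<Sum>v\<in>UNIV. K u v * (S u i k * S v j l - S u i l * S v j k))"

text \<open>
  The value of \<open>\<Sum>\<^sub>i\<^sub>j\<^sub>k T\<^sub>e\<^sub>i\<^sub>j\<^sub>k T\<^sub>e\<^sub>i\<^sub>j\<^sub>k\<close> for such a tensor \<open>T\<close> and a unit vector \<open>e\<close> of factor \<open>u\<close>: each of the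
  \<open>d v\<close> directions of factor \<open>v\<close> spans a plane with \<open>e\<close> and contributes \<open>2 (K u v)\<^sup>2\<close>, and the
  subtracted term removes \<open>e\<close> itself from the directions of its own factor.
\<close>

definition curvature_square :: "('u::finite \<Rightarrow> real) \<Rightarrow> ('u \<Rightarrow> 'u \<Rightarrow> real) \<Rightarrow> 'u \<Rightarrow> real" where
  "curvature_square d K u = 2 * ((\<Sum>v\<in>UNIV. (K u v)\<^sup>2 * d v) - (K u u)\<^sup>2)"

text \<open>
  The situation at one point: \<open>H\<close> is the inverse metric and \<open>S u\<close> the metric of the \<open>u\<close>-th summand of
  an orthogonal splitting of the tangent space. The last two assumptions make the
  endomorphisms \<open>H (S u)\<close> mutually orthogonal projections of trace \<open>d u\<close>.
\<close>

locale orthogonal_splitting =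
  fixes H :: "'n::finite \<Rightarrow> 'n \<Rightarrow> real" and S :: "'u::finite \<Rightarrow> 'n \<Rightarrow> 'n \<Rightarrow> real" and d :: "'u \<Rightarrow> real"
  assumes H_sym: "H i j = H j i"
    and S_sym: "S u i j = S u j i"
    and S_H_S: "(\<Sum>s\<in>UNIV. \<Sum>t\<in>UNIV. H s t * S u i s * S v t j) = (if u = v then S u i j else 0)"
    and trace_S: "(\<Sum>s\<in>UNIV. \<Sum>t\<in>UNIV. H s t * S u s t) = d u"
begin

text \<open>
  The projection \<open>H (S u)\<close>, with \<open>i\<close> as upper and \<open>j\<close> as lower index.
\<close>

definition proj :: "'u \<Rightarrow> 'n \<Rightarrow> 'n \<Rightarrow> real" where
  "proj u i j = (\<Sum>a\<in>UNIV. H i a * S u a j)"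

definition raised :: "'u \<Rightarrow> 'n \<Rightarrow> 'n \<Rightarrow> real" where
  "raised u i j = (\<Sum>a\<in>UNIV. \<Sum>b\<in>UNIV. H i a * H j b * S u a b)"

lemma trace_proj: "(\<Sum>i\<in>UNIV. proj u i i) = d u"
  unfolding proj_def trace_S[symmetric] by (simp add: S_sym)

lemma S_proj: "(\<Sum>k\<in>UNIV. S u i k * proj v k j) = (if u = v then S u i j else 0)"
  unfolding proj_def S_H_S[symmetric] by (simp add: sum_distrib_left mult_ac)

lemma proj_proj: "(\<Sum>k\<in>UNIV. proj u i k * proj v k j) = (if u = v then proj u i j else 0)"
proof -
  have "(\<Sum>k\<in>UNIV. proj u i k * proj v k j) = (\<Sum>k\<in>UNIV. \<Sum>a\<in>UNIV. H i a * (S u a k * proj v k j))"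
    unfolding proj_def[of u] by (simp add: sum_distrib_left sum_distrib_right mult_ac)
  also have "\<dots> = (\<Sum>a\<in>UNIV. H i a * (\<Sum>k\<in>UNIV. S u a k * proj v k j))"
    by (subst sum.swap) (simp add: sum_distrib_left)
  finally show ?thesis
    unfolding S_proj by (simp add: proj_def)
qed

lemma S_raised: "(\<Sum>k\<in>UNIV. S u i k * raised v j k) = (if u = v then proj u j i else 0)"
proof -
  have "(\<Sum>k\<in>UNIV. S u i k * raised v j k)
      = (\<Sum>k\<in>UNIV. \<Sum>a\<in>UNIV. H j a * (S u i k * (\<Sum>b\<in>UNIV. H k b * S v b a)))"
    unfolding raised_def by (simp add: sum_distrib_left mult_ac S_sym[of v])
  also have "\<dots> = (\<Sum>a\<in>UNIV. H j a * (\<Sum>k\<in>UNIV. S u i k * proj v k a))"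
    unfolding proj_def by (subst sum.swap) (simp add: sum_distrib_left)
  finally show ?thesis
    unfolding S_proj by (simp add: proj_def S_sym[where i = i])
qed

lemma raised_sym: "raised u i j = raised u j i"
  unfolding raised_def by (subst sum.swap) (simp add: mult_ac S_sym)

text \<open>
  Raising acts on every index separately, so it can be done in each of the two forms.
\<close>

lemma raise4_split_curvature:
  "raise4 H (split_curvature S K) i j k l
   = (\<Sum>u\<in>UNIV. \<Sum>v\<in>UNIV. K u v * (raised u i k * raised v j l - raised u i l * raised v j k))"
proof -
  have prod1: "(\<Sum>a\<in>UNIV. \<Sum>b\<in>UNIV. \<Sum>c\<in>UNIV. \<Sum>d\<in>UNIV. H i a * H j b * H k c * H l d * (S u a c * S v b d))
      = raised u i k * raised v j l" for u v
  proof -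
    have "raised u i k * raised v j l
        = (\<Sum>a\<in>UNIV. \<Sum>b\<in>UNIV. (\<Sum>c\<in>UNIV. H i a * H k c * S u a c) * (\<Sum>d\<in>UNIV. H j b * H l d * S v b d))"
      unfolding raised_def by (rule sum_product)
    then show ?thesis
      unfolding sum_product by (simp add: mult_ac)
  qed
  have prod2: "(\<Sum>a\<in>UNIV. \<Sum>b\<in>UNIV. \<Sum>c\<in>UNIV. \<Sum>d\<in>UNIV. H i a * H j b * H k c * H l d * (S u a d * S v b c))
      = raised u i l * raised v j k" for u v
  proof -
    have "raised u i l * raised v j k
        = (\<Sum>a\<in>UNIV. \<Sum>b\<in>UNIV. (\<Sum>d\<in>UNIV. H i a * H l d * S u a d) * (\<Sum>c\<in>UNIV. H j b * H k c * S v b c))"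
      unfolding raised_def by (rule sum_product)
    also have "\<dots> = (\<Sum>a\<in>UNIV. \<Sum>b\<in>UNIV. \<Sum>c\<in>UNIV. \<Sum>d\<in>UNIV. (H i a * H l d * S u a d) * (H j b * H k c * S v b c))"
      unfolding sum_product by (intro sum.cong refl sum.swap)
    finally show ?thesis
      by (simp add: mult_ac)
  qed
  have "raise4 H (split_curvature S K) i j k l = (\<Sum>a\<in>UNIV. \<Sum>b\<in>UNIV. \<Sum>c\<in>UNIV. \<Sum>d\<in>UNIV. \<Sum>u\<in>UNIV. \<Sum>v\<in>UNIV.
      K u v * (H i a * H j b * H k c * H l d * (S u a c * S v b d) - H i a * H j b * H k c * H l d * (S u a d * S v b c)))"
    unfolding raise4_def split_curvature_def by (simp add: sum_distrib_left algebra_simps)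
  also have "\<dots> = (\<Sum>u\<in>UNIV. \<Sum>v\<in>UNIV. \<Sum>a\<in>UNIV. \<Sum>b\<in>UNIV. \<Sum>c\<in>UNIV. \<Sum>d\<in>UNIV.
      K u v * (H i a * H j b * H k c * H l d * (S u a c * S v b d) - H i a * H j b * H k c * H l d * (S u a d * S v b c)))"
    by (simp only: sum.swap[of _ "UNIV :: 'u set" "UNIV :: 'n set"])
  also have "\<dots> = (\<Sum>u\<in>UNIV. \<Sum>v\<in>UNIV. K u v * (raised u i k * raised v j l - raised u i l * raised v j k))"
    by (simp only: sum_distrib_left[symmetric] sum_subtractf prod1 prod2)
  finally show ?thesis .
qed

text \<open>
  Of the four terms of the expanded product, two contract each form with its own partner and give the
  trace \<open>d v\<close>. In the other two the partners are crossed; these survive only if all four forms belong to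
  the same factor, and they enter with the opposite sign.
\<close>

lemma contract_basic:
  "(\<Sum>i\<in>UNIV. \<Sum>j\<in>UNIV. \<Sum>k\<in>UNIV. (S u s j * S v i k - S u s k * S v i j) *
      (raised u' t j * raised v' i k - raised u' t k * raised v' i j))
   = (if u = u' \<and> v = v' then 2 * (d v - (if u = v then 1 else 0)) * proj u t s else 0)"
proof -
  have full: "(\<Sum>i\<in>UNIV. \<Sum>k\<in>UNIV. S v i k * raised v' i k) = (if v = v' then d v else 0)"
    by (simp add: S_raised trace_proj)
  have T1: "(\<Sum>i\<in>UNIV. \<Sum>j\<in>UNIV. \<Sum>k\<in>UNIV. (S u s j * raised u' t j) * (S v i k * raised v' i k))
      = (if u = u' \<and> v = v' then d v * proj u t s else 0)"
    by (subst sum.swap) (simp add: sum_distrib_left[symmetric] full sum_distrib_right[symmetric] S_raised trace_proj)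
  have T1': "(\<Sum>i\<in>UNIV. \<Sum>j\<in>UNIV. \<Sum>k\<in>UNIV. (S u s k * raised u' t k) * (S v i j * raised v' i j))
      = (if u = u' \<and> v = v' then d v * proj u t s else 0)"
    by (simp only: T1[symmetric]) (intro sum.cong refl sum.swap)
  have mixed: "(\<Sum>i\<in>UNIV. S v i k * raised v' i j) = (if v = v' then proj v j k else 0)" for j k
    using S_raised[where u=v and v=v' and i=k and j=j] by (simp add: S_sym[of v k] raised_sym[of v' j])
  have T2: "(\<Sum>i\<in>UNIV. \<Sum>j\<in>UNIV. \<Sum>k\<in>UNIV. (S u s j * raised u' t k) * (S v i k * raised v' i j))
      = (if u = u' \<and> v = v' \<and> u = v then proj u t s else 0)"
  proof -
    have "(\<Sum>i\<in>UNIV. \<Sum>j\<in>UNIV. \<Sum>k\<in>UNIV. (S u s j * raised u' t k) * (S v i k * raised v' i j))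
        = (\<Sum>j\<in>UNIV. \<Sum>k\<in>UNIV. (S u s j * raised u' t k) * (\<Sum>i\<in>UNIV. S v i k * raised v' i j))"
      unfolding sum_distrib_left
      by (rule trans[OF sum.swap]) (intro sum.cong refl sum.swap)
    also have "\<dots> = (\<Sum>k\<in>UNIV. raised u' t k * (\<Sum>j\<in>UNIV. S u s j * (if v = v' then proj v j k else 0)))"
      unfolding mixed by (subst sum.swap) (simp add: sum_distrib_left mult_ac)
    also have "\<dots> = (if v = v' \<and> u = v then (\<Sum>k\<in>UNIV. S u s k * raised u' t k) else 0)"
      by (cases "v = v'") (auto simp: S_proj mult.commute)
    finally show ?thesis
      by (auto simp: S_raised)
  qed
  have T2': "(\<Sum>i\<in>UNIV. \<Sum>j\<in>UNIV. \<Sum>k\<in>UNIV. (S u s k * raised u' t j) * (S v i j * raised v' i k))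
      = (if u = u' \<and> v = v' \<and> u = v then proj u t s else 0)"
    by (simp only: T2[symmetric]) (intro sum.cong refl sum.swap)
  have "(\<Sum>i\<in>UNIV. \<Sum>j\<in>UNIV. \<Sum>k\<in>UNIV. (S u s j * S v i k - S u s k * S v i j) *
      (raised u' t j * raised v' i k - raised u' t k * raised v' i j))
    = (\<Sum>i\<in>UNIV. \<Sum>j\<in>UNIV. \<Sum>k\<in>UNIV. (S u s j * raised u' t j) * (S v i k * raised v' i k))
    - (\<Sum>i\<in>UNIV. \<Sum>j\<in>UNIV. \<Sum>k\<in>UNIV. (S u s j * raised u' t k) * (S v i k * raised v' i j))
    - (\<Sum>i\<in>UNIV. \<Sum>j\<in>UNIV. \<Sum>k\<in>UNIV. (S u s k * raised u' t j) * (S v i j * raised v' i k))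
    + (\<Sum>i\<in>UNIV. \<Sum>j\<in>UNIV. \<Sum>k\<in>UNIV. (S u s k * raised u' t k) * (S v i j * raised v' i j))"
    by (simp only: sum_subtractf[symmetric] sum.distrib[symmetric]) (simp add: algebra_simps)
  then show ?thesis
    unfolding T1 T1' T2 T2' by (auto simp: algebra_simps)
qed

text \<open>
  Contracting three of the four indices leaves an endomorphism that is a multiple of the identity on each
  summand. Its trace is the norm; its trace against the Schouten tensor is the cubic term of \<open>L\<^sub>1\<close>.
\<close>

lemma split_curvature_contraction:
  "(\<Sum>i\<in>UNIV. \<Sum>j\<in>UNIV. \<Sum>k\<in>UNIV. split_curvature S K s i j k * raise4 H (split_curvature S K) t i j k)
   = (\<Sum>u\<in>UNIV. curvature_square d K u * proj u t s)"
proof -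
  let ?A = "\<lambda>u v i j k. S u s j * S v i k - S u s k * S v i j"
  let ?B = "\<lambda>u v i j k. raised u t j * raised v i k - raised u t k * raised v i j"
  have "(\<Sum>i\<in>UNIV. \<Sum>j\<in>UNIV. \<Sum>k\<in>UNIV. split_curvature S K s i j k * raise4 H (split_curvature S K) t i j k)
      = (\<Sum>i\<in>UNIV. \<Sum>j\<in>UNIV. \<Sum>k\<in>UNIV. \<Sum>u\<in>UNIV. \<Sum>v\<in>UNIV. \<Sum>u'\<in>UNIV. \<Sum>v'\<in>UNIV.
           K u v * K u' v' * (?A u' v' i j k * ?B u v i j k))"
    unfolding raise4_split_curvature unfolding split_curvature_def
    by (simp only: sum_distrib_left sum_distrib_right mult_ac)
  also have "\<dots> = (\<Sum>u\<in>UNIV. \<Sum>v\<in>UNIV. \<Sum>u'\<in>UNIV. \<Sum>v'\<in>UNIV. \<Sum>i\<in>UNIV. \<Sum>j\<in>UNIV. \<Sum>k\<in>UNIV.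
           K u v * K u' v' * (?A u' v' i j k * ?B u v i j k))"
    by (simp only: sum.swap[of _ "UNIV :: 'u set" "UNIV :: 'n set"])
  also have "\<dots> = (\<Sum>u\<in>UNIV. \<Sum>v\<in>UNIV. \<Sum>u'\<in>UNIV. \<Sum>v'\<in>UNIV. K u v * K u' v' *
           (if u' = u \<and> v' = v then 2 * (d v' - (if u' = v' then 1 else 0)) * proj u' t s else 0))"
    by (simp only: sum_distrib_left[symmetric] contract_basic)
  also have "\<dots> = (\<Sum>u\<in>UNIV. \<Sum>v\<in>UNIV. K u v * K u v * (2 * (d v - (if u = v then 1 else 0)) * proj u t s))"
  proof (intro sum.cong refl)
    fix u v
    have delta: "(\<Sum>v'\<in>UNIV. c u' v' * (if u' = u \<and> v' = v then e u' v' else 0))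
       = (if u' = u then c u v * e u v else 0)" for u' and c e :: "'u \<Rightarrow> 'u \<Rightarrow> real"
      by (cases "u' = u") (simp_all add: mult_delta_right)
    show "(\<Sum>u'\<in>UNIV. \<Sum>v'\<in>UNIV. K u v * K u' v' *
        (if u' = u \<and> v' = v then 2 * (d v' - (if u' = v' then 1 else 0)) * proj u' t s else 0))
      = K u v * K u v * (2 * (d v - (if u = v then 1 else 0)) * proj u t s)"
      unfolding delta[where c = "\<lambda>u' v'. K u v * K u' v'"
        and e = "\<lambda>u' v'. 2 * (d v' - (if u' = v' then 1 else 0)) * proj u' t s"] by simp
  qed
  also have "\<dots> = (\<Sum>u\<in>UNIV. curvature_square d K u * proj u t s)"
  proof (intro sum.cong refl)
    fix u
    have expand: "(\<Sum>v\<in>UNIV. K u v * K u v * (2 * (d v - (if u = v then 1 else 0)) * proj u t s))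
        = (\<Sum>v\<in>UNIV. 2 * proj u t s * ((K u v)\<^sup>2 * d v)) - (\<Sum>v\<in>UNIV. if u = v then 2 * proj u t s * (K u v)\<^sup>2 else 0)"
      unfolding sum_subtractf[symmetric]
      by (intro sum.cong refl) (simp add: algebra_simps power2_eq_square)
    show "(\<Sum>v\<in>UNIV. K u v * K u v * (2 * (d v - (if u = v then 1 else 0)) * proj u t s)) = curvature_square d K u * proj u t s"
      unfolding expand sum_distrib_left[symmetric] by (simp add: curvature_square_def algebra_simps)
  qed
  finally show ?thesis .
qed

lemma norm_sq4_split_curvature: "norm_sq4 H (split_curvature S K) = (\<Sum>u\<in>UNIV. curvature_square d K u * d u)"
proof -
  have "norm_sq4 H (split_curvature S K) = (\<Sum>i\<in>UNIV. \<Sum>u\<in>UNIV. curvature_square d K u * proj u i i)"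
    unfolding norm_sq4_def split_curvature_contraction ..
  then show ?thesis
    by (subst (asm) sum.swap) (simp add: sum_distrib_left[symmetric] trace_proj)
qed

lemma split_curvature_cubic:
  "(\<Sum>s\<in>UNIV. \<Sum>t\<in>UNIV. \<Sum>i\<in>UNIV. \<Sum>j\<in>UNIV. \<Sum>k\<in>UNIV.
      (\<Sum>a\<in>UNIV. H s a * (\<Sum>u\<in>UNIV. p u * S u t a)) * split_curvature S K s i j k * raise4 H (split_curvature S K) t i j k)
   = (\<Sum>u\<in>UNIV. p u * curvature_square d K u * d u)"
proof -
  have p: "(\<Sum>a\<in>UNIV. H s a * (\<Sum>u\<in>UNIV. p u * S u t a)) = (\<Sum>u\<in>UNIV. p u * proj u s t)" for s t
    unfolding proj_def sum_distrib_left by (subst sum.swap) (simp add: mult_ac S_sym)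
  have "(\<Sum>s\<in>UNIV. \<Sum>t\<in>UNIV. \<Sum>i\<in>UNIV. \<Sum>j\<in>UNIV. \<Sum>k\<in>UNIV.
      (\<Sum>a\<in>UNIV. H s a * (\<Sum>u\<in>UNIV. p u * S u t a)) * split_curvature S K s i j k * raise4 H (split_curvature S K) t i j k)
    = (\<Sum>s\<in>UNIV. \<Sum>t\<in>UNIV. (\<Sum>u\<in>UNIV. p u * proj u s t) * (\<Sum>u\<in>UNIV. curvature_square d K u * proj u t s))"
    unfolding p split_curvature_contraction[symmetric] by (simp add: sum_distrib_left mult_ac)
  also have "\<dots> = (\<Sum>s\<in>UNIV. \<Sum>t\<in>UNIV. \<Sum>u\<in>UNIV. \<Sum>v\<in>UNIV. p u * curvature_square d K v * (proj u s t * proj v t s))"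
    unfolding sum_product by (simp add: mult_ac)
  also have "\<dots> = (\<Sum>u\<in>UNIV. \<Sum>v\<in>UNIV. \<Sum>s\<in>UNIV. \<Sum>t\<in>UNIV. p u * curvature_square d K v * (proj u s t * proj v t s))"
    by (simp only: sum.swap[of _ "UNIV :: 'u set" "UNIV :: 'n set"])
  also have "\<dots> = (\<Sum>u\<in>UNIV. \<Sum>v\<in>UNIV. if u = v then p u * curvature_square d K v * d v else 0)"
    by (intro sum.cong refl) (simp add: sum_distrib_left[symmetric] proj_proj trace_proj)
  finally show ?thesis
    by simp
qed

lemma ricci_contraction:
  "(\<Sum>s\<in>UNIV. \<Sum>t\<in>UNIV. H s t * (\<Sum>u\<in>UNIV. \<kappa> u * (S u i j * S u s t - S u i t * S u s j)))
   = (\<Sum>u\<in>UNIV. \<kappa> u * (d u - 1) * S u i j)"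
proof -
  have "(\<Sum>s\<in>UNIV. \<Sum>t\<in>UNIV. H s t * (\<Sum>u\<in>UNIV. \<kappa> u * (S u i j * S u s t - S u i t * S u s j)))
    = (\<Sum>s\<in>UNIV. \<Sum>t\<in>UNIV. \<Sum>u\<in>UNIV. \<kappa> u * (S u i j * (H s t * S u s t) - H t s * S u i t * S u s j))"
    by (simp add: sum_distrib_left algebra_simps H_sym)
  also have "\<dots> = (\<Sum>u\<in>UNIV. \<Sum>s\<in>UNIV. \<Sum>t\<in>UNIV. \<kappa> u * (S u i j * (H s t * S u s t) - H t s * S u i t * S u s j))"
    by (simp only: sum.swap[of _ "UNIV :: 'u set" "UNIV :: 'n set"])
  also have "\<dots> = (\<Sum>u\<in>UNIV. \<kappa> u * (d u - 1) * S u i j)"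
  proof (intro sum.cong refl)
    fix u
    have "(\<Sum>s\<in>UNIV. \<Sum>t\<in>UNIV. H t s * S u i t * S u s j) = S u i j"
      by (subst sum.swap) (simp add: S_H_S)
    then show "(\<Sum>s\<in>UNIV. \<Sum>t\<in>UNIV. \<kappa> u * (S u i j * (H s t * S u s t) - H t s * S u i t * S u s j))
      = \<kappa> u * (d u - 1) * S u i j"
      by (simp only: sum_distrib_left[symmetric] sum_subtractf trace_S) (simp add: algebra_simps)
  qed
  finally show ?thesis .
qed

end

section \<open>Products of spheres in an orthogonally decomposed space\<close>

text \<open>
  The ambient space is an orthogonal direct sum, and the manifold is the product of the unit spheres of
  the summands. A one-element index type gives a single sphere and \<open>bool\<close> a product of two, so that
  both are treated at once.
\<close>

locale orthogonal_decomposition =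
  fixes pr :: "'u::finite \<Rightarrow> 'e::euclidean_space \<Rightarrow> 'e"
  assumes linear_pr: "linear (pr u)"
    and pr_adjoint: "pr u x \<bullet> y = x \<bullet> pr u y"
    and pr_pr: "pr u (pr v x) = (if u = v then pr u x else 0)"
    and sum_pr: "(\<Sum>u\<in>UNIV. pr u x) = x"
begin

definition sphere_product :: "'e set" where
  "sphere_product = {x. \<forall>u. norm (pr u x) = 1}"

text \<open>
  Multiplying the metric of a unit sphere by \<open>w u\<close> gives curvature \<open>1 / w u\<close>.
\<close>

definition weighted_metric :: "('u \<Rightarrow> real) \<Rightarrow> 'e two_tensor" where
  "weighted_metric w p x y = (\<Sum>u\<in>UNIV. w u * (pr u x \<bullet> pr u y))"

text \<open>
  The sum is the trace of \<open>pr u\<close>, which is the dimension of the summand; the sphere in it has one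
  dimension less.
\<close>

definition factor_dim :: "'u \<Rightarrow> real" where
  "factor_dim u = (\<Sum>b\<in>Basis. pr u b \<bullet> b) - 1"

lemmas pr_simps = linear_add[OF linear_pr] linear_diff[OF linear_pr] linear_cmul[OF linear_pr]
  linear_sum[OF linear_pr] linear_0[OF linear_pr]

lemma bounded_linear_pr: "bounded_linear (pr u)"
  using linear_pr by (simp add: linear_conv_bounded_linear)

lemma pr_inner_commute: "pr u x \<bullet> y = pr u y \<bullet> x"
  by (metis pr_adjoint inner_commute)

lemma pr_inner_pr: "pr u x \<bullet> pr v y = (if u = v then pr u x \<bullet> y else 0)"
  by (simp add: pr_adjoint pr_pr)

end

lemma inner_delta_left: "(if P then x else 0) \<bullet> y = (if P then x \<bullet> y else 0)"
  by simp

lemma matrix_inv_inverse: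
  fixes A :: "'a::field^'n^'n"
  assumes "invertible A"
  shows "A ** matrix_inv A = mat 1" "matrix_inv A ** A = mat 1"
  using someI_ex[OF assms[unfolded invertible_def]] by (auto simp: matrix_inv_def)

lemma partial_eqI: "(f has_derivative f') (at x) \<Longrightarrow> partial k f x = f' (axis k 1)"
  unfolding partial_def by (metis frechet_derivative_at)

lemma partial_cong:
  assumes "open U" "x \<in> U" "\<And>y. y \<in> U \<Longrightarrow> f y = g y"
  shows "partial k f x = partial k g x"
proof -
  have "(f has_derivative f') (at x) \<longleftrightarrow> (g has_derivative f') (at x)" for f'
    using assms by (metis has_derivative_transform_within_open)
  then show ?thesis
    by (simp add: partial_def frechet_derivative_def)
qed

lemma partial_const_on:
  assumes "open U" "x \<in> U" "\<And>y. y \<in> U \<Longrightarrow> f y = c"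
  shows "partial k f x = 0"
  using partial_cong[OF assms(1,2), of f "\<lambda>_. c"] assms(3)
  by (simp add: partial_def)

text \<open>
  The parametrization is arbitrary, since the density of the functional and the volume measure quantify
  over all of them. The condition on the dimensions says that the manifold has one normal direction
  in each summand.
\<close>

locale sphere_product_chart = orthogonal_decomposition pr
  for pr :: "'u::finite \<Rightarrow> 'e::euclidean_space \<Rightarrow> 'e" +
  fixes U :: "(real^'n) set" and \<psi> :: "real^'n \<Rightarrow> 'e" and w :: "'u \<Rightarrow> real"
  assumes param: "local_param sphere_product U \<psi>"
    and dims: "DIM('e) = CARD('n) + CARD('u)"
    and w_pos: "w u > 0"
begin

lemma open_U: "open U" and smooth: "smooth_on U \<psi>"
  and inj_derivative: "x \<in> U \<Longrightarrow> inj (frechet_derivative \<psi> (at x))"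
  and in_sphere_product: "x \<in> U \<Longrightarrow> \<psi> x \<in> sphere_product"
  using param openin_imp_subset unfolding local_param_def by blast+

definition D :: "'n \<Rightarrow> real^'n \<Rightarrow> 'e" where
  "D i y = frechet_derivative \<psi> (at y) (axis i 1)"

definition DD :: "'n \<Rightarrow> 'n \<Rightarrow> real^'n \<Rightarrow> 'e" where
  "DD k i y = frechet_derivative (D i) (at y) (axis k 1)"

definition G :: "real^'n \<Rightarrow> real^'n^'n" where
  "G = components \<psi> (weighted_metric w)"

text \<open>
  The metric of the \<open>u\<close>-th factor in the coordinates.
\<close>

definition S :: "real^'n \<Rightarrow> 'u \<Rightarrow> 'n \<Rightarrow> 'n \<Rightarrow> real" where
  "S x u i j = w u * (pr u (D i x) \<bullet> D j x)"

text \<open>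
  The constant inner product of the ambient space that induces the metric.
\<close>

definition ip :: "'e \<Rightarrow> 'e \<Rightarrow> real" where
  "ip x y = (\<Sum>u\<in>UNIV. w u * (pr u x \<bullet> y))"

lemma ip_sym: "ip x y = ip y x"
  unfolding ip_def by (intro sum.cong arg_cong2[of _ _ _ _ "(*)"] refl pr_inner_commute)

lemma ip_simps: "ip (x + y) z = ip x z + ip y z" "ip (x - y) z = ip x z - ip y z"
  "ip (a *\<^sub>R x) z = a * ip x z" "ip (sum f A) z = (\<Sum>a\<in>A. ip (f a) z)"
  "ip z (x + y) = ip z x + ip z y" "ip z (x - y) = ip z x - ip z y"
  "ip z (a *\<^sub>R x) = a * ip z x" "ip z (sum f A) = (\<Sum>a\<in>A. ip z (f a))"
  unfolding ip_def
  by (simp_all add: pr_simps inner_simps algebra_simps sum.distrib sum_subtractf sum_distrib_left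
      inner_sum_left inner_sum_right) (subst sum.swap, simp)+

lemma ip_pr: "ip (pr u x) y = w u * (pr u x \<bullet> y)"
  unfolding ip_def by (simp add: pr_pr if_distrib[of "\<lambda>z. z \<bullet> y"] mult_delta_right cong: if_cong)

lemma ip_self_eq_0: "ip x x = 0 \<Longrightarrow> x = 0"
proof -
  assume "ip x x = 0"
  moreover have nonneg: "w u * (pr u x \<bullet> x) \<ge> 0" for u
    using pr_inner_pr[of u x u x] w_pos[of u] inner_ge_zero[of "pr u x"] by simp
  ultimately have "w u * (pr u x \<bullet> x) = 0" for u
    unfolding ip_def by (subst (asm) sum_nonneg_eq_0_iff) auto
  then have "pr u x = 0" for u
    using pr_inner_pr[of u x u x] w_pos[of u] by (metis inner_eq_zero_iff less_irrefl mult_eq_0_iff)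
  with sum_pr[of x] show "x = 0"
    by simp
qed

lemma G_eq_ip: "G x $ i $ j = ip (D i x) (D j x)"
  unfolding G_def components_def pullback_def weighted_metric_def ip_def D_def
  by (simp add: pr_inner_pr)

lemma G_eq_sum_S: "G x $ i $ j = (\<Sum>u\<in>UNIV. S x u i j)"
  by (simp add: G_eq_ip ip_def S_def)

lemma S_eq_ip: "S x u i j = ip (pr u (D i x)) (D j x)"
  by (simp add: ip_pr S_def)

lemma S_sym: "S x u i j = S x u j i"
  unfolding S_def by (intro arg_cong2[of _ _ _ _ "(*)"] refl pr_inner_commute)

lemma smooth_D: "smooth_on U (D i)"
  unfolding D_def by (rule smooth_on_frechet_derivative[OF smooth])

lemma smooth_DD: "smooth_on U (DD k i)"
  unfolding DD_def by (rule smooth_on_frechet_derivative[OF smooth_D])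

lemma DD_sym: "x \<in> U \<Longrightarrow> DD i j x = DD j i x"
  unfolding DD_def D_def by (rule second_derivative_symmetric[OF open_U _ smooth])

lemma derivative_eq_sum_D:
  assumes "x \<in> U" shows "frechet_derivative \<psi> (at x) v = (\<Sum>i\<in>UNIV. v $ i *\<^sub>R D i x)"
proof -
  have lin: "linear (frechet_derivative \<psi> (at x))"
    using smooth_on_has_derivative[OF smooth assms] by (rule has_derivative_linear)
  have "v = (\<Sum>i\<in>UNIV. v $ i *\<^sub>R axis i 1)"
    using basis_expansion[of v] by (simp add: scalar_mult_eq_scaleR)
  then have "frechet_derivative \<psi> (at x) v = frechet_derivative \<psi> (at x) (\<Sum>i\<in>UNIV. v $ i *\<^sub>R axis i 1)"
    by simp
  then show ?thesis
    by (simp add: linear_sum[OF lin] linear_cmul[OF lin] D_def)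
qed

lemma partial_inner:
  fixes f g :: "real^'n \<Rightarrow> 'e"
  assumes "smooth_on U f" "smooth_on U g" "x \<in> U"
  shows "partial k (\<lambda>y. pr u (f y) \<bullet> g y) x
    = pr u (frechet_derivative f (at x) (axis k 1)) \<bullet> g x + pr u (f x) \<bullet> frechet_derivative g (at x) (axis k 1)"
  using partial_eqI[OF has_derivative_inner[OF
      bounded_linear.has_derivative[OF bounded_linear_pr smooth_on_has_derivative[OF assms(1,3)]]
      smooth_on_has_derivative[OF assms(2,3)]]]
  by simp

lemma unit_factors: "x \<in> U \<Longrightarrow> pr u (\<psi> x) \<bullet> \<psi> x = 1"
  using in_sphere_product[of x] pr_inner_pr[of u "\<psi> x" u "\<psi> x"]
  by (simp add: sphere_product_def norm_eq_sqrt_inner)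

text \<open>
  This is the derivative of the constant \<open>|pr u (\<psi> x)|\<^sup>2\<close>.
\<close>

lemma tangent_normal: "x \<in> U \<Longrightarrow> pr u (D i x) \<bullet> \<psi> x = 0"
proof -
  assume x: "x \<in> U"
  have "partial i (\<lambda>y. pr u (\<psi> y) \<bullet> \<psi> y) x = 0"
    by (rule partial_const_on[OF open_U x, of _ 1]) (simp add: unit_factors)
  then show ?thesis
    unfolding partial_inner[OF smooth smooth x] D_def[symmetric]
    using pr_inner_commute[of u "\<psi> x" "D i x"] by simp
qed

lemma tangent_normal': "x \<in> U \<Longrightarrow> pr u (\<psi> x) \<bullet> D i x = 0"
  using tangent_normal[of x u i] pr_inner_commute[of u "\<psi> x" "D i x"] by simp

text \<open>
  A further derivative of \<open>tangent_normal\<close> gives the normal part of the second derivatives.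
\<close>

lemma second_normal: "x \<in> U \<Longrightarrow> pr u (DD k i x) \<bullet> \<psi> x = - (pr u (D i x) \<bullet> D k x)"
proof -
  assume x: "x \<in> U"
  have "partial k (\<lambda>y. pr u (D i y) \<bullet> \<psi> y) x = 0"
    by (rule partial_const_on[OF open_U x, of _ 0]) (simp add: tangent_normal)
  then show ?thesis
    unfolding partial_inner[OF smooth_D smooth x] D_def[of k, symmetric] DD_def[symmetric] by simp
qed

text \<open>
  The coordinate tangent vectors and the normals \<open>pr u (\<psi> x)\<close> are linearly independent, and they are
  as many as the dimension of the ambient space.
\<close>

lemma tangent_normal_span:
  assumes x: "x \<in> U"
  obtains v s where "y = (\<Sum>i\<in>UNIV. v i *\<^sub>R D i x) + (\<Sum>u\<in>UNIV. s u *\<^sub>R pr u (\<psi> x))"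
proof -
  define F :: "(real^'n) \<times> (real^'u) \<Rightarrow> 'e" where
    "F p = frechet_derivative \<psi> (at x) (fst p) + (\<Sum>u\<in>UNIV. snd p $ u *\<^sub>R pr u (\<psi> x))" for p
  have lin: "linear (frechet_derivative \<psi> (at x))"
    using smooth_on_has_derivative[OF smooth x] by (rule has_derivative_linear)
  have linF: "linear F"
    by (rule linearI)
      (simp_all add: F_def linear_add[OF lin] linear_cmul[OF lin] scaleR_add_left sum.distrib
        scaleR_add_right scaleR_right.sum algebra_simps)
  moreover have "p = 0" if "F p = 0" for p
  proof -
    have "pr u (F p) \<bullet> \<psi> x = snd p $ u" for u
    proof -
      have "pr u (F p) \<bullet> \<psi> x = (\<Sum>v\<in>UNIV. if u = v then snd p $ v * (pr v (\<psi> x) \<bullet> \<psi> x) else 0)"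
        unfolding F_def derivative_eq_sum_D[OF x]
        by (simp add: pr_simps inner_add_left inner_sum_left tangent_normal[OF x] pr_pr
            inner_delta_left mult_delta_right)
      then show ?thesis
        by (simp add: unit_factors[OF x])
    qed
    with that have snd: "snd p = 0"
      by (simp add: vec_eq_iff pr_simps)
    with that have "frechet_derivative \<psi> (at x) (fst p) = 0"
      by (simp add: F_def)
    then have "fst p = 0"
      using inj_derivative[OF x] lin linear_injective_0 by blast
    with snd show "p = 0"
      by (simp add: prod_eq_iff)
  qed
  then have "inj F"
    using linF linear_injective_0 by blast
  ultimately have "surj F"
    by (rule linear_injective_imp_surjective) (simp add: dims)
  then obtain p where "y = F p"
    by (metis surjD)
  then show ?thesis
    using that[of "\<lambda>i. fst p $ i" "\<lambda>u. snd p $ u"] by (simp add: F_def derivative_eq_sum_D[OF x])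
qed

lemma eq_0_if_orthogonal:
  assumes x: "x \<in> U" and tangent: "\<And>i. ip z (D i x) = 0" and normal: "\<And>u. pr u z \<bullet> \<psi> x = 0"
  shows "z = 0"
proof -
  obtain v s where z: "z = (\<Sum>i\<in>UNIV. v i *\<^sub>R D i x) + (\<Sum>u\<in>UNIV. s u *\<^sub>R pr u (\<psi> x))"
    by (rule tangent_normal_span[OF x])
  have "ip z (pr u (\<psi> x)) = 0" for u
    using normal[of u] pr_inner_commute[of u "\<psi> x" z] by (simp add: ip_sym[of z] ip_pr)
  then have "ip z z = 0"
    by (subst (2) z) (simp add: ip_simps tangent)
  then show ?thesis
    by (rule ip_self_eq_0)
qed

lemma invertible_G:
  assumes x: "x \<in> U" shows "invertible (G x)"
proof -
  have "c = 0" if c: "G x *v c = 0" for c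
  proof -
    let ?z = "\<Sum>i\<in>UNIV. c $ i *\<^sub>R D i x"
    have "ip ?z (D j x) = (G x *v c) $ j" for j
      by (simp add: ip_simps matrix_vector_mult_def G_eq_ip ip_sym[of "D j x"] mult.commute)
    then have "?z = 0"
      using c by (intro eq_0_if_orthogonal[OF x])
        (simp_all add: pr_simps inner_sum_left tangent_normal[OF x])
    moreover have "linear (frechet_derivative \<psi> (at x))"
      using smooth_on_has_derivative[OF smooth x] by (rule has_derivative_linear)
    ultimately show "c = 0"
      using inj_derivative[OF x] linear_injective_0 derivative_eq_sum_D[OF x, of c] by metis
  qed
  then show ?thesis
    by (simp add: invertible_left_inverse matrix_left_invertible_ker)
qed

lemma ginv_G: "x \<in> U \<Longrightarrow> (\<Sum>l\<in>UNIV. ginv G x i l * G x $ l $ j) = (if i = j then 1 else 0)"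
  using matrix_inv_inverse(2)[OF invertible_G, of x]
  by (simp add: ginv_def vec_eq_iff matrix_matrix_mult_def mat_def)

lemma ginv_sym:
  assumes x: "x \<in> U" shows "ginv G x i j = ginv G x j i"
proof -
  let ?H = "matrix_inv (G x)"
  have sym: "transpose (G x) = G x"
    by (simp add: vec_eq_iff transpose_def G_eq_ip ip_sym)
  have "transpose ?H ** G x = mat 1"
    using matrix_inv_inverse(1)[OF invertible_G[OF x]] sym by (metis matrix_transpose_mul transpose_mat)
  then have "transpose ?H = ?H"
    by (metis invertible_G[OF x] matrix_inv_inverse(1) matrix_mul_assoc matrix_mul_lid matrix_mul_rid)
  then have "transpose ?H $ i $ j = ?H $ i $ j"
    by simp
  then show ?thesis
    by (simp add: ginv_def transpose_def)
qed

text \<open>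
  The resolution of the identity by the tangent frame and the normals. All contractions with the inverse
  metric are evaluated through it.
\<close>

lemma completeness:
  assumes x: "x \<in> U"
  shows "y = (\<Sum>s\<in>UNIV. \<Sum>t\<in>UNIV. (ginv G x s t * ip y (D s x)) *\<^sub>R D t x)
    + (\<Sum>u\<in>UNIV. (pr u y \<bullet> \<psi> x) *\<^sub>R pr u (\<psi> x))" (is "y = ?T + ?N")
proof -
  have "y - (?T + ?N) = 0"
  proof (rule eq_0_if_orthogonal[OF x])
    fix j
    have "ip ?T (D j x) = (\<Sum>s\<in>UNIV. ip y (D s x) * (\<Sum>t\<in>UNIV. ginv G x s t * G x $ t $ j))"
      by (simp add: ip_simps G_eq_ip sum_distrib_left mult_ac)
    also have "\<dots> = ip y (D j x)"
      by (simp add: ginv_G[OF x] mult_delta_right)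
    finally show "ip (y - (?T + ?N)) (D j x) = 0"
      by (simp add: ip_simps ip_pr tangent_normal'[OF x])
  next
    fix u
    have "pr u ?N \<bullet> \<psi> x = (\<Sum>v\<in>UNIV. if u = v then (pr v y \<bullet> \<psi> x) * (pr v (\<psi> x) \<bullet> \<psi> x) else 0)"
      by (simp add: pr_simps inner_sum_left pr_pr inner_delta_left mult_delta_right)
    then show "pr u (y - (?T + ?N)) \<bullet> \<psi> x = 0"
      by (simp add: pr_simps inner_simps inner_sum_left tangent_normal[OF x] unit_factors[OF x])
  qed
  then show ?thesis
    by simp
qed

text \<open>
  The projection property is \<open>completeness\<close> for the tangent vectors \<open>pr u (D i x)\<close>, and the trace is
  \<open>completeness\<close> for the basis of the ambient space.
\<close>

lemma splitting:
  assumes x: "x \<in> U" shows "orthogonal_splitting (ginv G x) (S x) factor_dim"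
proof
  fix i j :: 'n and u v :: 'u
  show "ginv G x i j = ginv G x j i"
    by (rule ginv_sym[OF x])
  show "S x u i j = S x u j i"
    by (rule S_sym)
  have norm0: "pr v (pr u (D i x)) \<bullet> \<psi> x = 0" for v
    by (simp add: pr_pr tangent_normal[OF x])
  have "S x v t j = ip (D t x) (pr v (D j x))" for t
    by (subst S_sym, subst ip_sym) (rule S_eq_ip)
  then have "(\<Sum>s\<in>UNIV. \<Sum>t\<in>UNIV. ginv G x s t * S x u i s * S x v t j)
      = ip (\<Sum>s\<in>UNIV. \<Sum>t\<in>UNIV. (ginv G x s t * ip (pr u (D i x)) (D s x)) *\<^sub>R D t x) (pr v (D j x))"
    by (simp add: ip_simps S_eq_ip)
  also have "\<dots> = ip (pr u (D i x)) (pr v (D j x))"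
    using completeness[OF x, of "pr u (D i x)"] by (simp add: norm0)
  also have "\<dots> = (if u = v then S x u i j else 0)"
    by (simp add: ip_pr pr_inner_pr S_def)
  finally show "(\<Sum>s\<in>UNIV. \<Sum>t\<in>UNIV. ginv G x s t * S x u i s * S x v t j) = (if u = v then S x u i j else 0)" .
next
  fix u
  have S: "S x u s t = (\<Sum>b\<in>Basis. ip (pr u b) (D s x) * (D t x \<bullet> b))" for s t
  proof -
    have "ip (pr u b) (D s x) = w u * (pr u (D s x) \<bullet> b)" for b
      by (simp add: ip_pr pr_adjoint inner_commute)
    then show ?thesis
      unfolding S_def by (subst euclidean_inner) (simp add: sum_distrib_left mult_ac)
  qed
  have "(\<Sum>s\<in>UNIV. \<Sum>t\<in>UNIV. ginv G x s t * S x u s t)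
      = (\<Sum>b\<in>Basis. \<Sum>s\<in>UNIV. \<Sum>t\<in>UNIV. (ginv G x s t * ip (pr u b) (D s x)) * (D t x \<bullet> b))"
    unfolding S sum_distrib_left
    by (simp only: sum.swap[of _ "Basis :: 'e set" "UNIV :: 'n set"] mult.assoc)
  also have "\<dots> = (\<Sum>b\<in>Basis. pr u b \<bullet> b - (pr u (\<psi> x) \<bullet> b) * (pr u (\<psi> x) \<bullet> b))"
  proof (intro sum.cong refl)
    fix b :: 'e
    have "(\<Sum>s\<in>UNIV. \<Sum>t\<in>UNIV. (ginv G x s t * ip (pr u b) (D s x)) * (D t x \<bullet> b))
      = (\<Sum>s\<in>UNIV. \<Sum>t\<in>UNIV. (ginv G x s t * ip (pr u b) (D s x)) *\<^sub>R D t x) \<bullet> b"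
      by (simp add: inner_sum_left)
    also have "\<dots> = (pr u b - (\<Sum>v\<in>UNIV. (pr v (pr u b) \<bullet> \<psi> x) *\<^sub>R pr v (\<psi> x))) \<bullet> b"
      by (rule arg_cong2[where f = "(\<bullet>)"], unfold eq_diff_eq)
        (rule completeness[OF x, of "pr u b", symmetric], rule refl)
    also have "(\<Sum>v\<in>UNIV. (pr v (pr u b) \<bullet> \<psi> x) *\<^sub>R pr v (\<psi> x))
      = (\<Sum>v\<in>UNIV. if v = u then (pr u b \<bullet> \<psi> x) *\<^sub>R pr u (\<psi> x) else 0)"
      by (intro sum.cong) (auto simp: pr_pr)
    also have "(pr u b - \<dots>) \<bullet> b = pr u b \<bullet> b - (pr u (\<psi> x) \<bullet> b) * (pr u (\<psi> x) \<bullet> b)"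
      by (simp add: inner_diff_left pr_inner_commute[of u b "\<psi> x"])
    finally show "(\<Sum>s\<in>UNIV. \<Sum>t\<in>UNIV. (ginv G x s t * ip (pr u b) (D s x)) * (D t x \<bullet> b))
      = pr u b \<bullet> b - (pr u (\<psi> x) \<bullet> b) * (pr u (\<psi> x) \<bullet> b)" .
  qed
  also have "\<dots> = (\<Sum>b\<in>Basis. pr u b \<bullet> b) - pr u (\<psi> x) \<bullet> pr u (\<psi> x)"
    by (subst euclidean_inner[of "pr u (\<psi> x)"]) (simp add: sum_subtractf)
  also have "\<dots> = factor_dim u"
    by (simp add: factor_dim_def pr_inner_pr unit_factors[OF x])
  finally show "(\<Sum>s\<in>UNIV. \<Sum>t\<in>UNIV. ginv G x s t * S x u s t) = factor_dim u" .
qed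

end

section \<open>The Gauss formula and the Gauss equation\<close>

lemma differentiable_prod_real:
  fixes f :: "'i \<Rightarrow> 'a::real_normed_vector \<Rightarrow> real"
  assumes "\<And>i. i \<in> I \<Longrightarrow> f i differentiable (at x)"
  shows "(\<lambda>y. \<Prod>i\<in>I. f i y) differentiable (at x)"
  using assms by (induction I rule: infinite_finite_induct) simp_all

lemma differentiable_transform_open:
  assumes "f differentiable (at x)" "open U" "x \<in> U" "\<And>y. y \<in> U \<Longrightarrow> f y = g y"
  shows "g differentiable (at x)"
  using assms unfolding differentiable_def by (metis has_derivative_transform_within_open)

lemma differentiable_det:
  fixes A :: "'a::real_normed_vector \<Rightarrow> real^'n^'n"
  assumes "\<And>i j. (\<lambda>y. A y $ i $ j) differentiable (at x)"
  shows "(\<lambda>y. det (A y)) differentiable (at x)"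
  unfolding det_def by (intro differentiable_sum differentiable_mult differentiable_prod_real)
    (simp_all add: assms differentiable_prod_real)

text \<open>
  Cramer's rule expresses the inverse metric by determinants, which shows that it is differentiable.
\<close>

lemma ginv_cramer:
  assumes "invertible (G x)"
  shows "ginv G x i j
    = det (\<chi> a b. if b = i then axis j 1 $ a else (G x $ a $ b :: real)) / det (G x)"
proof -
  have "matrix_inv (G x) *v axis j 1 = (\<chi> k. det (\<chi> a b. if b = k then axis j 1 $ a else G x $ a $ b) / det (G x))"
    using assms by (subst cramer[symmetric])
      (simp_all add: invertible_det_nz matrix_vector_mul_assoc matrix_inv_inverse)
  moreover have "(matrix_inv (G x) *v axis j 1) $ i = matrix_inv (G x) $ i $ j"
    by (simp add: matrix_vector_mul_component inner_axis)
  ultimately show ?thesis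
    by (simp add: ginv_def)
qed

context sphere_product_chart
begin

lemma smooth_ip:
  fixes f g :: "real^'n \<Rightarrow> 'e"
  assumes "smooth_on U f" "smooth_on U g"
  shows "smooth_on U (\<lambda>y. ip (f y) (g y))"
  unfolding ip_def
  by (intro smooth_on_sum smooth_on_bilinear[OF open_U bounded_bilinear_mult] smooth_on_inner
      smooth_on_linear[OF open_U bounded_linear_pr] smooth_on_const open_U assms)

lemma differentiable_ip:
  fixes f g :: "real^'n \<Rightarrow> 'e"
  assumes "x \<in> U" "smooth_on U f" "smooth_on U g"
  shows "(\<lambda>y. ip (f y) (g y)) differentiable (at x)"
  using smooth_on_has_derivative[OF smooth_ip[OF assms(2,3)] assms(1)] by (auto simp: differentiable_def)

lemma differentiable_ginv:
  assumes x: "x \<in> U" shows "(\<lambda>y. ginv G y i j) differentiable (at x)"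
proof -
  have entry: "(\<lambda>y. G y $ a $ b) differentiable (at x)" for a b
    unfolding G_eq_ip by (rule differentiable_ip[OF x smooth_D smooth_D])
  have entry': "(\<lambda>y. if b = i then c else G y $ a $ b) differentiable (at x)" for a b c
    by (cases "b = i") (simp_all add: entry)
  have "det (G x) \<noteq> 0"
    using invertible_G[OF x] invertible_det_nz by blast
  then have "(\<lambda>y. det (\<chi> a b. if b = i then axis j 1 $ a else (G y $ a $ b :: real)) / det (G y)) differentiable (at x)"
    by (intro differentiable_divide differentiable_det) (simp_all add: entry entry')
  then show ?thesis
    by (rule differentiable_transform_open[OF _ open_U x]) (simp add: ginv_cramer[OF invertible_G])
qed

abbreviation \<Gamma> :: "real^'n \<Rightarrow> 'n \<Rightarrow> 'n \<Rightarrow> 'n \<Rightarrow> real" where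
  "\<Gamma> \<equiv> christoffel G"

lemma partial_ip:
  fixes f g :: "real^'n \<Rightarrow> 'e"
  assumes "smooth_on U f" "smooth_on U g" "x \<in> U"
  shows "partial k (\<lambda>y. ip (f y) (g y)) x
    = ip (frechet_derivative f (at x) (axis k 1)) (g x) + ip (f x) (frechet_derivative g (at x) (axis k 1))"
proof -
  have "((\<lambda>y. ip (f y) (g y)) has_derivative (\<lambda>v. ip (frechet_derivative f (at x) v) (g x)
      + ip (f x) (frechet_derivative g (at x) v))) (at x)"
    unfolding ip_def using assms
    by (auto intro!: derivative_eq_intros bounded_linear.has_derivative[OF bounded_linear_pr]
        smooth_on_has_derivative simp: algebra_simps sum.distrib)
  from partial_eqI[OF this] show ?thesis .
qed

lemma partial_G:
  "x \<in> U \<Longrightarrow> partial k (\<lambda>y. G y $ i $ j) x = ip (DD k i x) (D j x) + ip (D i x) (DD k j x)"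
  unfolding G_eq_ip DD_def by (rule partial_ip[OF smooth_D smooth_D])

text \<open>
  The Christoffel symbols are the tangential components of the second derivatives of \<open>\<psi>\<close>: in the
  combination of first derivatives of the metric, four of the six terms cancel and two agree.
\<close>

lemma christoffel_eq:
  assumes x: "x \<in> U"
  shows "\<Gamma> x m i j = (\<Sum>l\<in>UNIV. ginv G x m l * ip (DD i j x) (D l x))"
proof -
  have "partial i (\<lambda>y. G y $ j $ l) x + partial j (\<lambda>y. G y $ i $ l) x - partial l (\<lambda>y. G y $ i $ j) x
      = 2 * ip (DD i j x) (D l x)" for l
    using DD_sym[OF x, of i l] DD_sym[OF x, of j l] DD_sym[OF x, of i j]
    by (simp add: partial_G[OF x] ip_sym[of "D j x"] ip_sym[of "D i x"])
  then show ?thesis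
    unfolding christoffel_def by (simp add: sum_divide_distrib)
qed

lemma differentiable_christoffel:
  assumes x: "x \<in> U" shows "(\<lambda>y. \<Gamma> y m i j) differentiable (at x)"
proof -
  have "(\<lambda>y. \<Sum>l\<in>UNIV. ginv G y m l * ip (DD i j y) (D l y)) differentiable (at x)"
    by (simp add: differentiable_ginv[OF x] differentiable_ip[OF x smooth_DD smooth_D])
  then show ?thesis
    by (rule differentiable_transform_open[OF _ open_U x]) (simp add: christoffel_eq)
qed

text \<open>
  The expansion of \<open>DD i j x\<close> by \<open>completeness\<close>, with \<open>christoffel_eq\<close> for the tangential and
  \<open>second_normal\<close> for the normal coefficients.
\<close>

theorem gauss_formula:
  assumes x: "x \<in> U"
  shows "DD i j x = (\<Sum>m\<in>UNIV. \<Gamma> x m i j *\<^sub>R D m x) - (\<Sum>u\<in>UNIV. (S x u i j / w u) *\<^sub>R pr u (\<psi> x))"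
proof -
  have "(\<Sum>m\<in>UNIV. \<Gamma> x m i j *\<^sub>R D m x)
      = (\<Sum>s\<in>UNIV. \<Sum>t\<in>UNIV. (ginv G x s t * ip (DD i j x) (D s x)) *\<^sub>R D t x)"
    unfolding christoffel_eq[OF x] scaleR_sum_left
    by (subst sum.swap) (simp add: ginv_sym[OF x])
  moreover have "S x u i j / w u = - (pr u (DD i j x) \<bullet> \<psi> x)" for u
    using w_pos[of u] by (simp add: second_normal[OF x] S_sym[of x u i j]) (simp add: S_def)
  ultimately show ?thesis
    using completeness[OF x, of "DD i j x"] by (simp add: sum_negf)
qed

text \<open>
  The metric of each factor is parallel: after projection with \<open>pr u\<close> the normal part of the Gauss formula
  is still a normal vector, and it disappears in the product with a tangent vector.
\<close>

lemma partial_S: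
  assumes x: "x \<in> U"
  shows "partial k (\<lambda>y. S y u i j) x
    = (\<Sum>m\<in>UNIV. \<Gamma> x m k i * S x u m j + \<Gamma> x m k j * S x u i m)"
proof -
  have half: "w u * (pr u (DD k i x) \<bullet> D j x) = (\<Sum>m\<in>UNIV. \<Gamma> x m k i * S x u m j)" for i j
    unfolding gauss_formula[OF x] S_def
    by (simp add: pr_simps pr_pr inner_diff_left inner_sum_left inner_delta_left tangent_normal'[OF x]
        mult_delta_left sum_distrib_left mult_ac)
  have "((\<lambda>y. S y u i j) has_derivative (\<lambda>v. w u * (pr u (frechet_derivative (D i) (at x) v) \<bullet> D j x
      + pr u (D i x) \<bullet> frechet_derivative (D j) (at x) v))) (at x)"
    unfolding S_def
    by (auto intro!: derivative_eq_intros bounded_linear.has_derivative[OF bounded_linear_pr]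
        smooth_on_has_derivative[OF smooth_D] x simp: algebra_simps)
  from partial_eqI[OF this] have "partial k (\<lambda>y. S y u i j) x
      = w u * (pr u (DD k i x) \<bullet> D j x) + w u * (pr u (DD k j x) \<bullet> D i x)"
    by (simp add: DD_def distrib_left pr_inner_commute[of u "D i x"])
  then show ?thesis
    unfolding half by (simp add: sum.distrib S_sym[of x u i])
qed

lemma differentiable_S: "x \<in> U \<Longrightarrow> (\<lambda>y. S y u i j) differentiable (at x)"
  unfolding S_eq_ip
  by (rule differentiable_ip[OF _ smooth_on_linear[OF open_U bounded_linear_pr smooth_D] smooth_D])

text \<open>
  The tangential component of the derivative of the Gauss formula. The first sum is one of the
  two parts whose difference defines the curvature tensor; the second comes from the derivatives of the
  normals \<open>pr u (\<psi> x)\<close>, which are the tangent vectors \<open>pr u (D i x)\<close>.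
\<close>

lemma partial_DD_contracted:
  assumes x: "x \<in> U"
  shows "ip (D k x) (frechet_derivative (DD j l) (at x) (axis i 1))
    = (\<Sum>m\<in>UNIV. G x $ k $ m * (partial i (\<lambda>y. \<Gamma> y m j l) x + (\<Sum>p\<in>UNIV. \<Gamma> x m i p * \<Gamma> x p j l)))
      - (\<Sum>u\<in>UNIV. S x u i k * S x u j l / w u)"
proof -
  (* The product with the tangent vector at x is written with the constant vector c, so that only the
     second derivatives have to be differentiated. *)
  let ?c = "\<Sum>u\<in>UNIV. w u *\<^sub>R pr u (D k x)"
  have ip_c: "ip (D k x) y = ?c \<bullet> y" for y
    by (simp add: ip_def inner_sum_left)
  have c1: "?c \<bullet> pr u (\<psi> x) = 0" for u
    by (simp add: ip_c[symmetric] ip_sym[of "D k x"] ip_pr tangent_normal'[OF x])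
  have c2: "?c \<bullet> pr u (D i x) = S x u i k" for u
    by (simp add: ip_c[symmetric] ip_sym[of "D k x"] S_eq_ip)
  have c3: "?c \<bullet> D m x = G x $ k $ m" for m
    by (simp add: ip_c[symmetric] G_eq_ip)
  have c4: "?c \<bullet> DD i m x = (\<Sum>p\<in>UNIV. \<Gamma> x p i m * G x $ k $ p)" for m
    by (simp add: ip_c[symmetric] gauss_formula[OF x] ip_simps ip_sym[of "D k x" "pr _ _"] ip_pr
        tangent_normal'[OF x] G_eq_ip)
  have \<Gamma>_der: "((\<lambda>y. \<Gamma> y m j l) has_derivative frechet_derivative (\<lambda>y. \<Gamma> y m j l) (at x)) (at x)" for m
    using differentiable_christoffel[OF x] by (simp add: frechet_derivative_works[symmetric])
  have S_der: "((\<lambda>y. S y u j l) has_derivative frechet_derivative (\<lambda>y. S y u j l) (at x)) (at x)" for u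
    using differentiable_S[OF x] by (simp add: frechet_derivative_works[symmetric])
  have "((\<lambda>y. ?c \<bullet> DD j l y) has_derivative (\<lambda>v. ?c \<bullet> frechet_derivative (DD j l) (at x) v)) (at x)"
    by (rule has_derivative_inner_right[OF smooth_on_has_derivative[OF smooth_DD x]])
  from partial_eqI[OF this] have "ip (D k x) (frechet_derivative (DD j l) (at x) (axis i 1))
      = partial i (\<lambda>y. ?c \<bullet> DD j l y) x"
    by (simp add: ip_c)
  also have "\<dots> = partial i (\<lambda>y. (\<Sum>m\<in>UNIV. \<Gamma> y m j l * (?c \<bullet> D m y))
      - (\<Sum>u\<in>UNIV. S y u j l * (?c \<bullet> pr u (\<psi> y)) / w u)) x"
    by (rule partial_cong[OF open_U x])
      (simp add: gauss_formula inner_diff_right inner_sum_right)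
  also have "\<dots> = (\<Sum>m\<in>UNIV. \<Gamma> x m j l * (?c \<bullet> DD i m x) + partial i (\<lambda>y. \<Gamma> y m j l) x * (?c \<bullet> D m x))
      - (\<Sum>u\<in>UNIV. (S x u j l * (?c \<bullet> pr u (D i x)) + partial i (\<lambda>y. S y u j l) x * (?c \<bullet> pr u (\<psi> x))) / w u)"
  proof -
    have "((\<lambda>y. (\<Sum>m\<in>UNIV. \<Gamma> y m j l * (?c \<bullet> D m y)) - (\<Sum>u\<in>UNIV. S y u j l * (?c \<bullet> pr u (\<psi> y)) / w u))
      has_derivative (\<lambda>v. (\<Sum>m\<in>UNIV. \<Gamma> x m j l * (?c \<bullet> frechet_derivative (D m) (at x) v)
            + frechet_derivative (\<lambda>y. \<Gamma> y m j l) (at x) v * (?c \<bullet> D m x))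
        - (\<Sum>u\<in>UNIV. (S x u j l * (?c \<bullet> pr u (frechet_derivative \<psi> (at x) v))
            + frechet_derivative (\<lambda>y. S y u j l) (at x) v * (?c \<bullet> pr u (\<psi> x))) / w u))) (at x)"
      unfolding divide_inverse
      by (intro has_derivative_diff has_derivative_sum has_derivative_mult_left has_derivative_mult
          \<Gamma>_der S_der has_derivative_inner_right bounded_linear.has_derivative[OF bounded_linear_pr]
          smooth_on_has_derivative[OF smooth_D x] smooth_on_has_derivative[OF smooth x])
    from partial_eqI[OF this] show ?thesis
      by (simp add: DD_def partial_def D_def[of i, symmetric])
  qed
  also have "\<dots> = (\<Sum>m\<in>UNIV. \<Gamma> x m j l * (\<Sum>p\<in>UNIV. \<Gamma> x p i m * G x $ k $ p)
        + partial i (\<lambda>y. \<Gamma> y m j l) x * G x $ k $ m) - (\<Sum>u\<in>UNIV. S x u j l * S x u i k / w u)"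
    by (simp only: c1 c2 c3 c4 mult_zero_right add_0_right)
  also have "(\<Sum>m\<in>UNIV. \<Gamma> x m j l * (\<Sum>p\<in>UNIV. \<Gamma> x p i m * G x $ k $ p)
        + partial i (\<lambda>y. \<Gamma> y m j l) x * G x $ k $ m)
     = (\<Sum>m\<in>UNIV. G x $ k $ m * (partial i (\<lambda>y. \<Gamma> y m j l) x + (\<Sum>p\<in>UNIV. \<Gamma> x m i p * \<Gamma> x p j l)))"
  proof -
    have "(\<Sum>m\<in>UNIV. \<Gamma> x m j l * (\<Sum>p\<in>UNIV. \<Gamma> x p i m * G x $ k $ p))
       = (\<Sum>m\<in>UNIV. G x $ k $ m * (\<Sum>p\<in>UNIV. \<Gamma> x m i p * \<Gamma> x p j l))"
      unfolding sum_distrib_left by (subst sum.swap) (simp add: mult_ac)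
    then show ?thesis
      by (simp add: sum.distrib distrib_left mult.commute)
  qed
  finally show ?thesis
    by (simp add: mult.commute)
qed

text \<open>
  The Gauss equation. The third derivatives of \<open>\<psi>\<close> are symmetric, so \<open>partial_DD_contracted\<close> has the same value after
  \<open>i\<close> and \<open>j\<close> are exchanged; the difference of the two right hand sides is the claim.
\<close>

theorem riemann_eq:
  assumes x: "x \<in> U"
  shows "riemann G x i j k l
    = (\<Sum>u\<in>UNIV. 1 / w u * (S x u i k * S x u j l - S x u i l * S x u j k))"
proof -
  have "frechet_derivative (DD j l) (at x) (axis i 1) = frechet_derivative (DD i l) (at x) (axis j 1)"
    unfolding DD_def[abs_def] by (rule second_derivative_symmetric[OF open_U x smooth_D])
  from arg_cong[OF this, of "ip (D k x)"]
  have "(\<Sum>m\<in>UNIV. G x $ k $ m * (partial i (\<lambda>y. \<Gamma> y m j l) x + (\<Sum>p\<in>UNIV. \<Gamma> x m i p * \<Gamma> x p j l)))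
      - (\<Sum>m\<in>UNIV. G x $ k $ m * (partial j (\<lambda>y. \<Gamma> y m i l) x + (\<Sum>p\<in>UNIV. \<Gamma> x m j p * \<Gamma> x p i l)))
    = (\<Sum>u\<in>UNIV. S x u i k * S x u j l / w u) - (\<Sum>u\<in>UNIV. S x u j k * S x u i l / w u)"
    unfolding partial_DD_contracted[OF x] by simp
  then show ?thesis
    unfolding riemann_def sum_subtractf[symmetric]
    by (simp add: algebra_simps sum_subtractf diff_divide_distrib)
qed

end

section \<open>The invariant on a product of spheres\<close>

context sphere_product_chart
begin

text \<open>
  The trace of the Schouten tensor, and the coefficients of the Schouten and Weyl tensors with respect to
  the factor metrics. None of them depends on the point.
\<close>

definition J :: real where
  "J = (\<Sum>u\<in>UNIV. 1 / w u * (factor_dim u - 1) * factor_dim u) / (2 * (real CARD('n) - 1))"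

definition schouten_coeff :: "'u \<Rightarrow> real" where
  "schouten_coeff u = (1 / w u * (factor_dim u - 1) - J) / (real CARD('n) - 2)"

definition weyl_coeff :: "'u \<Rightarrow> 'u \<Rightarrow> real" where
  "weyl_coeff u v = (if u = v then 1 / w u else 0) - schouten_coeff u - schouten_coeff v"

lemma ricci_eq:
  assumes x: "x \<in> U"
  shows "ricci G x i j = (\<Sum>u\<in>UNIV. 1 / w u * (factor_dim u - 1) * S x u i j)"
proof -
  interpret orthogonal_splitting "ginv G x" "S x" factor_dim
    by (rule splitting[OF x])
  show ?thesis
    unfolding ricci_def riemann_eq[OF x] by (rule ricci_contraction)
qed

lemma schouten_trace_eq:
  assumes x: "x \<in> U"
  shows "schouten_trace G x = J"
proof -
  interpret orthogonal_splitting "ginv G x" "S x" factor_dim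
    by (rule splitting[OF x])
  have "scalar_curv G x
      = (\<Sum>u\<in>UNIV. \<Sum>i\<in>UNIV. \<Sum>j\<in>UNIV. 1 / w u * (factor_dim u - 1) * (ginv G x i j * S x u i j))"
    unfolding scalar_curv_def ricci_eq[OF x] sum_distrib_left
    by (simp only: sum.swap[of _ "UNIV :: 'u set" "UNIV :: 'n set"] mult_ac)
  then show ?thesis
    by (simp only: schouten_trace_def J_def sum_distrib_left[symmetric] trace_S)
qed

lemma schouten_eq:
  assumes x: "x \<in> U"
  shows "schouten G x i j = (\<Sum>u\<in>UNIV. schouten_coeff u * S x u i j)"
  unfolding schouten_def ricci_eq[OF x] schouten_trace_eq[OF x] G_eq_sum_S schouten_coeff_def
  by (simp add: sum_distrib_left sum_subtractf[symmetric] sum_divide_distrib left_diff_distrib)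

lemma weyl_eq:
  assumes x: "x \<in> U"
  shows "weyl G x = split_curvature (S x) weyl_coeff"
proof (intro ext)
  fix i j k l
  have prod: "schouten G x a b * G x $ c $ e
      = (\<Sum>u\<in>UNIV. \<Sum>v\<in>UNIV. schouten_coeff u * (S x u a b * S x v c e))" for a b c e
    unfolding schouten_eq[OF x] G_eq_sum_S sum_product by (simp add: mult.assoc)
  have prod': "schouten G x a b * G x $ c $ e
      = (\<Sum>u\<in>UNIV. \<Sum>v\<in>UNIV. schouten_coeff v * (S x u c e * S x v a b))" for a b c e
    unfolding prod by (subst sum.swap) (simp add: mult.commute)
  have riem: "riemann G x i j k l = (\<Sum>u\<in>UNIV. \<Sum>v\<in>UNIV. (if u = v then 1 / w u else 0)
      * (S x u i k * S x v j l - S x u i l * S x v j k))"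
    unfolding riemann_eq[OF x] by (simp add: mult_delta_left)
  show "weyl G x i j k l = split_curvature (S x) weyl_coeff i j k l"
    unfolding weyl_def riem prod[of i k j l] prod'[of j l i k] prod[of i l j k] prod'[of j k i l]
      split_curvature_def sum_subtractf[symmetric] sum.distrib[symmetric]
    by (intro sum.cong refl) (simp add: weyl_coeff_def algebra_simps)
qed

lemma schouten_parallel:
  assumes x: "x \<in> U"
  shows "nabla2 G (schouten G) x m i j = 0"
proof -
  have S_der: "((\<lambda>y. S y u i j) has_derivative frechet_derivative (\<lambda>y. S y u i j) (at x)) (at x)" for u
    using differentiable_S[OF x] by (simp add: frechet_derivative_works[symmetric])
  have "((\<lambda>y. \<Sum>u\<in>UNIV. schouten_coeff u * S y u i j) has_derivative
      (\<lambda>v. \<Sum>u\<in>UNIV. schouten_coeff u * frechet_derivative (\<lambda>y. S y u i j) (at x) v)) (at x)"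
    by (intro has_derivative_sum has_derivative_mult_right S_der)
  from partial_eqI[OF this]
  have "partial m (\<lambda>y. schouten G y i j) x = (\<Sum>u\<in>UNIV. schouten_coeff u * partial m (\<lambda>y. S y u i j) x)"
    using partial_cong[OF open_U x, of "\<lambda>y. schouten G y i j" "\<lambda>y. \<Sum>u\<in>UNIV. schouten_coeff u * S y u i j" m]
    by (simp add: schouten_eq partial_def)
  also have "\<dots> = (\<Sum>u\<in>UNIV. \<Sum>p\<in>UNIV. schouten_coeff u * (\<Gamma> x p m i * S x u p j + \<Gamma> x p m j * S x u i p))"
    unfolding partial_S[OF x] sum_distrib_left ..
  also have "\<dots> = (\<Sum>p\<in>UNIV. \<Gamma> x p m i * schouten G x p j + \<Gamma> x p m j * schouten G x i p)"
    unfolding schouten_eq[OF x] sum_distrib_left sum.distrib[symmetric]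
    by (subst sum.swap) (simp add: algebra_simps)
  finally show ?thesis
    by (simp add: nabla2_def)
qed

lemma cotton_eq_0: "x \<in> U \<Longrightarrow> cotton G x i j k = 0"
  by (simp add: cotton_def schouten_parallel)

text \<open>
  The Weyl tensor is a polynomial with constant coefficients in the parallel forms \<open>S x u\<close>.
\<close>

lemma weyl_parallel:
  assumes x: "x \<in> U"
  shows "nabla4 G (weyl G) x m i j k l = 0"
proof -
  have S_der: "((\<lambda>y. S y u a b) has_derivative frechet_derivative (\<lambda>y. S y u a b) (at x)) (at x)" for u a b
    using differentiable_S[OF x] by (simp add: frechet_derivative_works[symmetric])
  let ?d = "\<lambda>u a b. partial m (\<lambda>y. S y u a b) x"
  have "((\<lambda>y. split_curvature (S y) weyl_coeff i j k l) has_derivative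
      (\<lambda>z. \<Sum>u\<in>UNIV. \<Sum>v\<in>UNIV. weyl_coeff u v *
        ((S x u i k * frechet_derivative (\<lambda>y. S y v j l) (at x) z + frechet_derivative (\<lambda>y. S y u i k) (at x) z * S x v j l)
       - (S x u i l * frechet_derivative (\<lambda>y. S y v j k) (at x) z + frechet_derivative (\<lambda>y. S y u i l) (at x) z * S x v j k)))) (at x)"
    unfolding split_curvature_def
    by (intro has_derivative_sum has_derivative_mult_right has_derivative_diff has_derivative_mult S_der)
  from partial_eqI[OF this]
  have "partial m (\<lambda>y. weyl G y i j k l) x = (\<Sum>u\<in>UNIV. \<Sum>v\<in>UNIV. weyl_coeff u v *
        ((S x u i k * ?d v j l + ?d u i k * S x v j l) - (S x u i l * ?d v j k + ?d u i l * S x v j k)))"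
    using partial_cong[OF open_U x, of "\<lambda>y. weyl G y i j k l" "\<lambda>y. split_curvature (S y) weyl_coeff i j k l" m]
    by (simp add: weyl_eq partial_def)
  also have "\<dots> = (\<Sum>u\<in>UNIV. \<Sum>v\<in>UNIV. \<Sum>p\<in>UNIV.
        \<Gamma> x p m i * (weyl_coeff u v * (S x u p k * S x v j l - S x u p l * S x v j k))
      + \<Gamma> x p m j * (weyl_coeff u v * (S x u i k * S x v p l - S x u i l * S x v p k))
      + \<Gamma> x p m k * (weyl_coeff u v * (S x u i p * S x v j l - S x u i l * S x v j p))
      + \<Gamma> x p m l * (weyl_coeff u v * (S x u i k * S x v j p - S x u i p * S x v j k)))"
  proof (intro sum.cong refl)
    fix u v
    show "weyl_coeff u v *
        ((S x u i k * ?d v j l + ?d u i k * S x v j l) - (S x u i l * ?d v j k + ?d u i l * S x v j k))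
      = (\<Sum>p\<in>UNIV.
        \<Gamma> x p m i * (weyl_coeff u v * (S x u p k * S x v j l - S x u p l * S x v j k))
      + \<Gamma> x p m j * (weyl_coeff u v * (S x u i k * S x v p l - S x u i l * S x v p k))
      + \<Gamma> x p m k * (weyl_coeff u v * (S x u i p * S x v j l - S x u i l * S x v j p))
      + \<Gamma> x p m l * (weyl_coeff u v * (S x u i k * S x v j p - S x u i p * S x v j k)))"
      unfolding partial_S[OF x] sum_distrib_left sum_distrib_right sum.distrib[symmetric]
        sum_subtractf[symmetric]
      by (intro sum.cong refl) (simp add: algebra_simps)
  qed
  also have "\<dots> = (\<Sum>p\<in>UNIV. \<Gamma> x p m i * weyl G x p j k l + \<Gamma> x p m j * weyl G x i p k l
                 + \<Gamma> x p m k * weyl G x i j p l + \<Gamma> x p m l * weyl G x i j k p)"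
    unfolding weyl_eq[OF x] split_curvature_def
    by (simp only: sum.swap[of _ "UNIV :: 'n set" "UNIV :: 'u set"] sum_distrib_left sum.distrib)
  finally show ?thesis
    by (simp add: nabla4_def)
qed

lemma divergence_eq_0:
  assumes x: "x \<in> U" and "\<And>y i. y \<in> U \<Longrightarrow> v y i = 0"
  shows "divergence G v x = 0"
  using assms by (simp add: divergence_def nabla1_def partial_const_on[OF open_U x, of _ 0])

text \<open>
  The norm of the Weyl tensor is constant and the Weyl and Schouten tensors are parallel, so all terms of
  \<open>L\<^sub>1\<close> but the two that are algebraic in the Schouten and the Weyl tensor vanish.
\<close>

theorem L1_local_eq:
  assumes x: "x \<in> U"
  shows "L1_local G x =
    (\<Sum>u\<in>UNIV. (48 * schouten_coeff u - 8 * J) * curvature_square factor_dim weyl_coeff u * factor_dim u)"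
proof -
  let ?q = "curvature_square factor_dim weyl_coeff"
  have norm: "norm_sq4 (ginv G y) (weyl G y) = (\<Sum>u\<in>UNIV. ?q u * factor_dim u)" if "y \<in> U" for y
  proof -
    interpret orthogonal_splitting "ginv G y" "S y" factor_dim
      by (rule splitting[OF that])
    show ?thesis
      unfolding weyl_eq[OF that] by (rule norm_sq4_split_curvature)
  qed
  interpret orthogonal_splitting "ginv G x" "S x" factor_dim
    by (rule splitting[OF x])
  have "laplacian G (\<lambda>y. norm_sq4 (ginv G y) (weyl G y)) x = 0"
    unfolding laplacian_def
    by (rule divergence_eq_0[OF x], rule partial_const_on[OF open_U]) (auto intro: norm)
  moreover have "divergence G (\<lambda>y l. \<Sum>i\<in>UNIV. \<Sum>j\<in>UNIV. \<Sum>k\<in>UNIV.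
      weyl G y i j k l * raise3 (ginv G y) (cotton G y) i j k) x = 0"
    by (rule divergence_eq_0[OF x]) (simp add: raise3_def cotton_eq_0)
  moreover have "norm_sq5 (ginv G x) (nabla4 G (weyl G) x) = 0"
    by (simp add: norm_sq5_def weyl_parallel[OF x])
  moreover have "norm_sq3 (ginv G x) (cotton G x) = 0"
    by (simp add: norm_sq3_def cotton_eq_0[OF x])
  moreover have "(\<Sum>s\<in>UNIV. \<Sum>t\<in>UNIV. \<Sum>i\<in>UNIV. \<Sum>j\<in>UNIV. \<Sum>k\<in>UNIV.
      (\<Sum>a\<in>UNIV. ginv G x s a * schouten G x t a) * weyl G x s i j k * raise4 (ginv G x) (weyl G x) t i j k)
      = (\<Sum>u\<in>UNIV. schouten_coeff u * ?q u * factor_dim u)"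
    unfolding weyl_eq[OF x] schouten_eq[OF x] by (rule split_curvature_cubic)
  ultimately show ?thesis
    unfolding L1_local_def schouten_trace_eq[OF x] norm[OF x]
    by (simp add: sum_distrib_left sum_subtractf[symmetric] algebra_simps)
qed

end

section \<open>Weighted metrics and stereographic charts\<close>

context orthogonal_decomposition
begin

lemma smooth_on_weighted_metric:
  assumes "open U" "smooth_on U f" "smooth_on U h"
  shows "smooth_on U (\<lambda>x. weighted_metric w (\<psi> x) (f x) (h x))"
  unfolding weighted_metric_def
  by (intro smooth_on_sum smooth_on_bilinear[OF assms(1) bounded_bilinear_mult] smooth_on_inner
      smooth_on_linear[OF assms(1) bounded_linear_pr] smooth_on_const assms)

lemma smooth_on_components_weighted_metric:
  fixes \<psi> :: "real^'n \<Rightarrow> 'e"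
  assumes open_U: "open U" and smooth: "smooth_on U \<psi>"
  shows "smooth_on U (components \<psi> (weighted_metric w))"
proof -
  have expand: "(\<Sum>i\<in>UNIV. \<Sum>j\<in>UNIV. c i j *\<^sub>R axis i (axis j 1)) $ a $ b = c a b"
    for c :: "'n \<Rightarrow> 'n \<Rightarrow> real" and a b
  proof -
    have "(\<Sum>i\<in>UNIV. \<Sum>j\<in>UNIV. c i j *\<^sub>R axis i (axis j 1)) $ a $ b
        = (\<Sum>i\<in>UNIV. if i = a then (\<Sum>j\<in>UNIV. if j = b then c i j else 0) else 0)"
      unfolding sum_component by (intro sum.cong refl) (auto simp: axis_def mult_delta_right intro!: sum.cong)
    then show ?thesis
      by simp
  qed
  have "components \<psi> (weighted_metric w)
    = (\<lambda>x. \<Sum>i\<in>UNIV. \<Sum>j\<in>UNIV. pullback \<psi> (weighted_metric w) x (axis i 1) (axis j 1) *\<^sub>R axis i (axis j 1))"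
    by (simp add: fun_eq_iff vec_eq_iff expand components_def del: sum_component)
  then show ?thesis
    unfolding pullback_def
    by (simp only:) (intro smooth_on_sum smooth_on_scaleR smooth_on_weighted_metric
        smooth_on_frechet_derivative smooth_on_const open_U smooth)
qed

lemma smooth_symmetric_weighted_metric:
  "smooth_symmetric_tensor TYPE('n::finite) M (weighted_metric w)"
  unfolding smooth_symmetric_tensor_def
proof (intro allI impI conjI ballI)
  fix U and \<psi> :: "real^'n \<Rightarrow> 'e"
  assume "local_param M U \<psi>"
  then have open_U: "open U" and smooth: "smooth_on U \<psi>"
    by (simp_all add: local_param_def)
  show "smooth_on U (components \<psi> (weighted_metric w))"
    by (rule smooth_on_components_weighted_metric[OF open_U smooth])
  fix x assume x: "x \<in> U"
  have lin: "linear (frechet_derivative \<psi> (at x))"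
    using smooth_on_has_derivative[OF smooth x] by (rule has_derivative_linear)
  show "bilinear (pullback \<psi> (weighted_metric w) x)"
    unfolding bilinear_def pullback_def weighted_metric_def
    by (auto intro!: linearI simp: linear_add[OF lin] linear_cmul[OF lin] pr_simps inner_simps
        algebra_simps sum.distrib sum_distrib_left)
  show "pullback \<psi> (weighted_metric w) x u v = pullback \<psi> (weighted_metric w) x v u" for u v
    by (simp add: pullback_def weighted_metric_def inner_commute)
qed

lemma weighted_metric_pos:
  assumes "\<And>u. w u > 0" "v \<noteq> 0"
  shows "weighted_metric w p v v > 0"
proof -
  obtain u where "pr u v \<noteq> 0"
    using assms(2) by (metis sum_pr sum.neutral)
  then have "0 < w u * (pr u v \<bullet> pr u v)"
    using assms(1) by simp
  moreover have "0 \<le> w u * (pr u v \<bullet> pr u v)" for u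
    using assms(1)[of u] by simp
  ultimately show ?thesis
    unfolding weighted_metric_def by (intro sum_pos2[of UNIV u]) auto
qed

lemma compact_sphere_product: "compact sphere_product"
proof -
  have cont: "continuous_on UNIV (\<lambda>x. norm (pr u x))" for u
    by (intro continuous_on_norm bounded_linear.continuous_on[OF bounded_linear_pr] continuous_on_id)
  have "closed sphere_product"
    unfolding sphere_product_def
    by (intro closed_Collect_all closed_Collect_eq cont continuous_on_const)
  moreover have "norm x \<le> real CARD('u)" if "x \<in> sphere_product" for x
  proof -
    have "norm (\<Sum>u\<in>UNIV. pr u x) \<le> (\<Sum>u\<in>UNIV. norm (pr u x))"
      by (rule norm_sum)
    then show ?thesis
      using that by (simp add: sum_pr sphere_product_def)
  qed
  ultimately show ?thesis
    by (auto simp: compact_eq_bounded_closed bounded_iff)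
qed

text \<open>
  Linear coordinates on the product of the equatorial hyperplanes, which is the orthogonal complement of
  the normals \<open>pr u q\<close>.
\<close>

lemma stereographic_space:
  assumes q: "q \<in> sphere_product" and dims: "DIM('e) = CARD('n) + CARD('u)"
  obtains L :: "real^'n::finite \<Rightarrow> 'e" and K where "linear L" "linear K" "\<And>y. K (L y) = y"
    "\<And>y u. pr u (L y) \<bullet> q = 0" "\<And>z. (\<And>u. pr u z \<bullet> q = 0) \<Longrightarrow> L (K z) = z"
proof -
  define A where "A = range (\<lambda>u. pr u q)"
  define V where "V = {y. \<forall>x\<in>span A. orthogonal x y}"
  have norm_q: "pr u q \<bullet> pr u q = 1" for u
    using q by (simp add: sphere_product_def norm_eq_1)
  have V: "z \<in> V \<longleftrightarrow> (\<forall>u. pr u z \<bullet> q = 0)" for z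
  proof
    assume z: "\<forall>u. pr u z \<bullet> q = 0"
    have "orthogonal z x" if "x \<in> span A" for x
      using that by (rule orthogonal_to_span)
        (use z in \<open>auto simp: A_def orthogonal_def pr_adjoint[symmetric]\<close>)
    then show "z \<in> V"
      by (simp add: V_def orthogonal_commute)
  next
    assume "z \<in> V"
    then have "orthogonal (pr u q) z" for u
      by (auto simp: V_def A_def intro: span_base)
    then show "\<forall>u. pr u z \<bullet> q = 0"
      by (metis orthogonal_def pr_inner_commute)
  qed
  have inj: "inj (\<lambda>u. pr u q)"
  proof (rule injI)
    fix u v assume "pr u q = pr v q"
    then show "u = v"
      using norm_q[of u] pr_inner_pr[of u q v q] by (auto split: if_splits)
  qed
  have "independent A"
    using norm_q by (intro pairwise_orthogonal_independent)
      (auto simp: A_def pairwise_def orthogonal_def pr_inner_pr, metis inner_zero_left zero_neq_one)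
  then have "dim (span A) = CARD('u)"
    using inj by (simp add: dim_eq_card_independent A_def card_image)
  moreover have "dim V + dim (span A) = DIM('e)"
    using dim_subspace_orthogonal_to_vectors[of "span A" "UNIV :: 'e set"] by (simp add: V_def)
  ultimately have "dim V = CARD('n)"
    using dims by simp
  moreover have "subspace V"
    unfolding V_def by (rule subspace_orthogonal_to_vectors)
  moreover have "dim (UNIV :: (real^'n) set) = CARD('n)"
    by simp
  ultimately obtain L :: "real^'n \<Rightarrow> 'e" and K where LK: "linear L" "linear K" "range L = V"
    "\<And>y. y \<in> UNIV \<Longrightarrow> K (L y) = y" "\<And>z. z \<in> V \<Longrightarrow> L (K z) = z"
    using isometries_subspaces[of "UNIV :: (real^'n) set" V] subspace_UNIV by metis
  have "pr u (L y) \<bullet> q = 0" for y u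
    using V[of "L y"] LK(3) by blast
  moreover have "L (K z) = z" if "\<And>u. pr u z \<bullet> q = 0" for z
    using V[of z] LK(5)[of z] that by blast
  ultimately show ?thesis
    using LK(1,2,4) by (intro that[of L K]) auto
qed

text \<open>
  Stereographic projection in all factors at once. In the proof \<open>\<tau> u\<close> is the projection of the \<open>u\<close>-th
  sphere from the pole \<open>pr u q\<close> onto the equatorial hyperplane and \<open>\<sigma> u\<close> is its inverse, written with
  \<open>a u z = |pr u z|\<^sup>2\<close>. The derivative of the parametrization is injective because the chart \<open>\<phi>\<close> is a
  differentiable left inverse.
\<close>

theorem stereographic_chart:
  assumes p: "p \<in> sphere_product" and dims: "DIM('e) = CARD('n) + CARD('u)"
  obtains \<psi> :: "real^'n::finite \<Rightarrow> 'e" where "local_param sphere_product UNIV \<psi>" "p \<in> range \<psi>"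
proof -
  (* With the antipode of p as pole, the projection is defined at p. *)
  define q where "q = - p"
  have q: "q \<in> sphere_product"
    using p by (simp add: q_def sphere_product_def linear_neg[OF linear_pr])
  have qq: "pr u q \<bullet> q = 1" for u
    using q pr_inner_pr[of u q u q] by (simp add: sphere_product_def norm_eq_1)
  obtain L :: "real^'n \<Rightarrow> 'e" and K where L: "linear L" and K: "linear K"
    and KL: "\<And>y. K (L y) = y" and Lq: "\<And>y u. pr u (L y) \<bullet> q = 0"
    and LK: "\<And>z. (\<And>u. pr u z \<bullet> q = 0) \<Longrightarrow> L (K z) = z"
    by (rule stereographic_space[OF q dims]) blast
  define a where "a u z = pr u z \<bullet> z" for u z
  define \<sigma> where "\<sigma> u z = inverse (a u z + 1) *\<^sub>R (2 *\<^sub>R pr u z + (a u z - 1) *\<^sub>R pr u q)" for u z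
  define \<psi> where "\<psi> y = (\<Sum>u\<in>UNIV. \<sigma> u (L y))" for y
  define \<tau> where "\<tau> u x = inverse (1 - pr u x \<bullet> q) *\<^sub>R (pr u x - (pr u x \<bullet> q) *\<^sub>R pr u q)" for u x
  define \<phi> where "\<phi> x = K (\<Sum>u\<in>UNIV. \<tau> u x)" for x
  define V where "V = {x. \<forall>u. pr u x \<bullet> q \<noteq> 1}"
  have a_pos: "a u z + 1 > 0" for u z
    using pr_inner_pr[of u z u z] inner_ge_zero[of "pr u z"] by (simp add: a_def)
  have delta_pr: "pr u (\<Sum>v\<in>UNIV. \<rho> v) = \<rho> u" if "\<And>v. \<rho> v = pr v (\<rho> v)" for u \<rho>
  proof -
    have "pr u (\<rho> v) = (if u = v then \<rho> u else 0)" for v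
      using that pr_pr by metis
    then show ?thesis
      by (simp add: pr_simps)
  qed
  have pr_\<sigma>: "pr u (\<Sum>v\<in>UNIV. \<sigma> v z) = \<sigma> u z" for u z
    by (rule delta_pr) (simp add: \<sigma>_def pr_simps pr_pr)
  have pr_\<tau>: "pr u (\<Sum>v\<in>UNIV. \<tau> v x) = \<tau> u x" for u x
    by (rule delta_pr) (simp add: \<tau>_def pr_simps pr_pr)
  have \<sigma>_q: "\<sigma> u z \<bullet> q = (a u z - 1) / (a u z + 1)" if "pr u z \<bullet> q = 0" for u z
    using that by (simp add: \<sigma>_def inner_simps qq divide_inverse mult.commute)
  have \<psi>_sphere: "\<psi> y \<in> sphere_product" for y
  proof -
    have "\<sigma> u (L y) \<bullet> \<sigma> u (L y) = 1" for u
    proof -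
      have "pr u (L y) \<bullet> pr u q = 0" "pr u q \<bullet> pr u (L y) = 0"
        using Lq[of u y] pr_inner_commute[of u "L y" q] by (simp_all add: pr_inner_pr)
      then have "\<sigma> u (L y) \<bullet> \<sigma> u (L y)
          = inverse (a u (L y) + 1) * inverse (a u (L y) + 1) * (4 * a u (L y) + (a u (L y) - 1) * (a u (L y) - 1))"
        using qq[of u] by (simp add: \<sigma>_def inner_simps pr_inner_pr a_def[symmetric] distrib_left mult_ac)
      also have "\<dots> = inverse (a u (L y) + 1) * inverse (a u (L y) + 1) * ((a u (L y) + 1) * (a u (L y) + 1))"
        by (simp add: algebra_simps)
      also have "\<dots> = 1"
      proof -
        have "inverse c * inverse c * (c * c) = 1" if "c > 0" for c :: real
          using that by (simp add: field_simps)
        then show ?thesis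
          using a_pos by blast
      qed
      finally show ?thesis .
    qed
    then show ?thesis
      by (simp add: \<psi>_def sphere_product_def pr_\<sigma> norm_eq_1)
  qed
  have \<psi>_V: "\<psi> y \<in> V" for y
    using a_pos by (auto simp: V_def \<psi>_def pr_\<sigma> \<sigma>_q[OF Lq] divide_eq_1_iff)
  have \<phi>\<psi>: "\<phi> (\<psi> y) = y" for y
  proof -
    have "\<tau> u (\<psi> y) = pr u (L y)" for u
    proof -
      have pos: "a u (L y) + 1 \<noteq> 0"
        using a_pos[of u "L y"] by simp
      have t: "pr u (\<psi> y) \<bullet> q = (a u (L y) - 1) / (a u (L y) + 1)"
        by (simp add: \<psi>_def pr_\<sigma> \<sigma>_q[OF Lq])
      have inv: "inverse (1 - pr u (\<psi> y) \<bullet> q) = (a u (L y) + 1) / 2"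
        unfolding t using pos by (simp add: field_simps)
      have "\<tau> u (\<psi> y) = ((a u (L y) + 1) / 2) *\<^sub>R (\<sigma> u (L y) - ((a u (L y) - 1) / (a u (L y) + 1)) *\<^sub>R pr u q)"
        unfolding \<tau>_def inv unfolding t by (simp add: \<psi>_def pr_\<sigma>)
      also have "\<dots> = ((a u (L y) + 1) / 2) *\<^sub>R ((2 / (a u (L y) + 1)) *\<^sub>R pr u (L y))"
        by (simp only: \<sigma>_def scaleR_right_distrib scaleR_scaleR divide_inverse_commute add_diff_cancel_right')
      also have "\<dots> = pr u (L y)"
      proof -
        have "(a u (L y) + 1) / 2 * (2 / (a u (L y) + 1)) = 1"
          using pos by (simp only: times_divide_times_eq) simp
        then show ?thesis
          by (simp only: scaleR_scaleR scaleR_one)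
      qed
      finally show ?thesis .
    qed
    then show ?thesis
      by (simp add: \<phi>_def sum_pr KL)
  qed
  have \<psi>\<phi>: "\<psi> (\<phi> x) = x" if x: "x \<in> sphere_product" "x \<in> V" for x
  proof -
    let ?z = "\<Sum>u\<in>UNIV. \<tau> u x"
    have "pr u ?z \<bullet> q = 0" for u
      by (simp add: pr_\<tau>) (simp add: \<tau>_def inner_simps qq)
    then have Lz: "L (\<phi> x) = ?z"
      unfolding \<phi>_def by (rule LK)
    have "\<sigma> u ?z = pr u x" for u
    proof -
      define t where "t = pr u x \<bullet> q"
      have t: "1 - t \<noteq> 0"
        using x(2) by (auto simp: V_def t_def)
      have "pr u x \<bullet> pr u x = 1"
        using x(1) by (simp add: sphere_product_def norm_eq_1)
      moreover have "pr u x \<bullet> pr u q = t" "pr u q \<bullet> pr u x = t" "pr u q \<bullet> pr u q = 1"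
        using pr_inner_commute[of u x q] by (simp_all add: pr_inner_pr t_def qq)
      moreover have "a u ?z = \<tau> u x \<bullet> \<tau> u x"
        using pr_inner_pr[of u ?z u ?z] by (simp add: a_def pr_\<tau>)
      ultimately have "a u ?z = inverse (1 - t) * inverse (1 - t) * (1 - t * t)"
        by (simp add: \<tau>_def inner_simps t_def[symmetric] algebra_simps)
      also have "1 - t * t = (1 - t) * (1 + t)"
        by (simp add: algebra_simps)
      also have "inverse (1 - t) * inverse (1 - t) * ((1 - t) * (1 + t)) = (1 + t) / (1 - t)"
      proof -
        have "inverse c * inverse c * (c * e) = e / c" if "c \<noteq> 0" for c e :: real
          using that by (simp add: field_simps)
        then show ?thesis
          using t by blast
      qed
      finally have a: "a u ?z = (1 + t) / (1 - t)" .
      have "inverse (a u ?z + 1) = (1 - t) / 2" "a u ?z - 1 = 2 * t / (1 - t)"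
        unfolding a using t by (simp_all add: field_simps)
      then have "\<sigma> u ?z = ((1 - t) / 2) *\<^sub>R (2 *\<^sub>R \<tau> u x + (2 * t / (1 - t)) *\<^sub>R pr u q)"
        by (simp add: \<sigma>_def pr_\<tau>)
      also have "\<dots> = (1 - t) *\<^sub>R \<tau> u x + t *\<^sub>R pr u q"
        using t by (simp add: scaleR_add_right)
      also have "\<dots> = pr u x"
        using t by (simp add: \<tau>_def t_def[symmetric])
      finally show ?thesis .
    qed
    then show ?thesis
      by (simp add: \<psi>_def Lz sum_pr)
  qed
  have range: "range \<psi> = sphere_product \<inter> V"
    using \<psi>_sphere \<psi>_V \<psi>\<phi> by (auto intro: range_eqI[OF sym])
  have bL: "bounded_linear L" and bK: "bounded_linear K"
    using L K by (simp_all add: linear_conv_bounded_linear)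
  have smooth_L: "smooth_on UNIV L"
    using smooth_on_linear[OF open_UNIV bL smooth_on_ident[OF open_UNIV]] .
  have smooth_pr: "smooth_on UNIV (\<lambda>y. pr u (L y))" for u
    by (rule smooth_on_linear[OF open_UNIV bounded_linear_pr smooth_L])
  have smooth_a: "smooth_on UNIV (\<lambda>y. a u (L y))" for u
    unfolding a_def by (intro smooth_on_inner smooth_pr smooth_L open_UNIV)
  have smooth_a': "smooth_on UNIV (\<lambda>y. a u (L y) + c)" for u c
    by (intro smooth_on_add smooth_a smooth_on_const open_UNIV)
  have smooth: "smooth_on UNIV \<psi>"
    unfolding \<psi>_def[abs_def] \<sigma>_def
  proof (intro smooth_on_sum smooth_on_scaleR smooth_on_add smooth_on_inverse smooth_on_const
      smooth_pr smooth_a open_UNIV)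
    show "smooth_on UNIV (\<lambda>y. a u (L y) - 1)" for u
      using smooth_a'[of u "-1"] by simp
    show "a u (L y) + 1 \<noteq> 0" for u y
      using a_pos[of u "L y"] by simp
  qed
  have diff_\<phi>: "\<phi> differentiable (at x)" if "x \<in> V" for x
  proof -
    have pr_diff: "pr u differentiable (at x)" for u
      by (rule bounded_linear_imp_differentiable[OF bounded_linear_pr])
    have q_diff: "(\<lambda>x. pr u x \<bullet> q) differentiable (at x)" for u
      by (intro differentiable_inner pr_diff differentiable_const)
    have "(\<lambda>x. \<Sum>u\<in>UNIV. \<tau> u x) differentiable (at x)"
      unfolding \<tau>_def using that
      by (intro differentiable_sum finite ballI differentiable_scaleR differentiable_inverse
          differentiable_diff differentiable_const pr_diff q_diff) (auto simp: V_def)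
    then show ?thesis
      unfolding \<phi>_def[abs_def]
      by (rule differentiable_compose[OF bounded_linear_imp_differentiable[OF bK]])
  qed
  have "inj (frechet_derivative \<psi> (at y))" for y
  proof -
    have "(\<phi> has_derivative frechet_derivative \<phi> (at (\<psi> y))) (at (\<psi> y))"
      using diff_\<phi>[OF \<psi>_V] by (simp add: frechet_derivative_works[symmetric])
    from has_derivative_compose[OF smooth_on_has_derivative[OF smooth UNIV_I] this]
    have "((\<lambda>y. y) has_derivative (\<lambda>v. frechet_derivative \<phi> (at (\<psi> y)) (frechet_derivative \<psi> (at y) v))) (at y)"
      by (simp add: \<phi>\<psi>)
    from has_derivative_unique[OF has_derivative_ident this] show ?thesis
      by (metis injI)
  qed
  moreover have "openin (top_of_set sphere_product) (range \<psi>)"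
  proof -
    have "V = (\<Inter>u\<in>UNIV. {x. pr u x \<bullet> q \<noteq> 1})"
      by (auto simp: V_def)
    moreover have "open {x. pr u x \<bullet> q \<noteq> 1}" for u
      by (intro open_Collect_neq continuous_on_inner continuous_on_const
          bounded_linear.continuous_on[OF bounded_linear_pr] continuous_on_id)
    ultimately have "open V"
      by auto
    then show ?thesis
      unfolding range by (rule openin_open_Int)
  qed
  moreover have "homeomorphism UNIV (range \<psi>) \<psi> \<phi>"
  proof (rule homeomorphismI)
    show "continuous_on UNIV \<psi>"
      by (rule smooth_on_continuous_on[OF smooth])
    show "continuous_on (range \<psi>) \<phi>"
      by (intro continuous_at_imp_continuous_on ballI differentiable_imp_continuous_within diff_\<phi>)
        (auto simp: range)
  qed (auto simp: \<phi>\<psi>)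
  ultimately have "local_param sphere_product UNIV \<psi>"
    using smooth by (auto simp: local_param_def)
  moreover have "p \<in> range \<psi>"
  proof -
    have "pr u p \<bullet> q = - 1" for u
      using qq[of u] by (simp add: q_def linear_neg[OF linear_pr])
    then show ?thesis
      unfolding range using p by (simp add: V_def)
  qed
  ultimately show ?thesis
    by (rule that)
qed

lemma riemannian_weighted_metric:
  assumes dims: "DIM('e) = CARD('n) + CARD('u)" and w_pos: "\<And>u. w u > 0"
  shows "riemannian_metric TYPE('n::finite) sphere_product (weighted_metric w)"
  unfolding riemannian_metric_def closed_submanifold_def
proof (intro conjI allI impI ballI compact_sphere_product smooth_symmetric_weighted_metric)
  fix p assume "p \<in> sphere_product"
  then show "\<exists>U (\<psi> :: real^'n \<Rightarrow> 'e). local_param sphere_product U \<psi> \<and> p \<in> \<psi> ` U"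
    using dims stereographic_chart[of p] by metis
next
  fix U and \<psi> :: "real^'n \<Rightarrow> 'e" and x and v :: "real^'n"
  assume "local_param sphere_product U \<psi>" "x \<in> U" "v \<noteq> 0"
  then have "frechet_derivative \<psi> (at x) v \<noteq> 0"
    unfolding local_param_def using has_derivative_linear[OF smooth_on_has_derivative]
    by (metis linear_0 injD)
  then show "pullback \<psi> (weighted_metric w) x v v > 0"
    unfolding pullback_def by (rule weighted_metric_pos[OF w_pos])
qed

end

section \<open>Change of variables between Euclidean spaces\<close>

text \<open>
  A permutation contributes to the determinant of \<open>A\<close> only if it fixes every index outside the range of
  \<open>f\<close>, so the sum runs over the permutations of \<open>range f\<close>, that is, over those of \<open>'n\<close>.
\<close>

lemma det_extend_by_diagonal:
  fixes A :: "'a::comm_ring_1^'m^'m" and B :: "'a^'n^'n" and f :: "'n \<Rightarrow> 'm"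
  assumes inj: "inj f" and block: "\<And>i j. A $ f i $ f j = B $ i $ j"
    and diag: "\<And>k j. k \<notin> range f \<Longrightarrow> A $ k $ j = (if j = k then c k else 0)"
  shows "det A = det B * (\<Prod>k\<in>-range f. c k)"
proof -
  let ?P = "\<lambda>p. of_int (sign p) * (\<Prod>k\<in>UNIV. A $ k $ p k)"
  have vanish: "?P p = 0" if "p permutes UNIV" "\<not> p permutes range f" for p
  proof -
    have "\<exists>k. k \<notin> range f \<and> p k \<noteq> k"
      using that unfolding permutes_def by blast
    then obtain k where "k \<notin> range f" "p k \<noteq> k"
      by blast
    then have "A $ k $ p k = 0"
      by (simp add: diag)
    then show ?thesis
      by (metis (no_types, lifting) UNIV_I finite mult_zero_right prod_zero)
  qed
  have bij: "bij_betw f UNIV (range f)"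
    using inj by (simp add: bij_betw_def)
  have bij': "bij_betw (inv f) (range f) UNIV"
    using bij_betw_inv_into[OF bij] .
  have permutations: "bij_betw (map_permutation UNIV f) {q. q permutes UNIV} {p. p permutes range f}"
  proof (rule bij_betw_byWitness[where f' = "map_permutation (range f) (inv f)"])
    show "\<forall>q\<in>{q. q permutes UNIV}. map_permutation (range f) (inv f) (map_permutation UNIV f q) = q"
      using map_permutation_compose_inv[OF bij] inj by auto
    show "\<forall>p\<in>{p. p permutes range f}. map_permutation UNIV f (map_permutation (range f) (inv f) p) = p"
      using map_permutation_compose_inv[OF bij'] by (auto simp: f_inv_into_f)
    show "map_permutation UNIV f ` {q. q permutes UNIV} \<subseteq> {p. p permutes range f}"
      using map_permutation_permutes[OF bij] by auto
    show "map_permutation (range f) (inv f) ` {p. p permutes range f} \<subseteq> {q. q permutes UNIV}"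
      using map_permutation_permutes[OF bij'] by auto
  qed
  have "det A = (\<Sum>p | p permutes range f. ?P p)"
    unfolding det_def
    by (rule sum.mono_neutral_right) (auto intro: permutes_subset vanish)
  also have "\<dots> = (\<Sum>q | q permutes UNIV. ?P (map_permutation UNIV f q))"
    by (rule sum.reindex_bij_betw[OF permutations, symmetric])
  also have "\<dots> = (\<Sum>q | q permutes UNIV. of_int (sign q) * (\<Prod>i\<in>UNIV. B $ i $ q i) * (\<Prod>k\<in>-range f. c k))"
  proof (rule sum.cong[OF refl])
    fix q :: "'n \<Rightarrow> 'n" assume "q \<in> {q. q permutes UNIV}"
    then have q: "q permutes UNIV"
      by simp
    let ?p = "map_permutation UNIV f q"
    have "?p permutes range f"
      using map_permutation_permutes[OF bij q] .
    then have "(\<Prod>k\<in>-range f. A $ k $ ?p k) = (\<Prod>k\<in>-range f. c k)"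
      by (intro prod.cong refl) (simp add: diag permutes_not_in)
    moreover have "(\<Prod>k\<in>range f. A $ k $ ?p k) = (\<Prod>i\<in>UNIV. B $ i $ q i)"
      using inj by (simp add: prod.reindex map_permutation_apply block)
    moreover have "(\<Prod>k\<in>UNIV. A $ k $ ?p k) = (\<Prod>k\<in>range f. A $ k $ ?p k) * (\<Prod>k\<in>-range f. A $ k $ ?p k)"
      by (subst prod.union_disjoint[symmetric]) (auto simp: Compl_partition)
    ultimately show "?P ?p = of_int (sign q) * (\<Prod>i\<in>UNIV. B $ i $ q i) * (\<Prod>k\<in>-range f. c k)"
      using sign_map_permutation[OF inj q] by (simp add: mult.assoc)
  qed
  also have "\<dots> = det B * (\<Prod>k\<in>-range f. c k)"
    by (simp add: det_def sum_distrib_right)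
  finally show ?thesis .
qed

text \<open>
  Numbering a basis identifies a Euclidean space with a space \<open>real^'m\<close>. This carries the change of
  variables for maps of \<open>real^'m\<close> over to maps between two different Euclidean spaces.
\<close>

locale basis_enumeration =
  fixes \<beta> :: "'m::finite \<Rightarrow> 'a::euclidean_space"
  assumes bij: "bij_betw \<beta> UNIV Basis"
begin

definition combine :: "real^'m \<Rightarrow> 'a" where
  "combine y = (\<Sum>i\<in>UNIV. y $ i *\<^sub>R \<beta> i)"

definition coords :: "'a \<Rightarrow> real^'m" where
  "coords z = (\<chi> i. z \<bullet> \<beta> i)"

lemma in_Basis: "\<beta> i \<in> Basis"
  using bij by (auto simp: bij_betw_def)

lemma inner_enum: "\<beta> i \<bullet> \<beta> j = (if i = j then 1 else 0)"
  using bij by (auto simp: inner_Basis in_Basis bij_betw_def inj_on_def)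

lemma sum_Basis: "(\<Sum>b\<in>Basis. h b) = (\<Sum>i\<in>UNIV. h (\<beta> i))"
  by (rule sum.reindex_bij_betw[OF bij, symmetric])

lemma prod_Basis: "(\<Prod>b\<in>Basis. h b) = (\<Prod>i\<in>UNIV. h (\<beta> i))"
  by (rule prod.reindex_bij_betw[OF bij, symmetric])

lemma ball_Basis: "(\<forall>b\<in>Basis. P b) \<longleftrightarrow> (\<forall>i. P (\<beta> i))"
  using bij unfolding bij_betw_def by (metis UNIV_I imageE image_eqI)

lemma combine_inner_enum: "combine y \<bullet> \<beta> i = y $ i"
  by (simp add: combine_def inner_sum_left inner_enum mult_delta_right)

lemma coords_combine: "coords (combine y) = y"
  by (simp add: coords_def combine_inner_enum vec_eq_iff)

lemma combine_coords: "combine (coords z) = z"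
  using euclidean_representation[of z] by (simp add: combine_def coords_def sum_Basis)

lemma linear_combine: "linear combine"
  by (rule linearI) (simp_all add: combine_def scaleR_left_distrib sum.distrib scaleR_sum_right)

lemma linear_coords: "linear coords"
  by (rule linearI) (simp_all add: coords_def vec_eq_iff inner_simps)

lemma inner_eq_sum: "x \<bullet> y = (\<Sum>i\<in>UNIV. (x \<bullet> \<beta> i) * (y \<bullet> \<beta> i))"
  by (subst euclidean_inner) (rule sum_Basis)

lemma borel_measurable_combine [measurable]: "combine \<in> borel_measurable borel"
  using linear_combine
  by (intro borel_measurable_continuous_onI linear_continuous_on) (simp add: linear_conv_bounded_linear)

text \<open>
  A box corresponds to a box with the same side lengths.
\<close>

lemma lborel_distr_combine: "distr lborel borel combine = lborel"
proof (rule lborel_eqI[symmetric])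
  fix l u :: 'a assume le: "\<And>b. b \<in> Basis \<Longrightarrow> l \<bullet> b \<le> u \<bullet> b"
  have "combine -` box l u = box (coords l) (coords u)"
    by (auto simp: mem_box ball_Basis combine_inner_enum coords_def Basis_vec_def inner_axis)
  then have "emeasure (distr lborel borel combine) (box l u) = emeasure lborel (box (coords l) (coords u))"
    by (simp add: emeasure_distr)
  also have "\<dots> = (\<Prod>b\<in>Basis. (coords u - coords l) \<bullet> b)"
    by (rule emeasure_lborel_box) (auto simp: coords_def Basis_vec_def inner_axis le in_Basis)
  also have "(\<Prod>b\<in>Basis. (coords u - coords l) \<bullet> b) = (\<Prod>i\<in>UNIV. (coords u - coords l) $ i)"
  proof -
    have bij: "bij_betw (\<lambda>i. axis i 1) UNIV (Basis :: (real^'m) set)"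
      by (auto simp: bij_betw_def Basis_vec_def inj_on_def axis_eq_axis)
    show ?thesis
      unfolding prod.reindex_bij_betw[OF bij, symmetric] by (simp add: inner_axis)
  qed
  also have "\<dots> = (\<Prod>b\<in>Basis. (u - l) \<bullet> b)"
    by (simp add: prod_Basis coords_def inner_simps)
  finally show "emeasure (distr lborel borel combine) (box l u) = (\<Prod>b\<in>Basis. (u - l) \<bullet> b)" .
qed simp

end

lemma basis_enumeration_exists:
  assumes "CARD('m::finite) = DIM('a::euclidean_space)"
  obtains \<beta> :: "'m::finite \<Rightarrow> 'a::euclidean_space" where "basis_enumeration \<beta>"
  using finite_same_card_bij[of "UNIV :: 'm set" "Basis :: 'a set"] assms
  by (auto simp: basis_enumeration_def)

definition frame_matrix ::
    "('m::finite \<Rightarrow> 'a::euclidean_space) \<Rightarrow> ('m \<Rightarrow> 'b::euclidean_space) \<Rightarrow> ('a \<Rightarrow> 'b) \<Rightarrow> real^'m^'m" where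
  "frame_matrix \<beta> \<gamma> f = (\<chi> i j. f (\<beta> j) \<bullet> \<gamma> i)"

lemma det_gram:
  assumes "basis_enumeration \<gamma>"
  shows "det (\<chi> i j. f (\<beta> i) \<bullet> f (\<beta> j)) = (det (frame_matrix \<beta> \<gamma> f))\<^sup>2"
proof -
  interpret basis_enumeration \<gamma> by fact
  have "f (\<beta> i) \<bullet> f (\<beta> j) = (\<Sum>k\<in>UNIV. (f (\<beta> i) \<bullet> \<gamma> k) * (f (\<beta> j) \<bullet> \<gamma> k))" for i j
    by (rule inner_eq_sum)
  then have "(\<chi> i j. f (\<beta> i) \<bullet> f (\<beta> j)) = transpose (frame_matrix \<beta> \<gamma> f) ** frame_matrix \<beta> \<gamma> f"
    by (simp add: vec_eq_iff frame_matrix_def matrix_matrix_mult_def transpose_def)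
  then show ?thesis
    by (simp add: det_mul power2_eq_square)
qed

text \<open>
  The change of variables for the conjugate of \<open>\<Phi>\<close> by the two numberings, which preserve Lebesgue measure.
  The Jacobian \<open>jac\<close> is a separate function so that it can be given by a formula that is visibly measurable.
\<close>

theorem emeasure_lborel_image:
  fixes \<beta> :: "'m::{finite,wellorder} \<Rightarrow> 'a::euclidean_space" and \<gamma> :: "'m \<Rightarrow> 'b::euclidean_space"
    and \<Phi> :: "'a \<Rightarrow> 'b"
  assumes \<beta>: "basis_enumeration \<beta>" and \<gamma>: "basis_enumeration \<gamma>"
    and S: "S \<in> sets borel" and image: "\<Phi> ` S \<in> sets borel" "bounded (\<Phi> ` S)"
    and der: "\<And>x. x \<in> S \<Longrightarrow> (\<Phi> has_derivative \<Phi>' x) (at x)" and inj: "inj_on \<Phi> S"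
    and jac: "\<And>x. x \<in> S \<Longrightarrow> jac x = \<bar>det (frame_matrix \<beta> \<gamma> (\<Phi>' x))\<bar>"
    and jac_measurable: "(\<lambda>x. ennreal (jac x) * indicator S x) \<in> borel_measurable borel"
  shows "emeasure lborel (\<Phi> ` S) = (\<integral>\<^sup>+x\<in>S. ennreal (jac x) \<partial>lborel)"
proof -
  interpret \<beta>: basis_enumeration \<beta> by fact
  interpret \<gamma>: basis_enumeration \<gamma> by fact
  define g where "g = \<gamma>.coords \<circ> \<Phi> \<circ> \<beta>.combine"
  define T where "T = \<beta>.combine -` S"
  define g' where "g' y = (\<lambda>v. \<gamma>.coords (\<Phi>' (\<beta>.combine y) (\<beta>.combine v)))" for y
  have T: "T \<in> sets borel"
    unfolding T_def using measurable_sets_borel[OF \<beta>.borel_measurable_combine S] .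
  have bl: "bounded_linear \<gamma>.coords" "bounded_linear \<beta>.combine"
    using \<gamma>.linear_coords \<beta>.linear_combine by (simp_all add: linear_conv_bounded_linear)
  have g': "(g has_derivative g' y) (at y within T)" if "y \<in> T" for y
    unfolding g_def g'_def o_def
    by (rule has_derivative_at_withinI, rule bounded_linear.has_derivative[OF bl(1)
        has_derivative_compose[OF bounded_linear_imp_has_derivative[OF bl(2)] der]])
      (use that in \<open>simp add: T_def\<close>)
  have inj_g: "inj_on g T"
  proof (rule inj_onI)
    fix y z assume yz: "y \<in> T" "z \<in> T" "g y = g z"
    have "\<Phi> (\<beta>.combine y) = \<Phi> (\<beta>.combine z)"
      using arg_cong[OF yz(3), of \<gamma>.combine] by (simp add: g_def \<gamma>.combine_coords)
    then have "\<beta>.combine y = \<beta>.combine z"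
      using yz by (intro inj_onD[OF inj]) (auto simp: T_def)
    from arg_cong[OF this, of \<beta>.coords] show "y = z"
      by (simp add: \<beta>.coords_combine)
  qed
  have image_T: "\<beta>.combine ` T = S"
    unfolding T_def using \<beta>.combine_coords by (auto intro!: image_eqI[of _ _ "\<beta>.coords _"])
  have image_g: "g ` T = \<gamma>.combine -` (\<Phi> ` S)"
  proof -
    have "g ` T = \<gamma>.coords ` \<Phi> ` S"
      unfolding image_T[symmetric] by (auto simp: g_def image_comp)
    also have "\<dots> = \<gamma>.combine -` (\<Phi> ` S)"
    proof (intro equalityI subsetI)
      fix y assume "y \<in> \<gamma>.combine -` (\<Phi> ` S)"
      then show "y \<in> \<gamma>.coords ` \<Phi> ` S"
        by (intro image_eqI[of y \<gamma>.coords "\<gamma>.combine y"]) (simp_all add: \<gamma>.coords_combine)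
    qed (auto simp: \<gamma>.combine_coords)
    finally show ?thesis .
  qed
  have g_borel: "g ` T \<in> sets borel"
    unfolding image_g using measurable_sets_borel[OF \<gamma>.borel_measurable_combine image(1)] .
  have "bounded (g ` T)"
  proof -
    have "g ` T = \<gamma>.coords ` \<Phi> ` S"
      unfolding image_T[symmetric] by (auto simp: g_def image_comp)
    then show ?thesis
      using image(2) bl(1) by (simp add: bounded_linear_image)
  qed
  with g_borel have g_meas: "g ` T \<in> lmeasurable"
    by (intro bounded_set_imp_lmeasurable) auto
  then have "((\<lambda>y. \<bar>det (matrix (g' y))\<bar>) has_integral measure lebesgue (g ` T)) T"
    using has_measure_differentiable_image[OF _ g' inj_g] T by auto
  from nn_integral_has_integral_lebesgue'[OF _ this]
  have "(\<integral>\<^sup>+y\<in>T. ennreal \<bar>det (matrix (g' y))\<bar> \<partial>lborel) = ennreal (measure lebesgue (g ` T))"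
    by simp
  also have "\<dots> = emeasure lborel (g ` T)"
    using emeasure_eq_measure2[OF g_meas] g_borel by simp
  also have "\<dots> = emeasure (distr lborel borel \<gamma>.combine) (\<Phi> ` S)"
    using image(1) by (simp add: emeasure_distr image_g)
  also have "\<dots> = emeasure lborel (\<Phi> ` S)"
    by (simp only: \<gamma>.lborel_distr_combine)
  finally have "emeasure lborel (\<Phi> ` S) = (\<integral>\<^sup>+y\<in>T. ennreal \<bar>det (matrix (g' y))\<bar> \<partial>lborel)" ..
  also have "\<dots> = (\<integral>\<^sup>+y. ennreal (jac (\<beta>.combine y)) * indicator S (\<beta>.combine y) \<partial>lborel)"
  proof (rule nn_integral_cong)
    fix y
    have "matrix (g' y) = frame_matrix \<beta> \<gamma> (\<Phi>' (\<beta>.combine y))"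
      by (simp add: matrix_def frame_matrix_def g'_def \<gamma>.coords_def \<beta>.combine_def axis_def
          if_distrib[of "\<lambda>a. a *\<^sub>R _"] cong: if_cong)
    then show "ennreal \<bar>det (matrix (g' y))\<bar> * indicator T y
        = ennreal (jac (\<beta>.combine y)) * indicator S (\<beta>.combine y)"
      using jac[of "\<beta>.combine y"] by (simp add: T_def indicator_def)
  qed
  also have "\<dots> = (\<integral>\<^sup>+x. ennreal (jac x) * indicator S x \<partial>distr lborel borel \<beta>.combine)"
    using jac_measurable by (subst nn_integral_distr) auto
  finally show ?thesis
    by (simp only: \<beta>.lborel_distr_combine)
qed

section \<open>The volume of a product of two spheres\<close>

definition prod_pr :: "bool \<Rightarrow> 'a::euclidean_space \<times> 'b::euclidean_space \<Rightarrow> 'a \<times> 'b" where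
  "prod_pr u z = (if u then (fst z, 0) else (0, snd z))"

lemma orthogonal_decomposition_prod:
  "orthogonal_decomposition (prod_pr :: bool \<Rightarrow> 'a::euclidean_space \<times> 'b::euclidean_space \<Rightarrow> 'a \<times> 'b)"
proof (rule orthogonal_decomposition.intro)
  fix u v and x y :: "'a \<times> 'b"
  show "linear (prod_pr u :: 'a \<times> 'b \<Rightarrow> 'a \<times> 'b)"
    by (rule linearI) (simp_all add: prod_pr_def prod_eq_iff)
  show "prod_pr u x \<bullet> y = x \<bullet> prod_pr u y"
    by (cases u) (simp_all add: prod_pr_def inner_prod_def)
  show "prod_pr u (prod_pr v x) = (if u = v then prod_pr u x else 0)"
    by (cases u; cases v) (simp_all add: prod_pr_def zero_prod_def)
  show "(\<Sum>u\<in>UNIV. prod_pr u x) = x"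
    by (simp add: prod_pr_def UNIV_bool)
qed

interpretation factors: orthogonal_decomposition prod_pr
  by (rule orthogonal_decomposition_prod)

lemma sphere_product_eq:
  "factors.sphere_product = sphere (0 :: 'a::euclidean_space) 1 \<times> sphere (0 :: 'b::euclidean_space) 1"
proof -
  have "norm (a, 0 :: 'b) = norm a" "norm (0 :: 'a, b) = norm b" for a :: 'a and b :: 'b
    by (simp_all add: norm_prod_def)
  then show ?thesis
    by (auto simp: factors.sphere_product_def prod_pr_def all_bool_eq)
qed

lemma weighted_metric_eq:
  "factors.weighted_metric w p x y = w True * (fst x \<bullet> fst y) + w False * (snd x \<bullet> snd y)"
  by (simp add: factors.weighted_metric_def prod_pr_def UNIV_bool inner_prod_def)

definition weights :: "real \<Rightarrow> real \<Rightarrow> bool \<Rightarrow> real" where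
  "weights a b u = (if u then a else b)"

text \<open>
  For \<open>p = q = 1\<close> this is the derivative of the cone map \<open>(x, s, t) \<mapsto> (s \<psi>\<^sub>1(x), t \<psi>\<^sub>2(x))\<close> at \<open>(x, a, b)\<close>.
  For \<open>p = a\<close> and \<open>q = b\<close> it is the derivative at \<open>(x, 1, 1)\<close>, followed by the dilation
  \<open>(y, z) \<mapsto> (a y, b z)\<close>.
\<close>

definition cone_frame ::
    "(real^'n \<Rightarrow> 'a::euclidean_space \<times> 'b::euclidean_space) \<Rightarrow> real^'n \<Rightarrow> real \<Rightarrow> real \<Rightarrow> real \<Rightarrow> real \<Rightarrow>
     (real^'n) \<times> real \<times> real \<Rightarrow> 'a \<times> 'b" where
  "cone_frame \<psi> x a b p q = (\<lambda>(v, \<sigma>, \<tau>).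
     (a *\<^sub>R fst (frechet_derivative \<psi> (at x) v) + (p * \<sigma>) *\<^sub>R fst (\<psi> x),
      b *\<^sub>R snd (frechet_derivative \<psi> (at x) v) + (q * \<tau>) *\<^sub>R snd (\<psi> x)))"

text \<open>
  The square is the Gram determinant. The radial directions are orthogonal to the tangent vectors and to
  each other, so the Gram matrix consists of the metric with weights \<open>a\<^sup>2\<close> and \<open>b\<^sup>2\<close> and the diagonal
  entries \<open>p\<^sup>2\<close> and \<open>q\<^sup>2\<close>.
\<close>

lemma det_cone_frame:
  fixes \<psi> :: "real^'n \<Rightarrow> 'a::euclidean_space \<times> 'b::euclidean_space"
    and \<beta> :: "'m::finite \<Rightarrow> (real^'n) \<times> real \<times> real"
  assumes param: "local_param factors.sphere_product U \<psi>" and x: "x \<in> U"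
    and dims: "DIM('a) + DIM('b) = CARD('n) + 2"
    and \<beta>: "basis_enumeration \<beta>" and \<gamma>: "basis_enumeration \<gamma>"
  shows "(det (frame_matrix \<beta> \<gamma> (cone_frame \<psi> x a b p q)))\<^sup>2
    = det (components \<psi> (factors.weighted_metric (weights (a\<^sup>2) (b\<^sup>2))) x) * (p\<^sup>2 * q\<^sup>2)"
proof -
  interpret \<beta>: basis_enumeration \<beta> by fact
  interpret chart: sphere_product_chart prod_pr U \<psi> "\<lambda>_. 1"
    using param dims by unfold_locales auto
  let ?F = "cone_frame \<psi> x a b p q"
  have lin: "linear (frechet_derivative \<psi> (at x))"
    using smooth_on_has_derivative[OF chart.smooth x] by (rule has_derivative_linear)
  have unit: "fst (\<psi> x) \<bullet> fst (\<psi> x) = 1" "snd (\<psi> x) \<bullet> snd (\<psi> x) = 1"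
    using chart.unit_factors[OF x, of True] chart.unit_factors[OF x, of False]
    by (simp_all add: prod_pr_def inner_prod_def)
  have tangent: "fst (chart.D i x) \<bullet> fst (\<psi> x) = 0" "snd (chart.D i x) \<bullet> snd (\<psi> x) = 0"
    "fst (\<psi> x) \<bullet> fst (chart.D i x) = 0" "snd (\<psi> x) \<bullet> snd (chart.D i x) = 0" for i
    using chart.tangent_normal[OF x, of True i] chart.tangent_normal[OF x, of False i]
    by (simp_all add: prod_pr_def inner_prod_def inner_commute)
  have F_axis: "?F (axis i 1, 0, 0) = (a *\<^sub>R fst (chart.D i x), b *\<^sub>R snd (chart.D i x))" for i
    by (simp add: cone_frame_def chart.D_def)
  have F_normal: "?F (0, 1, 0) = (p *\<^sub>R fst (\<psi> x), 0)" "?F (0, 0, 1) = (0, q *\<^sub>R snd (\<psi> x))"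
    by (simp_all add: cone_frame_def linear_0[OF lin])
  have Basis: "(Basis :: ((real^'n) \<times> real \<times> real) set) = range (\<lambda>i. (axis i 1, 0, 0)) \<union> {(0, 1, 0), (0, 0, 1)}"
    by (auto simp: Basis_prod_def Basis_vec_def zero_prod_def)
  define f where "f i = inv \<beta> (axis i 1, 0, 0)" for i
  have \<beta>_inv: "\<beta> (inv \<beta> z) = z" if "z \<in> Basis" for z
    using that \<beta>.bij by (auto simp: bij_betw_def f_inv_into_f)
  have \<beta>_f: "\<beta> (f i) = (axis i 1, 0, 0)" for i
    unfolding f_def by (rule \<beta>_inv) (simp add: Basis)
  have inj: "inj f"
  proof (rule injI)
    fix i j assume "f i = f j"
    then have "\<beta> (f i) = \<beta> (f j)"
      by simp
    then show "i = j"
      by (simp add: \<beta>_f axis_eq_axis)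
  qed
  have \<beta>_inj: "\<beta> i = \<beta> j \<longleftrightarrow> i = j" for i j
    using \<beta>.bij by (auto simp: bij_betw_def inj_on_def)
  (* The two indices that number the radial directions. *)
  define k1 k2 where "k1 = inv \<beta> (0, 1, 0)" and "k2 = inv \<beta> (0, 0, 1)"
  have k: "\<beta> k1 = (0, 1, 0)" "\<beta> k2 = (0, 0, 1)"
    unfolding k1_def k2_def by (auto intro!: \<beta>_inv simp: Basis)
  have k12: "k1 \<noteq> k2"
    using k by auto
  have cases: "(\<exists>i. j = f i) \<or> j = k1 \<or> j = k2" for j
  proof -
    have "\<beta> j \<in> Basis"
      by (rule \<beta>.in_Basis)
    then have "(\<exists>i. \<beta> j = \<beta> (f i)) \<or> \<beta> j = \<beta> k1 \<or> \<beta> j = \<beta> k2"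
      unfolding \<beta>_f k Basis by auto
    then show ?thesis
      by (simp add: \<beta>_inj)
  qed
  have not_f: "k1 \<noteq> f i" "k2 \<noteq> f i" for i
    using k \<beta>_f by (auto simp: \<beta>_inj[symmetric] axis_def vec_eq_iff)
  have compl: "- range f = {k1, k2}"
  proof (intro equalityI subsetI)
    fix j assume "j \<in> - range f"
    with cases[of j] show "j \<in> {k1, k2}"
      by auto
  qed (use not_f in auto)
  define c where "c k = (if k = k1 then p\<^sup>2 else q\<^sup>2)" for k
  let ?A = "\<chi> i j. ?F (\<beta> i) \<bullet> ?F (\<beta> j)"
  have "det ?A = det (components \<psi> (factors.weighted_metric (weights (a\<^sup>2) (b\<^sup>2))) x) * (\<Prod>k\<in>-range f. c k)"
  proof (rule det_extend_by_diagonal[OF inj])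
    fix i j
    show "?A $ f i $ f j = components \<psi> (factors.weighted_metric (weights (a\<^sup>2) (b\<^sup>2))) x $ i $ j"
      by (simp add: \<beta>_f F_axis components_def pullback_def weighted_metric_eq weights_def
          chart.D_def inner_prod_def power2_eq_square)
  next
    fix k j assume "k \<notin> range f"
    then have "k = k1 \<or> k = k2"
      using compl by auto
    then show "?A $ k $ j = (if j = k then c k else 0)"
      using cases[of j] k12 not_f
      by (auto simp: k F_normal \<beta>_f F_axis inner_prod_def tangent unit c_def power2_eq_square)
  qed
  also have "(\<Prod>k\<in>-range f. c k) = p\<^sup>2 * q\<^sup>2"
    using k12 by (simp add: compl c_def)
  finally show ?thesis
    using det_gram[OF \<gamma>, of ?F \<beta>] by simp
qed

text \<open>
  The dilation multiplies the rows that belong to the first factor by \<open>a\<close> and the others by \<open>b\<close>.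
\<close>

lemma det_cone_frame_scale:
  fixes \<gamma> :: "'m::finite \<Rightarrow> 'a::euclidean_space \<times> 'b::euclidean_space"
  assumes \<gamma>: "basis_enumeration \<gamma>"
  shows "det (frame_matrix \<beta> \<gamma> (cone_frame \<psi> x a b a b))
    = a ^ DIM('a) * b ^ DIM('b) * det (frame_matrix \<beta> \<gamma> (cone_frame \<psi> x 1 1 1 1))"
proof -
  interpret \<gamma>: basis_enumeration \<gamma> by fact
  define c where "c z = (if snd z = 0 then a else b)" for z :: "'a \<times> 'b"
  have row: "cone_frame \<psi> x a b a b y \<bullet> z = c z * (cone_frame \<psi> x 1 1 1 1 y \<bullet> z)"
    if "z \<in> Basis" for y z
    using that by (auto simp: Basis_prod_def c_def cone_frame_def inner_prod_def inner_simps
        split: prod.split) (simp_all add: algebra_simps)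
  have "frame_matrix \<beta> \<gamma> (cone_frame \<psi> x a b a b)
      = (\<chi> i. c (\<gamma> i) *s (frame_matrix \<beta> \<gamma> (cone_frame \<psi> x 1 1 1 1) $ i))"
    by (simp add: vec_eq_iff frame_matrix_def row[OF \<gamma>.in_Basis])
  then have "det (frame_matrix \<beta> \<gamma> (cone_frame \<psi> x a b a b))
      = (\<Prod>i\<in>UNIV. c (\<gamma> i)) * det (frame_matrix \<beta> \<gamma> (cone_frame \<psi> x 1 1 1 1))"
    using det_rows_mul[of "\<lambda>i. c (\<gamma> i)" "\<lambda>i. frame_matrix \<beta> \<gamma> (cone_frame \<psi> x 1 1 1 1) $ i"]
    by simp
  also have "(\<Prod>i\<in>UNIV. c (\<gamma> i)) = (\<Prod>z\<in>Basis. c z)"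
    by (rule \<gamma>.prod_Basis[symmetric])
  also have "\<dots> = (\<Prod>z\<in>(\<lambda>u. (u, 0)) ` Basis. c z) * (\<Prod>z\<in>(\<lambda>v. (0, v)) ` Basis. c z)"
    unfolding Basis_prod_def by (rule prod.union_disjoint) auto
  also have "(\<Prod>z\<in>(\<lambda>u. (u, 0)) ` Basis. c z) = a ^ DIM('a)"
    by (simp add: prod.reindex inj_on_def c_def)
  also have "(\<Prod>z\<in>(\<lambda>v. (0, v)) ` Basis. c z) = (\<Prod>v\<in>(Basis :: 'b set). b)"
  proof -
    have "(\<Prod>z\<in>(\<lambda>v. (0, v)) ` Basis. c z) = (\<Prod>v\<in>Basis. c (0, v))"
      by (simp add: prod.reindex inj_on_def)
    also have "\<dots> = (\<Prod>v\<in>(Basis :: 'b set). b)"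
      by (intro prod.cong refl) (auto simp: c_def)
    finally show ?thesis .
  qed
  finally show ?thesis
    by simp
qed

definition unit_density :: "(real^'n \<Rightarrow> 'a::euclidean_space \<times> 'b::euclidean_space) \<Rightarrow> real^'n \<Rightarrow> real" where
  "unit_density \<psi> x = sqrt (det (components \<psi> (factors.weighted_metric (weights 1 1)) x))"

text \<open>
  How the volume density depends on the two radii, in a parametrization that need not respect the product
  structure. The determinant of \<open>cone_frame \<psi> x a b a b\<close> is computed in two ways: as a Gram
  determinant and by its behaviour under dilations.
\<close>

lemma sqrt_det_weighted:
  fixes \<psi> :: "real^'n \<Rightarrow> 'a::euclidean_space \<times> 'b::euclidean_space"
    and \<beta> :: "'m::finite \<Rightarrow> (real^'n) \<times> real \<times> real" and \<gamma> :: "'m \<Rightarrow> 'a \<times> 'b"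
  assumes param: "local_param factors.sphere_product U \<psi>" and x: "x \<in> U"
    and dims: "DIM('a) + DIM('b) = CARD('n) + 2"
    and \<beta>: "basis_enumeration \<beta>" and \<gamma>: "basis_enumeration \<gamma>" and pos: "a > 0" "b > 0"
  shows "sqrt (det (components \<psi> (factors.weighted_metric (weights (a\<^sup>2) (b\<^sup>2))) x))
    = a ^ (DIM('a) - 1) * b ^ (DIM('b) - 1) * unit_density \<psi> x"
proof -
  let ?d = "\<lambda>a b. det (components \<psi> (factors.weighted_metric (weights a b)) x)"
  note det = det_cone_frame[OF param x dims \<beta> \<gamma>]
  have power: "a ^ DIM('a) = a ^ (DIM('a) - 1) * a" "b ^ DIM('b) = b ^ (DIM('b) - 1) * b"
    by (simp_all only: power_minus_mult DIM_positive)
  have "?d (a\<^sup>2) (b\<^sup>2) * (a\<^sup>2 * b\<^sup>2) = (a ^ DIM('a) * b ^ DIM('b))\<^sup>2 * ?d 1 1"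
    using det[of a b a b] det[of 1 1 1 1]
    unfolding det_cone_frame_scale[OF \<gamma>, of \<beta> \<psi> x a b] by (simp add: power_mult_distrib)
  also have "\<dots> = (a ^ (DIM('a) - 1) * b ^ (DIM('b) - 1))\<^sup>2 * ?d 1 1 * (a\<^sup>2 * b\<^sup>2)"
    unfolding power by (simp only: power_mult_distrib mult_ac)
  finally have "?d (a\<^sup>2) (b\<^sup>2) = (a ^ (DIM('a) - 1) * b ^ (DIM('b) - 1))\<^sup>2 * ?d 1 1"
    using pos by simp
  then show ?thesis
    using pos by (simp add: real_sqrt_mult unit_density_def)
qed

lemma nn_integral_lborel_times:
  fixes F :: "'a::euclidean_space \<Rightarrow> ennreal" and H :: "'b::euclidean_space \<Rightarrow> ennreal"
  assumes [measurable]: "F \<in> borel_measurable borel" "H \<in> borel_measurable borel"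
  shows "(\<integral>\<^sup>+z. F (fst z) * H (snd z) \<partial>lborel) = (\<integral>\<^sup>+x. F x \<partial>lborel) * (\<integral>\<^sup>+y. H y \<partial>lborel)"
proof -
  have "(\<integral>\<^sup>+z. F (fst z) * H (snd z) \<partial>lborel) = (\<integral>\<^sup>+z. F (fst z) * H (snd z) \<partial>(lborel \<Otimes>\<^sub>M lborel))"
    by (simp only: lborel_prod)
  also have "\<dots> = (\<integral>\<^sup>+x. \<integral>\<^sup>+y. F x * H y \<partial>lborel \<partial>lborel)"
    by (subst lborel.nn_integral_fst[symmetric]) simp_all
  also have "\<dots> = (\<integral>\<^sup>+x. F x \<partial>lborel) * (\<integral>\<^sup>+y. H y \<partial>lborel)"
    by (simp add: nn_integral_cmult nn_integral_multc)
  finally show ?thesis .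
qed

lemma nn_integral_power_unit_interval:
  "(\<integral>\<^sup>+s. ennreal (s ^ k) * indicator {0<..1} s \<partial>lborel) = ennreal (1 / real (Suc k))"
proof -
  have "(\<integral>\<^sup>+s. ennreal (s ^ k) * indicator {0<..1} s \<partial>lborel)
      = (\<integral>\<^sup>+s. ennreal (s ^ k) * indicator {0..1} s \<partial>lborel)"
    by (rule nn_integral_cong_AE)
      (use AE_lborel_singleton[of "0::real"] in eventually_elim, auto simp: indicator_def)
  also have "\<dots> = ennreal (1 ^ Suc k / real (Suc k) - 0 ^ Suc k / real (Suc k))"
  proof (rule nn_integral_FTC_Icc)
    show "((\<lambda>s. s ^ Suc k / real (Suc k)) has_real_derivative s ^ k) (at s)" for s
      using DERIV_cdivide[OF DERIV_pow[of "Suc k" s], of "real (Suc k)"] by (simp del: of_nat_Suc)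
  qed auto
  finally show ?thesis
    by simp
qed

definition radial :: "'a::euclidean_space \<times> 'b::euclidean_space \<Rightarrow> 'a \<times> 'b" where
  "radial z = (fst z /\<^sub>R norm (fst z), snd z /\<^sub>R norm (snd z))"

definition punctured_balls :: "('a::euclidean_space \<times> 'b::euclidean_space) set" where
  "punctured_balls = (cball 0 1 - {0}) \<times> (cball 0 1 - {0})"

definition cone_factor :: "('a::euclidean_space \<times> 'b::euclidean_space) itself \<Rightarrow> real \<Rightarrow> real \<Rightarrow> real" where
  "cone_factor _ a b = a ^ (DIM('a) - 1) * b ^ (DIM('b) - 1) * real DIM('a) * real DIM('b)"

text \<open>
  The Riemannian measure for spheres of radii \<open>a\<close> and \<open>b\<close>, up to the normalization the Lebesgue measure of
  the cone over a set. The powers of \<open>a\<close> and \<open>b\<close> in \<open>cone_factor\<close> come from the radii, and the dimensions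
  compensate the integrals \<open>\<integral> s ^ (d - 1) ds = 1 / d\<close> over the unit interval.
\<close>

definition cone_measure :: "real \<Rightarrow> real \<Rightarrow> ('a::euclidean_space \<times> 'b::euclidean_space) measure" where
  "cone_measure a b = scale_measure (ennreal (cone_factor TYPE('a \<times> 'b) a b))
     (distr (restrict_space lborel punctured_balls) (restrict_space borel factors.sphere_product) radial)"

lemma punctured_balls_borel [measurable]: "punctured_balls \<in> sets borel"
  unfolding punctured_balls_def by (intro borel_Times) auto

lemma radial_in_sphere_product: "z \<in> punctured_balls \<Longrightarrow> radial z \<in> factors.sphere_product"
  by (auto simp: punctured_balls_def radial_def sphere_product_eq)

lemma radial_borel_measurable [measurable]: "radial \<in> borel_measurable borel"
  unfolding radial_def[abs_def] borel_prod[symmetric] by measurable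

lemma radial_measurable:
  "radial \<in> measurable (restrict_space lborel punctured_balls) (restrict_space borel factors.sphere_product)"
  by (rule measurable_restrict_space2)
    (auto simp: space_restrict_space radial_in_sphere_product intro!: measurable_restrict_space1)

lemma sphere_product_borel: "factors.sphere_product \<in> sets borel"
  using factors.compact_sphere_product by (rule borel_compact)

lemma emeasure_cone_measure:
  assumes "A \<in> sets borel" "A \<subseteq> factors.sphere_product"
  shows "emeasure (cone_measure a b) A = ennreal (cone_factor TYPE('a::euclidean_space \<times> 'b::euclidean_space) a b)
    * emeasure lborel {z \<in> punctured_balls. radial z \<in> (A :: ('a \<times> 'b) set)}"
proof -
  have A: "A \<in> sets (restrict_space borel factors.sphere_product)"
    using assms by (simp add: sets_restrict_space_iff sphere_product_borel)
  have "{z \<in> punctured_balls. radial z \<in> A} = radial -` A \<inter> punctured_balls"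
    by auto
  then show ?thesis
    unfolding cone_measure_def
    by (simp add: emeasure_distr[OF radial_measurable A] space_restrict_space emeasure_restrict_space)
qed

lemma emeasure_cone_measure_total:
  "emeasure (cone_measure a b) (factors.sphere_product :: ('a::euclidean_space \<times> 'b::euclidean_space) set)
    = ennreal (cone_factor TYPE('a \<times> 'b) a b * (unit_ball_vol DIM('a) * unit_ball_vol DIM('b)))"
proof -
  have ball: "emeasure lborel (cball 0 1 - {0 :: 'c::euclidean_space}) = ennreal (unit_ball_vol DIM('c))"
  proof -
    have "emeasure lborel (cball 0 1 - {0 :: 'c}) = emeasure lborel (cball (0 :: 'c) 1)"
      by (rule emeasure_Diff_null_set) auto
    then show ?thesis
      by (simp add: emeasure_cball)
  qed
  have "{z \<in> punctured_balls. radial z \<in> factors.sphere_product} = (punctured_balls :: ('a \<times> 'b) set)"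
    using radial_in_sphere_product by auto
  moreover have "emeasure lborel (punctured_balls :: ('a \<times> 'b) set)
      = ennreal (unit_ball_vol DIM('a)) * ennreal (unit_ball_vol DIM('b))"
    unfolding punctured_balls_def lborel_prod[symmetric]
    by (subst lborel.emeasure_pair_measure_Times) (auto simp: ball)
  ultimately show ?thesis
    by (simp add: emeasure_cone_measure[OF sphere_product_borel] ennreal_mult'')
qed

lemma continuous_unit_density:
  assumes "open U" "smooth_on U \<psi>"
  shows "continuous_on U (unit_density \<psi>)"
proof -
  have "continuous_on U (\<lambda>x. components \<psi> (factors.weighted_metric (weights 1 1)) x $ i $ j)" for i j
    by (intro continuous_on_component smooth_on_continuous_on
        factors.smooth_on_components_weighted_metric assms)
  then show ?thesis
    unfolding unit_density_def[abs_def] det_def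
    by (intro continuous_on_real_sqrt continuous_on_sum continuous_on_mult continuous_on_const continuous_on_prod)
qed

lemma chart_preimage_borel:
  assumes param: "local_param M U \<psi>" and A: "A \<in> sets borel"
  shows "{x\<in>U. \<psi> x \<in> A} \<in> sets borel"
proof -
  have open_U: "open U" and smooth: "smooth_on U \<psi>"
    using param by (simp_all add: local_param_def)
  have "\<psi> \<in> borel_measurable (restrict_space borel U)"
      using smooth_on_continuous_on[OF smooth] by (rule borel_measurable_continuous_on_restrict)
  from measurable_sets[OF this A] have "\<psi> -` A \<inter> U \<in> sets (restrict_space borel U)"
      by (simp add: space_restrict_space)
  then have "\<psi> -` A \<inter> U \<in> sets borel"
      using open_U by (simp add: sets_restrict_space_iff)
  moreover have "{x\<in>U. \<psi> x \<in> A} = \<psi> -` A \<inter> U"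
      by auto
  ultimately show ?thesis
    by simp
qed

lemma unit_density_measurable:
  assumes param: "local_param M U \<psi>" and A: "A \<in> sets borel"
  shows "(\<lambda>x. ennreal (unit_density \<psi> x) * indicator {x\<in>U. \<psi> x \<in> A} x) \<in> borel_measurable borel"
proof -
  define B where "B = {x\<in>U. \<psi> x \<in> A}"
  have B: "B \<in> sets borel"
    unfolding B_def by (rule chart_preimage_borel[OF assms])
  have open_U: "open U" and smooth: "smooth_on U \<psi>"
    using param by (simp_all add: local_param_def)
  have "(\<lambda>x. indicator B x *\<^sub>R unit_density \<psi> x) \<in> borel_measurable borel"
    using continuous_on_subset[OF continuous_unit_density[OF open_U smooth], of B] B
    by (intro borel_measurable_continuous_on_indicator) (auto simp: B_def)
  then have "(\<lambda>x. ennreal (indicator B x *\<^sub>R unit_density \<psi> x)) \<in> borel_measurable borel"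
    by measurable
  moreover have "ennreal (unit_density \<psi> x) * indicator B x = ennreal (indicator B x *\<^sub>R unit_density \<psi> x)" for x
    by (simp add: indicator_def)
  ultimately show ?thesis
    unfolding B_def by (simp cong: measurable_cong)
qed

lemma nn_integral_unit_cone:
  fixes V :: "'c::euclidean_space \<Rightarrow> ennreal"
  assumes [measurable]: "V \<in> borel_measurable borel"
  shows "(\<integral>\<^sup>+z. V (fst z) * (ennreal (fst (snd z) ^ k) * indicator {0<..1} (fst (snd z))
      * (ennreal (snd (snd z) ^ l) * indicator {0<..1} (snd (snd z)))) \<partial>lborel)
    = (\<integral>\<^sup>+x. V x \<partial>lborel) * ennreal (1 / (real (Suc k) * real (Suc l)))"
proof -
  let ?f = "\<lambda>k (s::real). ennreal (s ^ k) * indicator {0<..1} s :: ennreal"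
  have [measurable]: "?f k \<in> borel_measurable borel" for k
    by measurable
  have "(\<integral>\<^sup>+z. V (fst z) * (?f k (fst (snd z)) * ?f l (snd (snd z))) \<partial>lborel)
    = (\<integral>\<^sup>+x. V x \<partial>lborel) * (\<integral>\<^sup>+y. ?f k (fst y) * ?f l (snd y) \<partial>(lborel :: (real \<times> real) measure))"
  proof (rule nn_integral_lborel_times)
    show "(\<lambda>y. ?f k (fst y) * ?f l (snd y)) \<in> borel_measurable (borel :: (real \<times> real) measure)"
      unfolding borel_prod[symmetric] by measurable
  qed measurable
  also have "(\<integral>\<^sup>+y. ?f k (fst y) * ?f l (snd y) \<partial>(lborel :: (real \<times> real) measure))
    = ennreal (1 / real (Suc k)) * ennreal (1 / real (Suc l))"
    by (subst nn_integral_lborel_times) (simp_all only: nn_integral_power_unit_interval, measurable)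
  also have "\<dots> = ennreal (1 / (real (Suc k) * real (Suc l)))"
    by (subst ennreal_mult[symmetric]) (simp_all del: of_nat_Suc)
  finally show ?thesis .
qed

text \<open>
  Integration in polar coordinates: the cone over \<open>A\<close> is the image of a product set under the cone map
  \<open>\<Phi>\<close>, whose Jacobian is the product of \<open>unit_density\<close> and powers of the two radial variables.
\<close>

lemma emeasure_cone:
  fixes \<psi> :: "real^'n \<Rightarrow> 'a::euclidean_space \<times> 'b::euclidean_space"
    and \<beta> :: "'m::{finite,wellorder} \<Rightarrow> (real^'n) \<times> real \<times> real" and \<gamma> :: "'m \<Rightarrow> 'a \<times> 'b"
  assumes param: "local_param factors.sphere_product U \<psi>"
    and dims: "DIM('a) + DIM('b) = CARD('n) + 2"
    and \<beta>: "basis_enumeration \<beta>" and \<gamma>: "basis_enumeration \<gamma>"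
    and A: "A \<in> sets borel" "A \<subseteq> \<psi> ` U"
  shows "emeasure lborel {z \<in> punctured_balls. radial z \<in> A}
    = (\<integral>\<^sup>+x\<in>{x\<in>U. \<psi> x \<in> A}. ennreal (unit_density \<psi> x) \<partial>lborel) * ennreal (1 / (real DIM('a) * real DIM('b)))"
proof -
  have open_U: "open U" and smooth: "smooth_on U \<psi>" and image: "\<psi> ` U \<subseteq> factors.sphere_product"
    using param openin_imp_subset unfolding local_param_def by blast+
  obtain \<phi> where hom: "homeomorphism U (\<psi> ` U) \<psi> \<phi>"
    using param unfolding local_param_def by blast
  then have inj_\<psi>: "inj_on \<psi> U"
    by (metis homeomorphism_def inj_on_inverseI)
  define B where "B = {x\<in>U. \<psi> x \<in> A}"
  have B: "B \<in> sets borel"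
    unfolding B_def by (rule chart_preimage_borel[OF param A(1)])
  define V where "V x = ennreal (unit_density \<psi> x) * indicator B x" for x
  have V: "V \<in> borel_measurable borel"
    unfolding V_def[abs_def] B_def by (rule unit_density_measurable[OF param A(1)])
  define S where "S = B \<times> {0<..1::real} \<times> {0<..1::real}"
  define \<Phi> where "\<Phi> y = (fst (snd y) *\<^sub>R fst (\<psi> (fst y)), snd (snd y) *\<^sub>R snd (\<psi> (fst y)))"
    for y :: "(real^'n) \<times> real \<times> real"
  define \<Phi>' where "\<Phi>' y = cone_frame \<psi> (fst y) (fst (snd y)) (snd (snd y)) 1 1" for y
  define jac where "jac y = unit_density \<psi> (fst y) * (fst (snd y) ^ (DIM('a) - 1) * snd (snd y) ^ (DIM('b) - 1))"
    for y :: "(real^'n) \<times> real \<times> real"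
  have S_B: "fst y \<in> U" "\<psi> (fst y) \<in> A" "0 < fst (snd y)" "0 < snd (snd y)" "fst (snd y) \<le> 1" "snd (snd y) \<le> 1"
    if "y \<in> S" for y
    using that by (auto simp: S_def B_def)
  have unit: "norm (fst (\<psi> x)) = 1" "norm (snd (\<psi> x)) = 1" if "x \<in> U" for x
    using image that by (auto simp: sphere_product_eq image_subset_iff mem_Times_iff)
  have image_S: "\<Phi> ` S = {z \<in> punctured_balls. radial z \<in> A}"
  proof (intro equalityI subsetI)
    fix z assume "z \<in> \<Phi> ` S"
    then obtain y where y: "y \<in> S" "z = \<Phi> y"
      by blast
    have "radial z = \<psi> (fst y)"
      using S_B[OF y(1)] unit[OF S_B(1)[OF y(1)]] by (simp add: y(2) \<Phi>_def radial_def)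
    moreover have "z \<in> punctured_balls"
      using S_B[OF y(1)] unit[OF S_B(1)[OF y(1)]] by (auto simp: y(2) \<Phi>_def punctured_balls_def)
    ultimately show "z \<in> {z \<in> punctured_balls. radial z \<in> A}"
      using S_B[OF y(1)] by simp
  next
    fix z :: "'a \<times> 'b" assume z: "z \<in> {z \<in> punctured_balls. radial z \<in> A}"
    then obtain x where x: "x \<in> U" "radial z = \<psi> x"
      using A(2) by auto
    have pos: "0 < norm (fst z)" "norm (fst z) \<le> 1" "0 < norm (snd z)" "norm (snd z) \<le> 1"
      using z by (auto simp: punctured_balls_def)
    have "\<Phi> (x, norm (fst z), norm (snd z)) = z"
      using pos by (simp add: \<Phi>_def x(2)[symmetric] radial_def)
    moreover have "(x, norm (fst z), norm (snd z)) \<in> S"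
      using pos x z by (auto simp: S_def B_def)
    ultimately show "z \<in> \<Phi> ` S"
      by (metis image_eqI)
  qed
  have S: "S \<in> sets borel"
    unfolding S_def using B by (intro borel_Times) auto
  have cone_borel: "{z \<in> punctured_balls. radial z \<in> A} \<in> sets borel"
  proof -
    have "radial -` A \<inter> punctured_balls \<in> sets borel"
      using measurable_sets_borel[OF radial_borel_measurable A(1)] by (intro sets.Int punctured_balls_borel)
    moreover have "{z \<in> punctured_balls. radial z \<in> A} = radial -` A \<inter> punctured_balls"
      by auto
    ultimately show ?thesis
      by simp
  qed
  have integrand: "ennreal (jac y) * indicator S y
      = V (fst y) * (ennreal (fst (snd y) ^ (DIM('a) - 1)) * indicator {0<..1} (fst (snd y))
        * (ennreal (snd (snd y) ^ (DIM('b) - 1)) * indicator {0<..1} (snd (snd y))))" for y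
  proof (cases "y \<in> S")
    case True
    then show ?thesis
      using S_B[OF True] by (simp add: V_def B_def jac_def ennreal_mult'')
  next
    case False
    then show ?thesis
      by (auto simp: S_def V_def mem_Times_iff)
  qed
  have "emeasure lborel (\<Phi> ` S) = (\<integral>\<^sup>+y\<in>S. ennreal (jac y) \<partial>lborel)"
  proof (rule emeasure_lborel_image[OF \<beta> \<gamma> S])
    show "\<Phi> ` S \<in> sets borel"
      unfolding image_S by (rule cone_borel)
    have "bounded (punctured_balls :: ('a \<times> 'b) set)"
      unfolding punctured_balls_def by (intro bounded_Times bounded_diff bounded_cball)
    then show "bounded (\<Phi> ` S)"
      unfolding image_S by (rule bounded_subset) auto
    show "inj_on \<Phi> S"
    proof (rule inj_onI)
      fix y y' assume y: "y \<in> S" "y' \<in> S" "\<Phi> y = \<Phi> y'"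
      have norms: "norm (fst (\<Phi> y)) = fst (snd y)" "norm (snd (\<Phi> y)) = snd (snd y)" if "y \<in> S" for y
        using S_B[OF that] unit[OF S_B(1)[OF that]] by (simp_all add: \<Phi>_def)
      then have eq: "snd y = snd y'"
        using y by (metis prod_eq_iff)
      then have "\<psi> (fst y) = \<psi> (fst y')"
        using y(3) S_B[OF y(1)] by (simp add: \<Phi>_def prod_eq_iff)
      then show "y = y'"
        using eq inj_\<psi> S_B(1)[OF y(1)] S_B(1)[OF y(2)] by (simp add: inj_on_def prod_eq_iff)
    qed
  next
    fix y assume y: "y \<in> S"
    note x = S_B(1)[OF y]
    have "(\<psi> has_derivative frechet_derivative \<psi> (at (fst y))) (at (fst y))"
      by (rule smooth_on_has_derivative[OF smooth x])
    from has_derivative_compose[OF has_derivative_fst[OF has_derivative_ident] this]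
    have \<psi>: "((\<lambda>y. \<psi> (fst y)) has_derivative (\<lambda>v. frechet_derivative \<psi> (at (fst y)) (fst v))) (at y)" .
    have "(\<Phi> has_derivative (\<lambda>v.
        (fst (snd y) *\<^sub>R fst (frechet_derivative \<psi> (at (fst y)) (fst v)) + fst (snd v) *\<^sub>R fst (\<psi> (fst y)),
         snd (snd y) *\<^sub>R snd (frechet_derivative \<psi> (at (fst y)) (fst v)) + snd (snd v) *\<^sub>R snd (\<psi> (fst y))))) (at y)"
      unfolding \<Phi>_def[abs_def]
      by (intro has_derivative_Pair has_derivative_scaleR has_derivative_fst has_derivative_snd has_derivative_ident \<psi>)
    moreover have "(\<lambda>v.
        (fst (snd y) *\<^sub>R fst (frechet_derivative \<psi> (at (fst y)) (fst v)) + fst (snd v) *\<^sub>R fst (\<psi> (fst y)),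
         snd (snd y) *\<^sub>R snd (frechet_derivative \<psi> (at (fst y)) (fst v)) + snd (snd v) *\<^sub>R snd (\<psi> (fst y)))) = \<Phi>' y"
      by (auto simp: fun_eq_iff \<Phi>'_def cone_frame_def)
    ultimately show "(\<Phi> has_derivative \<Phi>' y) (at y)"
      by simp
    have "(det (frame_matrix \<beta> \<gamma> (\<Phi>' y)))\<^sup>2
        = det (components \<psi> (factors.weighted_metric (weights ((fst (snd y))\<^sup>2) ((snd (snd y))\<^sup>2))) (fst y))"
      unfolding \<Phi>'_def by (subst det_cone_frame[OF param x dims \<beta> \<gamma>]) simp
    then have "\<bar>det (frame_matrix \<beta> \<gamma> (\<Phi>' y))\<bar>
        = sqrt (det (components \<psi> (factors.weighted_metric (weights ((fst (snd y))\<^sup>2) ((snd (snd y))\<^sup>2))) (fst y)))"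
      by (metis real_sqrt_abs)
    then show "jac y = \<bar>det (frame_matrix \<beta> \<gamma> (\<Phi>' y))\<bar>"
      unfolding sqrt_det_weighted[OF param x dims \<beta> \<gamma> S_B(3,4)[OF y]] by (simp add: jac_def)
  next
    show "(\<lambda>y. ennreal (jac y) * indicator S y) \<in> borel_measurable borel"
      unfolding integrand borel_prod[symmetric] using V by measurable
  qed
  also have "\<dots> = (\<integral>\<^sup>+x. V x \<partial>lborel) * ennreal (1 / (real (Suc (DIM('a) - 1)) * real (Suc (DIM('b) - 1))))"
    unfolding integrand by (rule nn_integral_unit_cone[OF V])
  finally show ?thesis
    unfolding image_S V_def B_def by simp
qed

lemma emeasure_eq_on_finite_Union:
  assumes sets: "sets M = sets N" and "finite \<V>" "\<V> \<subseteq> sets M"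
    and eq: "\<And>V A. V \<in> \<V> \<Longrightarrow> A \<in> sets M \<Longrightarrow> A \<subseteq> V \<Longrightarrow> emeasure M A = emeasure N A"
    and A: "A \<in> sets M" "A \<subseteq> \<Union>\<V>"
  shows "emeasure M A = emeasure N A"
  using assms(2-)
proof (induction \<V> arbitrary: A rule: finite_induct)
  case empty
  then show ?case
    by simp
next
  case (insert V \<V>)
  have sets_A: "A \<inter> V \<in> sets M" "A - V \<in> sets M"
    using insert.prems by auto
  have "emeasure M (A - V) = emeasure N (A - V)"
    by (rule insert.IH) (use insert.prems sets_A in auto)
  moreover have "emeasure M (A \<inter> V) = emeasure N (A \<inter> V)"
    using insert.prems(2)[of V "A \<inter> V"] sets_A by auto
  moreover have "(A \<inter> V) \<union> (A - V) = A"
    by auto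
  ultimately show ?case
    using plus_emeasure[OF sets_A] plus_emeasure[of "A \<inter> V" N "A - V"] sets_A sets by auto
qed

text \<open>
  The measure is determined on subsets of the images of parametrizations, and finitely many of these cover
  the compact manifold.
\<close>

theorem riemannian_measure_eqI:
  fixes M :: "'a::euclidean_space set"
  assumes M: "closed_submanifold TYPE('n::finite) M"
    and sets: "sets \<mu> = sets (restrict_space borel M)"
    and charts: "\<And>U (\<psi> :: real^'n \<Rightarrow> 'a) A. local_param M U \<psi> \<Longrightarrow> A \<in> sets borel \<Longrightarrow> A \<subseteq> \<psi> ` U \<Longrightarrow>
      emeasure \<mu> A = (\<integral>\<^sup>+x\<in>{x\<in>U. \<psi> x \<in> A}. ennreal (sqrt (det (components \<psi> g x))) \<partial>lborel)"
  shows "riemannian_measure TYPE('n) M g = \<mu>"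
  unfolding riemannian_measure_def
proof (rule the_equality)
  fix \<nu> :: "'a measure"
  assume \<nu>: "sets \<nu> = sets (restrict_space borel M) \<and>
        (\<forall>U (\<psi> :: real^'n \<Rightarrow> 'a). local_param M U \<psi> \<longrightarrow>
           (\<forall>A\<in>sets borel. A \<subseteq> \<psi> ` U \<longrightarrow>
              emeasure \<nu> A =
                (\<integral>\<^sup>+x\<in>{x\<in>U. \<psi> x \<in> A}. ennreal (sqrt (det (components \<psi> g x))) \<partial>lborel)))"
  have compact: "compact M"
    using M by (simp add: closed_submanifold_def)
  then have M_borel: "M \<in> sets borel"
    by (rule borel_compact)
  define C where "C = {\<psi> ` U | U (\<psi> :: real^'n \<Rightarrow> 'a). local_param M U \<psi>}"
  have "\<forall>V\<in>C. openin (top_of_set M) V" "M \<subseteq> \<Union>C"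
    using M unfolding C_def closed_submanifold_def local_param_def by blast+
  then obtain \<V> where \<V>: "\<V> \<subseteq> C" "finite \<V>" "M \<subseteq> \<Union>\<V>"
    using compact unfolding compact_eq_openin_cover by meson
  have "\<V> \<subseteq> sets \<nu>"
  proof
    fix V assume "V \<in> \<V>"
    then have "openin (top_of_set M) V"
      using \<V>(1) unfolding C_def local_param_def by blast
    then obtain T where "open T" "V = M \<inter> T"
      unfolding openin_open by blast
    then show "V \<in> sets \<nu>"
      using \<nu> M_borel by (simp add: sets_restrict_space_iff)
  qed
  show "\<nu> = \<mu>"
  proof (rule measure_eqI)
    show "sets \<nu> = sets \<mu>"
      using \<nu> sets by simp
    fix A assume A: "A \<in> sets \<nu>"
    show "emeasure \<nu> A = emeasure \<mu> A"
    proof (rule emeasure_eq_on_finite_Union[OF \<open>sets \<nu> = sets \<mu>\<close> \<V>(2) \<open>\<V> \<subseteq> sets \<nu>\<close> _ A])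
      show "A \<subseteq> \<Union>\<V>"
        using A \<nu> \<V>(3) M_borel by (auto simp: sets_restrict_space_iff)
      fix V B assume "V \<in> \<V>" "B \<in> sets \<nu>" "B \<subseteq> V"
      then obtain U and \<psi> :: "real^'n \<Rightarrow> 'a" where "local_param M U \<psi>" "B \<subseteq> \<psi> ` U"
        using \<V>(1) unfolding C_def by blast
      moreover have "B \<in> sets borel"
        using \<open>B \<in> sets \<nu>\<close> \<nu> M_borel by (simp add: sets_restrict_space_iff)
      ultimately show "emeasure \<nu> B = emeasure \<mu> B"
        using \<nu> charts[of U \<psi> B] by simp
    qed
  qed
qed (use sets charts in blast)

text \<open>
  The type \<open>'m\<close> numbers bases of the ambient space and of the domain of the cone map.
\<close>

theorem riemannian_measure_sphere_product:
  assumes dims: "DIM('a::euclidean_space) + DIM('b::euclidean_space) = CARD('n::finite) + 2"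
    and index: "CARD('m::{finite,wellorder}) = DIM('a) + DIM('b)" and pos: "a > 0" "b > 0"
  shows "riemannian_measure TYPE('n) (factors.sphere_product :: ('a \<times> 'b) set)
      (factors.weighted_metric (weights (a\<^sup>2) (b\<^sup>2))) = cone_measure a b"
proof (rule riemannian_measure_eqI)
  have "riemannian_metric TYPE('n) factors.sphere_product
      (factors.weighted_metric (\<lambda>_. 1) :: ('a \<times> 'b) two_tensor)"
    by (rule factors.riemannian_weighted_metric) (use dims in auto)
  then show "closed_submanifold TYPE('n) (factors.sphere_product :: ('a \<times> 'b) set)"
    by (simp add: riemannian_metric_def)
  show "sets (cone_measure a b) = sets (restrict_space borel (factors.sphere_product :: ('a \<times> 'b) set))"
    by (simp add: cone_measure_def)
  fix U and \<psi> :: "real^'n \<Rightarrow> 'a \<times> 'b" and A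
  assume param: "local_param factors.sphere_product U \<psi>" and A: "A \<in> sets borel" "A \<subseteq> \<psi> ` U"
  obtain \<beta> :: "'m \<Rightarrow> (real^'n) \<times> real \<times> real" where \<beta>: "basis_enumeration \<beta>"
    using basis_enumeration_exists[where 'm = 'm and 'a = "(real^'n) \<times> real \<times> real"] dims index by auto
  obtain \<gamma> :: "'m \<Rightarrow> 'a \<times> 'b" where \<gamma>: "basis_enumeration \<gamma>"
    using basis_enumeration_exists[where 'm = 'm and 'a = "'a \<times> 'b"] index by auto
  let ?c = "a ^ (DIM('a) - 1) * b ^ (DIM('b) - 1)"
  let ?V = "\<lambda>x. ennreal (unit_density \<psi> x) * indicator {x\<in>U. \<psi> x \<in> A} x"
  have "A \<subseteq> factors.sphere_product"
    using A(2) param openin_imp_subset unfolding local_param_def by blast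
  then have "emeasure (cone_measure a b) A
      = ennreal (cone_factor TYPE('a \<times> 'b) a b) * ((\<integral>\<^sup>+x. ?V x \<partial>lborel) * ennreal (1 / (real DIM('a) * real DIM('b))))"
    by (simp only: emeasure_cone_measure[OF A(1)] emeasure_cone[OF param dims \<beta> \<gamma> A])
  also have "\<dots> = ennreal (cone_factor TYPE('a \<times> 'b) a b * (1 / (real DIM('a) * real DIM('b)))) * (\<integral>\<^sup>+x. ?V x \<partial>lborel)"
    by (subst ennreal_mult'') (simp_all add: mult_ac)
  also have "cone_factor TYPE('a \<times> 'b) a b * (1 / (real DIM('a) * real DIM('b))) = ?c"
    by (simp add: cone_factor_def)
  also have "ennreal ?c * (\<integral>\<^sup>+x. ?V x \<partial>lborel) = (\<integral>\<^sup>+x. ennreal ?c * ?V x \<partial>lborel)"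
    by (rule nn_integral_cmult[symmetric]) (simp add: unit_density_measurable[OF param A(1)])
  also have "\<dots> = (\<integral>\<^sup>+x\<in>{x\<in>U. \<psi> x \<in> A}.
      ennreal (sqrt (det (components \<psi> (factors.weighted_metric (weights (a\<^sup>2) (b\<^sup>2))) x))) \<partial>lborel)"
  proof (rule nn_integral_cong)
    fix x
    show "ennreal ?c * ?V x = ennreal (sqrt (det (components \<psi> (factors.weighted_metric (weights (a\<^sup>2) (b\<^sup>2))) x)))
        * indicator {x\<in>U. \<psi> x \<in> A} x"
    proof (cases "x \<in> U")
      case True
      show ?thesis
        unfolding sqrt_det_weighted[OF param True dims \<beta> \<gamma> pos]
        using pos by (simp add: ennreal_mult' mult.assoc)
    qed simp
  qed
  finally show "emeasure (cone_measure a b) A = (\<integral>\<^sup>+x\<in>{x\<in>U. \<psi> x \<in> A}.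
      ennreal (sqrt (det (components \<psi> (factors.weighted_metric (weights (a\<^sup>2) (b\<^sup>2))) x))) \<partial>lborel)" .
qed

section \<open>Round spheres and the value of the functional\<close>

lemma orthogonal_decomposition_trivial: "orthogonal_decomposition (\<lambda>(_ :: unit) x. x :: 'a::euclidean_space)"
proof (rule orthogonal_decomposition.intro)
  show "linear (\<lambda>x :: 'a. x)"
    by (rule linearI) simp_all
qed (simp_all add: UNIV_unit)

lemma constant_sectional_curvature_round:
  assumes "DIM('a::euclidean_space) = CARD('n::finite) + 1" "\<mu> > 0"
  shows "constant_sectional_curvature TYPE('n) (sphere (0 :: 'a) 1) (round_metric \<mu>) \<mu>"
proof -
  interpret whole: orthogonal_decomposition "\<lambda>(_ :: unit) x. x :: 'a"
    by (rule orthogonal_decomposition_trivial)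
  have sphere: "sphere 0 1 = whole.sphere_product"
    by (auto simp: whole.sphere_product_def)
  have metric: "round_metric \<mu> = (whole.weighted_metric (\<lambda>_. 1 / \<mu>) :: 'a two_tensor)"
    by (simp add: fun_eq_iff round_metric_def whole.weighted_metric_def UNIV_unit)
  have "riemannian_metric TYPE('n) (sphere 0 1) (round_metric \<mu> :: 'a two_tensor)"
    unfolding sphere metric by (rule whole.riemannian_weighted_metric) (use assms in auto)
  moreover have "riemann (components \<psi> (round_metric \<mu>)) x i j k l
      = \<mu> * (components \<psi> (round_metric \<mu>) x $ i $ k * components \<psi> (round_metric \<mu>) x $ j $ l
           - components \<psi> (round_metric \<mu>) x $ i $ l * components \<psi> (round_metric \<mu>) x $ j $ k)"
    if "local_param (sphere 0 1) U \<psi>" "x \<in> U" for U and \<psi> :: "real^'n \<Rightarrow> 'a" and x i j k l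
  proof -
    interpret chart: sphere_product_chart "\<lambda>(_ :: unit) x. x :: 'a" U \<psi> "\<lambda>_. 1 / \<mu>"
      by unfold_locales (use that assms in \<open>auto simp: sphere\<close>)
    have "chart.G x $ i $ j = chart.S x () i j" for i j
      by (simp add: chart.G_eq_sum_S UNIV_unit)
    then show ?thesis
      using chart.riemann_eq[OF that(2), of i j k l] by (simp add: metric chart.G_def UNIV_unit)
  qed
  ultimately show ?thesis
    by (simp add: constant_sectional_curvature_def Let_def)
qed

lemma factor_dim_prod:
  "orthogonal_decomposition.factor_dim
      (prod_pr :: bool \<Rightarrow> 'a::euclidean_space \<times> 'b::euclidean_space \<Rightarrow> 'a \<times> 'b) u
    = (if u then real DIM('a) else real DIM('b)) - 1"
proof -
  have "(\<Sum>z\<in>Basis. prod_pr u z \<bullet> (z :: 'a \<times> 'b))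
      = (\<Sum>z\<in>(\<lambda>u. (u, 0)) ` Basis. prod_pr u z \<bullet> (z :: 'a \<times> 'b)) + (\<Sum>z\<in>(\<lambda>v. (0, v)) ` Basis. prod_pr u z \<bullet> (z :: 'a \<times> 'b))"
    unfolding Basis_prod_def by (rule sum.union_disjoint) auto
  then show ?thesis
    by (simp add: factors.factor_dim_def sum.reindex inj_on_def prod_pr_def inner_prod_def)
qed

lemma unit_ball_vol_5: "unit_ball_vol 5 = 8 / 15 * pi ^ 2"
  by (simp add: eval_unit_ball_vol)

abbreviation S2xS4 :: "((real^3) \<times> (real^5)) set" where
  "S2xS4 \<equiv> sphere 0 1 \<times> sphere 0 1"

abbreviation g_plus :: "real \<Rightarrow> ((real^3) \<times> (real^5)) two_tensor" where
  "g_plus c \<equiv> factors.weighted_metric (weights (1/3) c)"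

lemma product_metric_eq: "product_metric (round_metric 3) (scale_metric c (round_metric 1)) = g_plus c"
  by (simp add: fun_eq_iff product_metric_def round_metric_def scale_metric_def weighted_metric_eq weights_def)

lemma product_metric_eq_1: "product_metric (round_metric 3) (round_metric 1) = g_plus 1"
  using product_metric_eq[of 1] by (simp add: scale_metric_def)

lemma riemannian_g_plus: "c > 0 \<Longrightarrow> riemannian_metric TYPE(6) S2xS4 (g_plus c)"
  unfolding sphere_product_eq[symmetric]
  by (rule factors.riemannian_weighted_metric) (auto simp: weights_def)

lemma chart_S2xS4:
  fixes \<psi> :: "real^6 \<Rightarrow> (real^3) \<times> (real^5)"
  assumes "local_param S2xS4 U \<psi>" "c > 0"
  shows "sphere_product_chart prod_pr U \<psi> (weights (1/3) c)"
  by unfold_locales (use assms in \<open>auto simp: weights_def sphere_product_eq\<close>)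

text \<open>
  With \<open>k = 1/c\<close> the factors have the curvatures \<open>3\<close> and \<open>k\<close> and the dimensions \<open>2\<close> and \<open>4\<close>. A product of
  two space forms with opposite curvatures is conformally flat, which explains why the Weyl tensor is a
  multiple of \<open>3 + k\<close>.
\<close>

lemma L1_local_S2xS4:
  fixes \<psi> :: "real^6 \<Rightarrow> (real^3) \<times> (real^5)"
  assumes "local_param S2xS4 U \<psi>" "x \<in> U" "c > 0"
  shows "L1_local (components \<psi> (g_plus c)) x = 36 * (3 + inverse c)\<^sup>2 * (1 - inverse c)"
proof -
  interpret chart: sphere_product_chart prod_pr U \<psi> "weights (1/3) c"
    by (rule chart_S2xS4) fact+
  let ?dim = "orthogonal_decomposition.factor_dim (prod_pr :: bool \<Rightarrow> (real^3) \<times> (real^5) \<Rightarrow> (real^3) \<times> (real^5))"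
  define k where "k = inverse c"
  have curv: "1 / weights (1/3) c u = (if u then 3 else k)" for u
    by (simp add: weights_def k_def inverse_eq_divide)
  have J: "chart.J = (6 + 12 * k) / 10"
    unfolding chart.J_def curv by (simp add: UNIV_bool factor_dim_prod)
  have coeff: "chart.schouten_coeff True = (3 - chart.J) / 4" "chart.schouten_coeff False = (3 * k - chart.J) / 4"
    unfolding chart.schouten_coeff_def curv by (simp_all add: factor_dim_prod)
  have weyl: "chart.weyl_coeff True True = 3 * (3 + k) / 5" "chart.weyl_coeff False False = (3 + k) / 10"
    "chart.weyl_coeff True False = - 3 * (3 + k) / 20" "chart.weyl_coeff False True = - 3 * (3 + k) / 20"
    unfolding chart.weyl_coeff_def curv coeff J by (simp_all add: field_simps)
  have square: "curvature_square ?dim chart.weyl_coeff True = 9 / 10 * (3 + k)\<^sup>2"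
    "curvature_square ?dim chart.weyl_coeff False = 3 / 20 * (3 + k)\<^sup>2"
    unfolding curvature_square_def UNIV_bool
    by (simp_all add: weyl factor_dim_prod power2_eq_square field_simps)
  have "L1_local (components \<psi> (g_plus c)) x
      = (\<Sum>u\<in>UNIV. (48 * chart.schouten_coeff u - 8 * chart.J) * curvature_square ?dim chart.weyl_coeff u * ?dim u)"
    using chart.L1_local_eq[OF assms(2)] by (simp add: chart.G_def)
  also have "\<dots> = (48 * ((3 - chart.J) / 4) - 8 * chart.J) * (9 / 10 * (3 + k)\<^sup>2) * 2
      + (48 * ((3 * k - chart.J) / 4) - 8 * chart.J) * (3 / 20 * (3 + k)\<^sup>2) * 4"
    by (simp add: UNIV_bool square coeff factor_dim_prod)
  also have "\<dots> = 36 * (3 + k)\<^sup>2 * (1 - k)"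
  proof -
    have "(48 * ((3 - j) / 4) - 8 * j) * (9 / 10 * e) * 2 + (48 * ((3 * k - j) / 4) - 8 * j) * (3 / 20 * e) * 4
      = e * (36 * (1 - k))" if "j = (6 + 12 * k) / 10" for j e :: real
      unfolding that by (simp add: field_simps)
    from this[OF J, of "(3 + k)\<^sup>2"] show ?thesis
      by (simp only: mult_ac)
  qed
  finally show ?thesis
    by (simp add: k_def)
qed

text \<open>
  The value is the same in all parametrizations, so the choice made in the definition does not matter.
\<close>

lemma L1_density_S2xS4:
  assumes p: "p \<in> S2xS4" and c: "c > 0"
  shows "L1_density S2xS4 (g_plus c) p = 36 * (3 + inverse c)\<^sup>2 * (1 - inverse c)"
  unfolding L1_density_def
proof (rule someI2_ex)
  obtain U and \<psi> :: "real^6 \<Rightarrow> (real^3) \<times> (real^5)" where "local_param S2xS4 U \<psi>" "p \<in> \<psi> ` U"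
    using riemannian_g_plus[OF c] p unfolding riemannian_metric_def closed_submanifold_def by blast
  then show "\<exists>y U (\<psi> :: real^6 \<Rightarrow> (real^3) \<times> (real^5)). \<exists>x\<in>U.
      local_param S2xS4 U \<psi> \<and> \<psi> x = p \<and> y = L1_local (components \<psi> (g_plus c)) x"
    by blast
qed (use L1_local_S2xS4 c in blast)

text \<open>
  The spheres have the radii \<open>sqrt (1/3)\<close> and \<open>sqrt c\<close>, and the constant density is multiplied by the
  volume \<open>32 \<pi>\<^sup>3 c\<^sup>2 / 9\<close>.
\<close>

theorem L1_functional_S2xS4:
  assumes c: "c > 0"
  shows "L1_functional S2xS4 (g_plus c) = 128 * pi ^ 3 * inverse c * (3 * c + 1)\<^sup>2 * (c - 1)"
proof -
  define \<mu> :: "((real^3) \<times> (real^5)) measure" where "\<mu> = cone_measure (sqrt (1/3)) (sqrt c)"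
  have "riemannian_measure TYPE(6) (factors.sphere_product :: ((real^3) \<times> (real^5)) set)
      (factors.weighted_metric (weights ((sqrt (1/3))\<^sup>2) ((sqrt c)\<^sup>2))) = \<mu>"
    unfolding \<mu>_def
    by (rule riemannian_measure_sphere_product[where 'm = 8]) (use c in simp_all)
  then have measure: "riemannian_measure TYPE(6) S2xS4 (g_plus c) = \<mu>"
    using c by (simp add: sphere_product_eq)
  have space: "space \<mu> = S2xS4"
    by (simp add: \<mu>_def cone_measure_def space_scale_measure space_restrict_space sphere_product_eq)
  have factor: "cone_factor TYPE((real^3) \<times> (real^5)) (sqrt (1/3)) (sqrt c) = 5 * c\<^sup>2"
  proof -
    have "sqrt c ^ 4 = ((sqrt c)\<^sup>2)\<^sup>2"
      by (simp only: power_mult[symmetric]) simp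
    then show ?thesis
      using c by (simp add: cone_factor_def)
  qed
  have "emeasure \<mu> (space \<mu>) = ennreal (5 * c\<^sup>2 * (unit_ball_vol 3 * unit_ball_vol 5))"
    unfolding space unfolding sphere_product_eq[symmetric] \<mu>_def emeasure_cone_measure_total factor by simp
  then have total: "measure \<mu> (space \<mu>) = 32 * pi ^ 3 * c\<^sup>2 / 9"
    by (simp add: measure_def unit_ball_vol_3 unit_ball_vol_5 power2_eq_square power3_eq_cube)
  have "L1_functional S2xS4 (g_plus c) = (\<integral>p. 36 * (3 + inverse c)\<^sup>2 * (1 - inverse c) \<partial>\<mu>)"
    unfolding L1_functional_def measure
    by (rule Bochner_Integration.integral_cong) (simp_all add: space L1_density_S2xS4[OF _ c])
  also have "\<dots> = 32 * pi ^ 3 * c\<^sup>2 / 9 * (36 * (3 + inverse c)\<^sup>2 * (1 - inverse c))"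
    by (simp add: total)
  also have "\<dots> = 128 * pi ^ 3 * inverse c * (3 * c + 1)\<^sup>2 * (c - 1)"
  proof -
    have "3 + inverse c = inverse c * (3 * c + 1)" "1 - inverse c = inverse c * (c - 1)"
      using c by (simp_all add: field_simps)
    moreover have "c\<^sup>2 * (inverse c)\<^sup>2 = 1"
      using c by (simp add: power_mult_distrib[symmetric])
    ultimately show ?thesis
      by (simp add: power_mult_distrib)
  qed
  finally show ?thesis .
qed

lemma einstein_S2xS4: "einstein_metric TYPE(6) S2xS4 (g_plus 1)"
proof -
  have "ricci (components \<psi> (g_plus 1)) x i j = 3 * components \<psi> (g_plus 1) x $ i $ j"
    if "local_param S2xS4 U \<psi>" "x \<in> U" for U and \<psi> :: "real^6 \<Rightarrow> (real^3) \<times> (real^5)" and x i j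
  proof -
    interpret chart: sphere_product_chart prod_pr U \<psi> "weights (1/3) 1"
      by (rule chart_S2xS4[OF that(1)]) simp
    have "ricci chart.G x i j = 3 * chart.G x $ i $ j"
      unfolding chart.ricci_eq[OF that(2)] chart.G_eq_sum_S by (simp add: UNIV_bool weights_def factor_dim_prod)
    then show ?thesis
      by (simp add: chart.G_def)
  qed
  then show ?thesis
    unfolding einstein_metric_def Let_def using riemannian_g_plus[of 1] by auto
qed

text \<open>
  Variation in the direction of the metric of the second factor stays in the family \<open>g_plus\<close>, and the
  explicit value of the functional has the derivative \<open>128 \<pi>\<^sup>3 \<cdot> 4\<^sup>2\<close> at \<open>c = 1\<close>.
\<close>

lemma not_critical_S2xS4: "\<not> critical_metric TYPE(6) S2xS4 (L1_functional S2xS4) (g_plus 1)"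
proof
  let ?v = "factors.weighted_metric (weights 0 1) :: ((real^3) \<times> (real^5)) two_tensor"
  let ?F = "\<lambda>t. 128 * pi ^ 3 * inverse (1 + t) * (3 * (1 + t) + 1)\<^sup>2 * ((1 + t) - 1)"
  assume "critical_metric TYPE(6) S2xS4 (L1_functional S2xS4) (g_plus 1)"
  then have "((\<lambda>t. L1_functional S2xS4 (\<lambda>p u w. g_plus 1 p u w + t * ?v p u w)) has_real_derivative 0) (at 0)"
    unfolding critical_metric_def using factors.smooth_symmetric_weighted_metric by blast
  moreover have "(\<lambda>p u w. g_plus 1 p u w + t * ?v p u w) = g_plus (1 + t)" for t
    by (simp add: fun_eq_iff weighted_metric_eq weights_def algebra_simps)
  ultimately have "((\<lambda>t. L1_functional S2xS4 (g_plus (1 + t))) has_real_derivative 0) (at 0)"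
    by simp
  then have "(?F has_real_derivative 0) (at 0)"
  proof (rule has_field_derivative_transform_within_open)
    show "open {-1<..<(1::real)}" "0 \<in> {-1<..<(1::real)}"
      by simp_all
    show "L1_functional S2xS4 (g_plus (1 + t)) = ?F t" if "t \<in> {-1<..<1}" for t
      using that by (intro L1_functional_S2xS4) simp
  qed
  moreover have "(?F has_real_derivative 128 * pi ^ 3 * 16) (at 0)"
    by (auto intro!: derivative_eq_intros)
  ultimately have "0 = 128 * pi ^ 3 * 16"
    by (rule DERIV_unique)
  then show False
    by simp
qed

theorem proposition5p3:
  fixes S2 :: "(real^3) set" and g :: "(real^3) two_tensor"
    and S4 :: "(real^5) set" and h :: "(real^5) two_tensor"
  assumes S2: "S2 = sphere 0 1" and g: "g = round_metric 3"
    and S4: "S4 = sphere 0 1" and h: "h = round_metric 1"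
  shows "constant_sectional_curvature TYPE(2) S2 g 3 \<and>
         constant_sectional_curvature TYPE(4) S4 h 1 \<and>
         (\<forall>c>0. riemannian_metric TYPE(6) (S2 \<times> S4) (product_metric g (scale_metric c h)) \<and>
           L1_functional (S2 \<times> S4) (product_metric g (scale_metric c h))
             = 128 * pi ^ 3 * inverse c * (3 * c + 1)\<^sup>2 * (c - 1)) \<and>
         einstein_metric TYPE(6) (S2 \<times> S4) (product_metric g h) \<and>
         \<not> critical_metric TYPE(6) (S2 \<times> S4) (L1_functional (S2 \<times> S4)) (product_metric g h)"
  unfolding S2 S4 g h product_metric_eq product_metric_eq_1
  using riemannian_g_plus L1_functional_S2xS4 einstein_S2xS4 not_critical_S2xS4
  by (auto intro!: constant_sectional_curvature_round)

end
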